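(* Let $A$ and $B$ be groups with solvable conjugacy problem. Let $a$ be a super-critical element of $A$ and let $b$ be a non-self-conjugate and power-search-solvable element of $B$, such that $a\mapsto b$ induces an isomorphism $\langle a\rangle\cong\langle b\rangle$. Then the free product of $A$ and $B$ amalgamating $a$ and $b$ has a solvable conjugacy problem.
   Context: Groups are given by presentations. A group has solvable conjugacy problem if there is an algorithm deciding, for two words in the generators, whether they represent conjugate elements. The free product of $A$ and $B$ amalgamating $a$ and $b$ is the group generated by the generators of $A$ and of $B$ subject to the relations of $A$, the relations of $B$, and the relation $a=b$, where $\langle a\rangle\cong\langle b\rangle$ via $a\mapsto b$. Let $h$ be an element of a group $\Gamma$. - $h$ is *non-self-conjugate* if its distinct powers are in different conjugacy classes of $\Gamma$. - $h$ is *power-search-solvable* if for any $w\in\Gamma$ one can (algorithmically) decide whether $w$ is a power of $h$ and, if so, determine the power. - $h$ is *conjugate-power-search-solvable* if for any $w\in\Gamma$ one can decide whether or not $w$ is conjugate to a power of $h$ and, if it is, find which power of $h$ it is conjugate to; if there is more than one such power, then there are finitely many and one can find them all. - $h$ is *double-coset-search-solvable* if for any pair $u,v\in\Gamma$ one can decide whether or not there exist integers $r$ and $s$ such that $h^r u h^s=v$ and, if such $r$ and $s$ exist, one can find them; if there are many such values, there are finitely many, and one can find them all. - $h$ is *super-critical* if (a′) $h$ is non-self-conjugate; (b′) $h$ is conjugate-power-search-solvable; (c′) $h$ is double-coset-search-solvable; and (d′) for every integer $m\neq 0$ and every $u\in\Gamma$, if $h^m u=u h^m$ then $u$ is a power of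 $h$. *)

theory Defs
  imports "HOL-Algebra.Elementary_Groups" "HOL-Library.Nat_Bijection"
begin

section \<open>Recursive functions\<close>

text \<open>
  Total recursive functions of one argument; functions of several arguments are handled through
  Cantor pairing. Since pairing and its projections are primitive recursive, this is the usual
  class of total recursive functions (closure under minimisation of regular functions).
\<close>

inductive recursive_fun :: "(nat \<Rightarrow> nat) \<Rightarrow> bool" where
  zero: "recursive_fun (\<lambda>_. 0)"
| suc: "recursive_fun Suc"
| proj1: "recursive_fun (\<lambda>n. fst (prod_decode n))"
| proj2: "recursive_fun (\<lambda>n. snd (prod_decode n))"
| pair: "recursive_fun f \<Longrightarrow> recursive_fun g \<Longrightarrow>
    recursive_fun (\<lambda>n. prod_encode (f n, g n))"
| comp: "recursive_fun f \<Longrightarrow> recursive_fun g \<Longrightarrow> recursive_fun (\<lambda>n. f (g n))"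
| prim_rec: "recursive_fun f \<Longrightarrow> recursive_fun g \<Longrightarrow>
    recursive_fun (\<lambda>n. rec_nat (f (fst (prod_decode n)))
      (\<lambda>i r. g (prod_encode (fst (prod_decode n), prod_encode (i, r))))
      (snd (prod_decode n)))"
| minimize: "recursive_fun f \<Longrightarrow> (\<And>n. \<exists>m. f (prod_encode (n, m)) = 0) \<Longrightarrow>
    recursive_fun (\<lambda>n. LEAST m. f (prod_encode (n, m)) = 0)"


section \<open>Words and presentations\<close>

text \<open>The letter \<open>(x, False)\<close> is the generator \<open>x\<close>, and \<open>(x, True)\<close> is its formal inverse.\<close>

type_synonym letter = "nat \<times> bool"
type_synonym word = "letter list"

definition inv_word :: "word \<Rightarrow> word" where
  "inv_word w = rev (map (\<lambda>(x, e). (x, \<not> e)) w)"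

definition word_code :: "word \<Rightarrow> nat" where
  "word_code w = list_encode (map (\<lambda>(x, e). prod_encode (x, of_bool e)) w)"

text \<open>
  Generators are natural numbers, so that words can be input to an algorithm; neither generators
  nor relators are required to be finite in number.
\<close>

datatype presentation = Presentation (gens: "nat set") (rels: "word set")

definition words :: "presentation \<Rightarrow> word set" where
  "words P = lists (gens P \<times> UNIV)"

definition wf_presentation :: "presentation \<Rightarrow> bool" where
  "wf_presentation P \<longleftrightarrow> rels P \<subseteq> words P"

inductive word_eq :: "presentation \<Rightarrow> word \<Rightarrow> word \<Rightarrow> bool" for P where
  refl: "u \<in> words P \<Longrightarrow> word_eq P u u"
| sym: "word_eq P u v \<Longrightarrow> word_eq P v u"
| trans: "word_eq P u v \<Longrightarrow> word_eq P v w \<Longrightarrow> word_eq P u w"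
| cancel: "u \<in> words P \<Longrightarrow> v \<in> words P \<Longrightarrow> x \<in> gens P \<Longrightarrow>
    word_eq P (u @ [(x, e), (x, \<not> e)] @ v) (u @ v)"
| relator: "u \<in> words P \<Longrightarrow> v \<in> words P \<Longrightarrow> r \<in> rels P \<Longrightarrow> r \<in> words P \<Longrightarrow>
    word_eq P (u @ r @ v) (u @ v)"

definition elt :: "presentation \<Rightarrow> word \<Rightarrow> word set" where
  "elt P w = {v. word_eq P w v}"

definition presented_group :: "presentation \<Rightarrow> word set monoid" where
  "presented_group P = \<lparr>carrier = elt P ` words P,
     monoid.mult = (\<lambda>U V. \<Union>u\<in>U. \<Union>v\<in>V. elt P (u @ v)),
     one = elt P []\<rparr>"

lemma words_simps [simp]:
  "[] \<in> words P"
  "u @ v \<in> words P \<longleftrightarrow> u \<in> words P \<and> v \<in> words P"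
  "(x, e) # u \<in> words P \<longleftrightarrow> x \<in> gens P \<and> u \<in> words P"
  by (auto simp: words_def)

lemma inv_word_simps [simp]:
  "inv_word [] = []"
  "inv_word ((x, e) # u) = inv_word u @ [(x, \<not> e)]"
  by (auto simp: inv_word_def)

lemma inv_word_in_words [simp]: "u \<in> words P \<Longrightarrow> inv_word u \<in> words P"
  by (induction u) auto

lemma word_eq_in_words: "word_eq P u v \<Longrightarrow> u \<in> words P \<and> v \<in> words P"
  by (induction rule: word_eq.induct) auto

lemma word_eq_context:
  "word_eq P u v \<Longrightarrow> p \<in> words P \<Longrightarrow> q \<in> words P \<Longrightarrow> word_eq P (p @ u @ q) (p @ v @ q)"
proof (induction rule: word_eq.induct)
  case (refl u)
  then show ?case by (intro word_eq.refl) auto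
next
  case (sym u v)
  then show ?case by (blast intro: word_eq.sym)
next
  case (trans u v w)
  then show ?case by (blast intro: word_eq.trans)
next
  case (cancel u v x e)
  then show ?case using word_eq.cancel[of "p @ u" P "v @ q" x e] by simp
next
  case (relator u v r)
  then show ?case using word_eq.relator[of "p @ u" P "v @ q" r] by simp
qed

lemma word_eq_append:
  assumes "word_eq P u u'" "word_eq P v v'"
  shows "word_eq P (u @ v) (u' @ v')"
proof (rule word_eq.trans)
  show "word_eq P (u @ v) (u' @ v)"
    using word_eq_context[OF assms(1), of "[]" v] word_eq_in_words[OF assms(2)] by simp
  show "word_eq P (u' @ v) (u' @ v')"
    using word_eq_context[OF assms(2), of u' "[]"] word_eq_in_words[OF assms(1)] by simp
qed

lemma elt_eq_iff: "u \<in> words P \<Longrightarrow> elt P u = elt P v \<longleftrightarrow> word_eq P u v"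
  unfolding elt_def by (blast intro: word_eq.refl word_eq.sym word_eq.trans)

lemma elt_mult:
  assumes "u \<in> words P" "v \<in> words P"
  shows "elt P u \<otimes>\<^bsub>presented_group P\<^esub> elt P v = elt P (u @ v)"
proof -
  have *: "elt P (u' @ v') = elt P (u @ v)" if "u' \<in> elt P u" "v' \<in> elt P v" for u' v'
  proof -
    have "word_eq P (u @ v) (u' @ v')"
      using that by (intro word_eq_append) (simp_all add: elt_def)
    then show ?thesis using assms elt_eq_iff[of "u @ v" P "u' @ v'"] by simp
  qed
  have "u \<in> elt P u" "v \<in> elt P v"
    using assms by (simp_all add: elt_def word_eq.refl)
  then have "(\<Union>u'\<in>elt P u. \<Union>v'\<in>elt P v. elt P (u' @ v')) = elt P (u @ v)"
    using * by blast
  then show ?thesis by (simp add: presented_group_def)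
qed

lemma inv_word_left: "u \<in> words P \<Longrightarrow> word_eq P (inv_word u @ u) []"
proof (induction u)
  case Nil
  then show ?case by (simp add: word_eq.refl)
next
  case (Cons l u)
  obtain x e where l: "l = (x, e)" by (cases l)
  have "word_eq P (inv_word u @ [(x, \<not> e), (x, \<not> \<not> e)] @ u) (inv_word u @ u)"
    using Cons.prems l by (intro word_eq.cancel) auto
  then have "word_eq P (inv_word (l # u) @ l # u) (inv_word u @ u)"
    using l by simp
  moreover have "word_eq P (inv_word u @ u) []"
    using Cons l by simp
  ultimately show ?case by (rule word_eq.trans)
qed

lemma group_presented_group: "group (presented_group P)"
proof (rule groupI)
  show "\<one>\<^bsub>presented_group P\<^esub> \<in> carrier (presented_group P)"
    by (auto simp: presented_group_def)
next
  fix x y assume "x \<in> carrier (presented_group P)" "y \<in> carrier (presented_group P)"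
  then obtain u v where "u \<in> words P" "v \<in> words P" "x = elt P u" "y = elt P v"
    by (auto simp: presented_group_def)
  then show "x \<otimes>\<^bsub>presented_group P\<^esub> y \<in> carrier (presented_group P)"
    by (simp add: elt_mult) (simp add: presented_group_def)
next
  fix x y z
  assume "x \<in> carrier (presented_group P)" "y \<in> carrier (presented_group P)"
    "z \<in> carrier (presented_group P)"
  then obtain u v w where "u \<in> words P" "v \<in> words P" "w \<in> words P"
    "x = elt P u" "y = elt P v" "z = elt P w"
    by (auto simp: presented_group_def)
  then show "x \<otimes>\<^bsub>presented_group P\<^esub> y \<otimes>\<^bsub>presented_group P\<^esub> z =
      x \<otimes>\<^bsub>presented_group P\<^esub> (y \<otimes>\<^bsub>presented_group P\<^esub> z)"
    by (simp add: elt_mult)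
next
  fix x assume "x \<in> carrier (presented_group P)"
  then obtain u where u: "u \<in> words P" "x = elt P u"
    by (auto simp: presented_group_def)
  have one: "\<one>\<^bsub>presented_group P\<^esub> = elt P []"
    by (simp add: presented_group_def)
  show "\<one>\<^bsub>presented_group P\<^esub> \<otimes>\<^bsub>presented_group P\<^esub> x = x"
    using u by (simp add: one elt_mult)
  have "elt P (inv_word u) \<otimes>\<^bsub>presented_group P\<^esub> x = \<one>\<^bsub>presented_group P\<^esub>"
    using u inv_word_left[OF u(1)] by (simp add: one elt_mult elt_eq_iff)
  moreover have "elt P (inv_word u) \<in> carrier (presented_group P)"
    using u by (simp add: presented_group_def)
  ultimately show "\<exists>y\<in>carrier (presented_group P).
      y \<otimes>\<^bsub>presented_group P\<^esub> x = \<one>\<^bsub>presented_group P\<^esub>" ..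
qed


section \<open>Amalgamated free products\<close>

text \<open>Generators are made disjoint by numbering those of the factors through \<open>sum_encode\<close>.\<close>

definition left_word :: "word \<Rightarrow> word" where
  "left_word w = map (\<lambda>(x, e). (sum_encode (Inl x), e)) w"

definition right_word :: "word \<Rightarrow> word" where
  "right_word w = map (\<lambda>(x, e). (sum_encode (Inr x), e)) w"

definition amalgam :: "presentation \<Rightarrow> word \<Rightarrow> presentation \<Rightarrow> word \<Rightarrow> presentation" where
  "amalgam P a Q b = Presentation
     ((\<lambda>x. sum_encode (Inl x)) ` gens P \<union> (\<lambda>x. sum_encode (Inr x)) ` gens Q)
     (left_word ` rels P \<union> right_word ` rels Q \<union> {left_word a @ inv_word (right_word b)})"


section \<open>Conjugacy and decision problems\<close>

definition conjugate :: "('g, 'm) monoid_scheme \<Rightarrow> 'g \<Rightarrow> 'g \<Rightarrow> bool" where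
  "conjugate G x y \<longleftrightarrow> (\<exists>g\<in>carrier G. y = g \<otimes>\<^bsub>G\<^esub> x \<otimes>\<^bsub>G\<^esub> inv\<^bsub>G\<^esub> g)"

definition powers :: "('g, 'm) monoid_scheme \<Rightarrow> 'g \<Rightarrow> 'g set" where
  "powers G h = range (\<lambda>k::int. h [^]\<^bsub>G\<^esub> k)"

definition non_self_conjugate :: "('g, 'm) monoid_scheme \<Rightarrow> 'g \<Rightarrow> bool" where
  "non_self_conjugate G h \<longleftrightarrow>
     (\<forall>x\<in>powers G h. \<forall>y\<in>powers G h. x \<noteq> y \<longrightarrow> \<not> conjugate G x y)"

definition solvable_conjugacy_problem :: "presentation \<Rightarrow> bool" where
  "solvable_conjugacy_problem P \<longleftrightarrow>
     (\<exists>f. recursive_fun f \<and>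
       (\<forall>u\<in>words P. \<forall>v\<in>words P.
          f (prod_encode (word_code u, word_code v)) =
            (if conjugate (presented_group P) (elt P u) (elt P v) then 1 else 0)))"

text \<open>In the next definition, output \<open>0\<close> means ``not a power''.\<close>

definition power_search_solvable :: "presentation \<Rightarrow> word set \<Rightarrow> bool" where
  "power_search_solvable P h \<longleftrightarrow>
     (\<exists>f. recursive_fun f \<and>
       (\<forall>w\<in>words P.
          if elt P w \<in> powers (presented_group P) h
          then \<exists>k::int. f (word_code w) = Suc (int_encode k) \<and>
                 elt P w = h [^]\<^bsub>presented_group P\<^esub> k
          else f (word_code w) = 0))"

text \<open>
  A power of \<open>h\<close> is a group element, output as one exponent or several; for \<open>h\<close> of infinite order
  powers and exponents correspond. The output list is empty exactly when \<open>w\<close> is not conjugate to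
  a power of \<open>h\<close>.
\<close>

definition conjugate_power_search_solvable :: "presentation \<Rightarrow> word set \<Rightarrow> bool" where
  "conjugate_power_search_solvable P h \<longleftrightarrow>
     (\<exists>f. recursive_fun f \<and>
       (\<forall>w\<in>words P.
          let S = {x \<in> powers (presented_group P) h. conjugate (presented_group P) (elt P w) x}
          in finite S \<and>
             (\<exists>ks :: int list. f (word_code w) = list_encode (map int_encode ks) \<and>
                (\<lambda>k. h [^]\<^bsub>presented_group P\<^esub> k) ` set ks = S)))"

text \<open>
  If \<open>h\<^sup>r u h\<^sup>s = v\<close> and \<open>u\<close> is a power of \<open>h\<close>, then also \<open>h\<^sup>r\<^sup>+\<^sup>t u h\<^sup>s\<^sup>-\<^sup>t = v\<close> for every \<open>t\<close>, so the
  solution set is never both nonempty and finite. Finiteness is therefore demanded only for \<open>u\<close>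
  outside the subgroup generated by \<open>h\<close>; on that subgroup the algorithm still decides solvability
  and finds solutions.
\<close>

definition double_coset_search_solvable :: "presentation \<Rightarrow> word set \<Rightarrow> bool" where
  "double_coset_search_solvable P h \<longleftrightarrow>
     (\<exists>f. recursive_fun f \<and>
       (\<forall>u\<in>words P. \<forall>v\<in>words P.
          let S = {(r :: int, s :: int).
                    h [^]\<^bsub>presented_group P\<^esub> r \<otimes>\<^bsub>presented_group P\<^esub> elt P u
                      \<otimes>\<^bsub>presented_group P\<^esub> h [^]\<^bsub>presented_group P\<^esub> s = elt P v}
          in (elt P u \<notin> powers (presented_group P) h \<longrightarrow> finite S) \<and>
             (\<exists>L. f (prod_encode (word_code u, word_code v)) =
                    list_encode (map (\<lambda>(r, s). prod_encode (int_encode r, int_encode s)) L) \<and>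
                  set L \<subseteq> S \<and>
                  (S \<noteq> {} \<longrightarrow> L \<noteq> []) \<and>
                  (finite S \<longrightarrow> set L = S))))"

definition super_critical :: "presentation \<Rightarrow> word set \<Rightarrow> bool" where
  "super_critical P h \<longleftrightarrow>
     non_self_conjugate (presented_group P) h \<and>
     conjugate_power_search_solvable P h \<and>
     double_coset_search_solvable P h \<and>
     (\<forall>m::int. m \<noteq> 0 \<longrightarrow> (\<forall>u\<in>carrier (presented_group P).
        h [^]\<^bsub>presented_group P\<^esub> m \<otimes>\<^bsub>presented_group P\<^esub> u =
          u \<otimes>\<^bsub>presented_group P\<^esub> h [^]\<^bsub>presented_group P\<^esub> m \<longrightarrow>
        u \<in> powers (presented_group P) h))"

end

theory Submission
  imports Defs
begin

text \<open>
  Elements of the amalgam are brought, by exact computation with exponents of the amalgamated element,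
  to reduced form and then to cyclically reduced form. The power searches in both factors make
  this effective, and solve the word problem. Two elements of factors are conjugate in the amalgam
  iff they are conjugate in one factor or both are conjugate, each in its own factor, to the same
  power of the amalgamated element: a chain of conjugacies through the amalgamated subgroup never
  changes the power, since powers are non-self-conjugate. Two cyclically reduced elements of
  length at least two are conjugate iff a rotation of one is carried to the other by a power
  \<open>a\<^sup>r\<close>; comparing the first syllables \<open>u\<close> and \<open>v\<close>, taken in \<open>A\<close>, shows that \<open>r\<close> occurs in a
  solution of \<open>a\<^sup>r u a\<^sup>s = v\<close>, so only finitely many \<open>r\<close> need to be tried. If \<open>a\<close> has finite order,
  the finiteness of these solution sets forces \<open>A\<close> to be generated by \<open>a\<close>, and then no syllable
  lies in \<open>A\<close> outside the amalgamated subgroup.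
\<close>

section \<open>Computable functions between encoded types\<close>

text \<open>An element of the amalgam is a class of words, so nothing prevents a reduced expression
  from collapsing a priori. Van der Waerden's device rules this out: the amalgam acts on formal
  normal forms, and the sides of the syllables reached from the empty normal form are an invariant,
  \<open>shape\<close>. Apart from injectivity of the factors, the conjugacy arguments use only this
  invariant, never uniqueness of the syllables themselves. Exponents are a second difficulty. As
  \<open>h\<close> may have finite order, a power does not determine its exponent. The action
  therefore works with canonical exponents (\<open>can\<close>), the reduction process is specified
  by a relation (\<open>push_rel\<close>), and an exponent passes from one factor to the other only
  through \<open>h_pow_eq\<close>. A power search in \<open>A\<close> is not among the given
  algorithms. It is recovered from the list of powers conjugate to \<open>w\<close>: if
  \<open>w\<close> is itself a power of \<open>a\<close>, non-self-conjugacy leaves only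
  \<open>w\<close> in that list.\<close>

class coded =
  fixes encode :: "'a \<Rightarrow> nat"

instantiation nat :: coded
begin
definition "encode_nat = (\<lambda>n::nat. n)"
instance ..
end

instantiation bool :: coded
begin
definition "encode_bool = (of_bool :: bool \<Rightarrow> nat)"
instance ..
end

instantiation int :: coded
begin
definition "encode_int = int_encode"
instance ..
end

instantiation prod :: (coded, coded) coded
begin
definition "encode_prod = (\<lambda>(x, y). prod_encode (encode x, encode y))"
instance ..
end

instantiation list :: (coded) coded
begin
definition "encode_list = (\<lambda>xs. list_encode (map encode xs))"
instance ..
end

instantiation option :: (coded) coded
begin
definition "encode_option = (\<lambda>x. case x of None \<Rightarrow> 0 | Some y \<Rightarrow> Suc (encode y))"
instance ..
end

lemma encode_simps [simp]:
  "encode (n :: nat) = n"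
  "encode False = 0" "encode True = Suc 0"
  "encode (x, y) = prod_encode (encode x, encode y)"
  "encode [] = 0" "encode (z # zs) = Suc (prod_encode (encode z, encode zs))"
  "encode None = 0" "encode (Some u) = Suc (encode u)"
  by (simp_all add: encode_nat_def encode_bool_def encode_prod_def encode_list_def
      encode_option_def)

lemma word_code_eq_encode: "word_code w = encode w"
  by (auto simp: word_code_def encode_list_def encode_prod_def encode_nat_def encode_bool_def
      split_def)

text \<open>The recursive function is constrained on codes only. Its values elsewhere are free, so
  encodings that are not onto, such as that of \<open>bool\<close>, cause no trouble.\<close>

definition computable :: "('a::coded \<Rightarrow> 'b::coded) \<Rightarrow> bool" where
  "computable f \<longleftrightarrow> (\<exists>g. recursive_fun g \<and> (\<forall>x. g (encode x) = encode (f x)))"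

lemma computableI: "recursive_fun g \<Longrightarrow> (\<And>x. g (encode x) = encode (f x)) \<Longrightarrow> computable f"
  unfolding computable_def by blast

text \<open>The identity is not a base function, but packing the two projections of a number gives
  the number back.\<close>

lemma recursive_fun_id: "recursive_fun (\<lambda>n. n)"
  using recursive_fun.comp[OF recursive_fun.proj1 recursive_fun.pair[OF recursive_fun.proj1 recursive_fun.zero]]
    recursive_fun.comp[OF recursive_fun.proj1
      recursive_fun.comp[OF recursive_fun.pair[OF recursive_fun.pair[OF recursive_fun.proj1 recursive_fun.proj2]
        recursive_fun.zero] recursive_fun.pair[OF recursive_fun.proj1 recursive_fun.proj2]]]
  by (simp add: comp_def)

lemma recursive_fun_const: "recursive_fun (\<lambda>_. k)"
proof (induction k)
  case (Suc k)
  then show ?case using recursive_fun.comp[OF recursive_fun.suc Suc] by simp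
qed (rule recursive_fun.zero)

text \<open>A case distinction is a primitive recursion whose step ignores the recursive value and
  uses only the counter.\<close>

lemma recursive_fun_case_nat:
  assumes f: "recursive_fun f" and g: "recursive_fun g" and n: "recursive_fun n"
  shows "recursive_fun (\<lambda>m. case n m of 0 \<Rightarrow> f m | Suc k \<Rightarrow> g (prod_encode (m, k)))"
proof -
  let ?p = "\<lambda>m. fst (prod_decode m)" and ?q = "\<lambda>m. snd (prod_decode m)"
  note [intro] = recursive_fun.proj1 recursive_fun.proj2
  have "recursive_fun (\<lambda>m. g (prod_encode (?p m, ?p (?q m))))"
    using g by (auto intro!: recursive_fun.comp[of g] recursive_fun.pair recursive_fun.comp[of ?p ?q])
  from recursive_fun.comp[OF recursive_fun.prim_rec[OF f this] recursive_fun.pair[OF recursive_fun_id n]]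
  have "recursive_fun (\<lambda>m. rec_nat (f m) (\<lambda>i r. g (prod_encode (m, i))) (n m))"
    by simp
  moreover have "rec_nat (f m) (\<lambda>i r. g (prod_encode (m, i))) k =
      (case k of 0 \<Rightarrow> f m | Suc k \<Rightarrow> g (prod_encode (m, k)))" for m k
    by (cases k) auto
  ultimately show ?thesis by simp
qed

section \<open>Closure properties of computable functions\<close>

named_theorems computable_intros

lemma computable_ident [computable_intros]: "computable (\<lambda>x. x)"
  by (rule computableI[OF recursive_fun_id]) simp

lemma computable_const [computable_intros]: "computable (\<lambda>_. c)"
  by (rule computableI[OF recursive_fun_const]) simp

text \<open>Kept out of \<open>computable_intros\<close>: its conclusion unifies with every
  computability goal, so it is only used with an instantiated premise.\<close>

lemma computable_compose:
  assumes "computable f" "computable g"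
  shows "computable (\<lambda>x. f (g x))"
proof -
  obtain F G where "recursive_fun F" "recursive_fun G" "\<And>x. F (encode x) = encode (f x)"
    "\<And>x. G (encode x) = encode (g x)"
    using assms unfolding computable_def by blast
  then show ?thesis by (intro computableI[OF recursive_fun.comp[of F G]]) auto
qed

lemma computable_Pair [computable_intros]:
  assumes "computable f" "computable g"
  shows "computable (\<lambda>x. (f x, g x))"
proof -
  obtain F G where "recursive_fun F" "recursive_fun G" "\<And>x. F (encode x) = encode (f x)"
    "\<And>x. G (encode x) = encode (g x)"
    using assms unfolding computable_def by blast
  then show ?thesis by (intro computableI[OF recursive_fun.pair[of F G]]) auto
qed

lemma computable_fst [computable_intros]: "computable f \<Longrightarrow> computable (\<lambda>x. fst (f x))"
  by (rule computable_compose[of fst], rule computableI[OF recursive_fun.proj1]) auto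

lemma computable_snd [computable_intros]: "computable f \<Longrightarrow> computable (\<lambda>x. snd (f x))"
  by (rule computable_compose[of snd], rule computableI[OF recursive_fun.proj2]) auto

lemma computable_Suc [computable_intros]: "computable f \<Longrightarrow> computable (\<lambda>x. Suc (f x))"
  by (rule computable_compose[of Suc], rule computableI[OF recursive_fun.suc]) auto

lemma computable_encode [computable_intros]: "computable f \<Longrightarrow> computable (\<lambda>x. encode (f x))"
  by (rule computable_compose[of encode], rule computableI[OF recursive_fun_id]) auto

lemma computable_Cons [computable_intros]:
  assumes "computable f" "computable g"
  shows "computable (\<lambda>x. f x # g x)"
proof -
  have "computable (\<lambda>p. fst p # snd p)"
    by (rule computableI[OF recursive_fun.suc]) auto
  from computable_compose[OF this computable_Pair[OF assms]] show ?thesis by simp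
qed

text \<open>
  The codes of \<open>y # ys\<close>, \<open>Some y\<close> and \<open>True\<close> are the successors of those of \<open>(y, ys)\<close>, \<open>y\<close>
  and \<open>0\<close>, so one case distinction on natural numbers serves all these types.
\<close>
lemma computable_case:
  fixes l :: "'a::coded \<Rightarrow> 'c::coded" and d :: "'c \<Rightarrow> 'd::coded" and t :: "'a \<Rightarrow> 'b::coded"
  assumes "computable l" "computable a" "computable b"
    and "\<And>x. (encode (l x) = 0 \<and> t x = a x) \<or>
              (\<exists>y. encode (l x) = Suc (encode y) \<and> t x = b (x, y :: 'd))"
  shows "computable t"
proof -
  obtain L A B where *: "recursive_fun L" "recursive_fun A" "recursive_fun B"
    "\<And>x. L (encode x) = encode (l x)" "\<And>x. A (encode x) = encode (a x)"
    "\<And>x. B (encode x) = encode (b x)"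
    using assms unfolding computable_def by metis
  show ?thesis
  proof (rule computableI[OF recursive_fun_case_nat[OF *(2,3,1)]])
    fix x
    show "(case L (encode x) of 0 \<Rightarrow> A (encode x) | Suc k \<Rightarrow> B (prod_encode (encode x, k))) =
        encode (t x)"
      using assms(4)[of x]
    proof
      assume "\<exists>y. encode (l x) = Suc (encode y) \<and> t x = b (x, y :: 'd)"
      then obtain y where "encode (l x) = Suc (encode y)" "t x = b (x, y :: 'd)" by blast
      moreover have "B (prod_encode (encode x, encode y)) = encode (b (x, y))"
        using *(6)[of "(x, y)"] by simp
      ultimately show ?thesis by (simp add: *)
    qed (simp add: *)
  qed
qed

lemma computable_if [computable_intros]:
  fixes a :: "'a::coded \<Rightarrow> 'b::coded"
  assumes "computable c" "computable a" "computable b"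
  shows "computable (\<lambda>x. if c x then a x else b x)"
proof (rule computable_case[OF assms(1,3)])
  show "computable (\<lambda>p :: 'a \<times> nat. a (fst p))"
    by (intro computable_compose[OF assms(2)] computable_intros)
qed (use encode_simps(1) in \<open>auto intro!: exI[of _ "0 :: nat"]\<close>)

text \<open>A branch with bound variables is assumed computable after uncurrying, with the ambient
  argument \<open>x\<close> as first component. The same convention in the later rules lets iterated
  functions depend on parameters.\<close>

lemma computable_case_list [computable_intros]:
  assumes "computable l" "computable a" "computable (\<lambda>p. b (fst p) (fst (snd p)) (snd (snd p)))"
  shows "computable (\<lambda>x. case l x of [] \<Rightarrow> a x | y # ys \<Rightarrow> b x y ys)"
proof (rule computable_case[OF assms])
  fix x
  show "encode (l x) = 0 \<and> (case l x of [] \<Rightarrow> a x | y # ys \<Rightarrow> b x y ys) = a x \<or>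
    (\<exists>y. encode (l x) = Suc (encode y) \<and> (case l x of [] \<Rightarrow> a x | y # ys \<Rightarrow> b x y ys) =
         b (fst (x, y)) (fst (snd (x, y))) (snd (snd (x, y))))"
  proof (cases "l x")
    case (Cons y ys)
    then show ?thesis by (intro disjI2 exI[of _ "(y, ys)"]) simp
  qed simp
qed

lemma computable_case_option [computable_intros]:
  assumes "computable l" "computable a" "computable (\<lambda>p. b (fst p) (snd p))"
  shows "computable (\<lambda>x. case l x of None \<Rightarrow> a x | Some y \<Rightarrow> b x y)"
  by (rule computable_case[OF assms]) (auto split: option.split)

lemma computable_Some [computable_intros]:
  assumes "computable f"
  shows "computable (\<lambda>x. Some (f x))"
proof (rule computable_compose[OF _ assms, of Some])
  show "computable Some" by (rule computableI[OF recursive_fun.suc]) simp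
qed

lemma computable_rec_nat [computable_intros]:
  assumes "computable n" "computable f" "computable (\<lambda>p. g (fst p) (fst (snd p)) (snd (snd p)))"
  shows "computable (\<lambda>x. rec_nat (f x) (\<lambda>i r. g x i r) (n x))"
proof -
  obtain N F R where *: "recursive_fun N" "recursive_fun F" "recursive_fun R"
    "\<And>x. N (encode x) = n x" "\<And>x. F (encode x) = encode (f x)"
    "\<And>p. R (encode p) = encode (g (fst p) (fst (snd p)) (snd (snd p)))"
    using assms unfolding computable_def encode_simps(1) by metis
  have R: "R (prod_encode (encode x, prod_encode (i, encode r))) = encode (g x i r)" for x i r
    using *(6)[of "(x, i, r)"] by simp
  from recursive_fun.comp[OF recursive_fun.prim_rec[OF *(2,3)]
      recursive_fun.pair[OF recursive_fun_id *(1)]]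
  have "recursive_fun (\<lambda>m. rec_nat (F m) (\<lambda>i r. R (prod_encode (m, prod_encode (i, r)))) (N m))"
    by simp
  then show ?thesis
  proof (rule computableI)
    fix x
    have "rec_nat (F (encode x)) (\<lambda>i r. R (prod_encode (encode x, prod_encode (i, r)))) k =
        encode (rec_nat (f x) (g x) k)" for k
      by (induction k) (simp_all add: * R)
    then show "rec_nat (F (encode x)) (\<lambda>i r. R (prod_encode (encode x, prod_encode (i, r))))
        (N (encode x)) = encode (rec_nat (f x) (\<lambda>i r. g x i r) (n x))"
      by (simp add: *)
  qed
qed

lemma computable_funpow [computable_intros]:
  fixes f :: "'a::coded \<Rightarrow> 'b::coded \<Rightarrow> 'b"
  assumes "computable n" "computable s" "computable (\<lambda>p. f (fst p) (snd p))"
  shows "computable (\<lambda>x. (f x ^^ n x) (s x))"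
proof -
  have "(f x ^^ k) y = rec_nat y (\<lambda>_ r. f x r) k" for x k y
    by (induction k) auto
  then show ?thesis
    by (simp only:) (intro computable_intros assms
        computable_compose[OF assms(3), of "\<lambda>p. (fst p, snd (snd p))", simplified])
qed

section \<open>Computability of list operations\<close>

lemma length_le_encode: "length xs \<le> encode xs"
proof (induction xs)
  case (Cons x xs)
  then show ?case using le_prod_encode_2[of "encode xs" "encode x"] by simp
qed simp

text \<open>The fold iterates a step that consumes one list element and fixes the empty list.
  Running it too often is harmless, so the code of the list, which is at least its length, can serve
  as iteration count.\<close>

lemma computable_foldl [computable_intros]:
  assumes "computable l" "computable s" "computable (\<lambda>p. g (fst p) (fst (snd p)) (snd (snd p)))"
  shows "computable (\<lambda>x. foldl (\<lambda>r y. g x r y) (s x) (l x))"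
proof -
  define step where "step x = (\<lambda>p. case fst p of [] \<Rightarrow> p | y # ys \<Rightarrow> (ys, g x (snd p) y))" for x
  have stop: "(step x ^^ n) ([], r) = ([], r)" for x n r
    by (induction n) (simp_all add: step_def)
  have "length ys \<le> n \<Longrightarrow> (step x ^^ n) (ys, r) = ([], foldl (g x) r ys)" for x n ys r
  proof (induction ys arbitrary: n r)
    case (Cons y ys)
    then obtain m where "n = Suc m" "length ys \<le> m" by (cases n) auto
    then show ?case
      using Cons.IH[of m] by (simp add: funpow_Suc_right step_def del: funpow.simps)
  qed (simp add: stop)
  then have "(\<lambda>x. foldl (\<lambda>r y. g x r y) (s x) (l x)) =
      (\<lambda>x. snd ((step x ^^ encode (l x)) (l x, s x)))"
    by (simp add: length_le_encode)
  moreover have "computable (\<lambda>x. snd ((step x ^^ encode (l x)) (l x, s x)))"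
    unfolding step_def
    by (intro computable_intros assms
      computable_compose[OF assms(3), of "\<lambda>q. (fst (fst q), snd (snd (fst q)), fst (snd q))", simplified])
  ultimately show ?thesis by simp
qed

lemma computable_rev [computable_intros]:
  assumes "computable (f :: _ \<Rightarrow> 'b::coded list)"
  shows "computable (\<lambda>x. rev (f x))"
proof -
  have "foldl (\<lambda>r y. y # r) zs ys = rev ys @ zs" for ys zs :: "'b list"
    by (induction ys arbitrary: zs) auto
  then have "rev ys = foldl (\<lambda>r y. y # r) [] ys" for ys :: "'b list"
    by simp
  then show ?thesis
    by (simp only:) (intro computable_intros assms)
qed

lemma computable_foldr [computable_intros]:
  assumes "computable l" "computable s" "computable (\<lambda>p. g (fst p) (fst (snd p)) (snd (snd p)))"
  shows "computable (\<lambda>x. foldr (\<lambda>y r. g x y r) (l x) (s x))"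
  unfolding foldr_conv_foldl
  by (intro computable_intros assms
      computable_compose[OF assms(3), of "\<lambda>p. (fst p, snd (snd p), fst (snd p))", simplified])

lemma computable_append [computable_intros]:
  assumes "computable f" "computable g"
  shows "computable (\<lambda>x. f x @ g x)"
proof -
  have "f x @ g x = foldr (\<lambda>y r. y # r) (f x) (g x)" for x
    by (induction "f x" rule: rev_induct) (simp_all add: foldr_conv_fold fold_Cons_rev)
  then show ?thesis
    by (simp only:) (intro computable_intros assms)
qed

lemma computable_map [computable_intros]:
  assumes "computable l" "computable (\<lambda>p. g (fst p) (snd p))"
  shows "computable (\<lambda>x. map (\<lambda>y. g x y) (l x))"
proof -
  have "map (g x) ys = foldr (\<lambda>y r. g x y # r) ys []" for x ys
    by (induction ys) auto
  then show ?thesis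
    by (simp only:) (intro computable_intros assms
        computable_compose[OF assms(2), of "\<lambda>p. (fst p, fst (snd p))", simplified])
qed

lemma computable_not [computable_intros]:
  assumes "computable f"
  shows "computable (\<lambda>x. \<not> f x)"
proof -
  have "(\<not> f x) = (if f x then False else True)" for x
    by simp
  then show ?thesis
    by (simp only:) (intro computable_intros assms)
qed

lemma computable_conj [computable_intros]:
  assumes "computable f" "computable g"
  shows "computable (\<lambda>x. f x \<and> g x)"
proof -
  have "(f x \<and> g x) = (if f x then g x else False)" for x
    by simp
  then show ?thesis
    by (simp only:) (intro computable_intros assms)
qed

lemma computable_disj [computable_intros]:
  assumes "computable f" "computable g"
  shows "computable (\<lambda>x. f x \<or> g x)"
proof -
  have "(f x \<or> g x) = (if f x then True else g x)" for x
    by simp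
  then show ?thesis
    by (simp only:) (intro computable_intros assms)
qed

lemma computable_iff [computable_intros]:
  assumes "computable f" "computable g"
  shows "computable (\<lambda>x. f x = (g x :: bool))"
proof -
  have "(f x = g x) = (if f x then g x else \<not> g x)" for x
    by auto
  then show ?thesis
    by (simp only:) (intro computable_intros assms)
qed

lemma computable_list_ex [computable_intros]:
  assumes "computable l" "computable (\<lambda>p. g (fst p) (snd p))"
  shows "computable (\<lambda>x. list_ex (\<lambda>y. g x y) (l x))"
proof -
  have "list_ex (g x) ys = foldr (\<lambda>y r. g x y \<or> r) ys False" for x ys
    by (induction ys) auto
  then show ?thesis
    by (simp only:) (intro computable_intros assms
        computable_compose[OF assms(2), of "\<lambda>p. (fst p, fst (snd p))", simplified])
qed

lemma computable_half [computable_intros]: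
  assumes "computable (f :: _ \<Rightarrow> nat)"
  shows "computable (\<lambda>x. f x div 2)" "computable (\<lambda>x. even (f x))"
proof -
  \<comment> \<open>Quotient and parity come from one recursion: the quotient grows exactly when the
    parity turns from odd to even.\<close>
  define R where "R = (\<lambda>n. rec_nat (0 :: nat, True)
    (\<lambda>_ p. if snd p then (fst p, False) else (Suc (fst p), True)) n)"
  have R: "R n = (n div 2, even n)" for n
    by (induction n) (auto simp: R_def)
  have "computable R"
    unfolding R_def by (intro computable_intros)
  from computable_fst[OF computable_compose[OF this assms]]
    computable_snd[OF computable_compose[OF this assms]]
  show "computable (\<lambda>x. f x div 2)" "computable (\<lambda>x. even (f x))"
    by (simp_all add: R)
qed

lemma computable_length [computable_intros]:
  assumes "computable (f :: _ \<Rightarrow> 'b::coded list)"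
  shows "computable (\<lambda>x. length (f x))"
proof -
  have "length ys = foldr (\<lambda>_ r. Suc r) ys 0" for ys :: "'b list"
    by (induction ys) auto
  then show ?thesis
    by (simp only:) (intro computable_intros assms)
qed

lemma computable_inv_word [computable_intros]:
  assumes "computable f"
  shows "computable (\<lambda>x. inv_word (f x))"
  unfolding inv_word_def split_def by (intro computable_intros assms)

lemma computable_null [computable_intros]:
  assumes "computable f"
  shows "computable (\<lambda>x. f x = [])"
proof -
  have "(f x = []) = (case f x of [] \<Rightarrow> True | y # ys \<Rightarrow> False)" for x
    by (auto split: list.split)
  then show ?thesis
    by (simp only:) (intro computable_intros assms)
qed

lemma computable_rotate [computable_intros]:
  assumes "computable n" "computable (f :: _ \<Rightarrow> 'b::coded list)"
  shows "computable (\<lambda>x. rotate (n x) (f x))"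
proof -
  have r: "rotate1 = (\<lambda>ys :: 'b list. case ys of [] \<Rightarrow> [] | z # zs \<Rightarrow> zs @ [z])"
    by (auto simp: fun_eq_iff split: list.split)
  show ?thesis
    unfolding rotate_def r by (intro computable_intros assms)
qed

lemma computable_upt [computable_intros]:
  assumes "computable n"
  shows "computable (\<lambda>x. [0..<n x])"
proof -
  have "[0..<k] = rec_nat [] (\<lambda>i r. r @ [i]) k" for k
    by (induction k) auto
  then show ?thesis
    by (simp only:) (intro computable_intros assms)
qed

section \<open>Action on normal forms\<close>

abbreviation alternating :: "(bool \<times> 'a) list \<Rightarrow> bool" where
  "alternating \<equiv> successively (\<lambda>s t. fst s \<noteq> fst t)"

text \<open>The amalgamated subgroup enters only through exponents: by \<open>h_pow_eq\<close> its
  copies satisfy the same equations between powers, so a power is carried to another factor by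
  keeping its exponent. Indexing the factors by \<open>bool\<close> lets one lemma serve both
  sides.\<close>

locale factor_groups =
  fixes F :: "bool \<Rightarrow> 'a monoid" and h :: "bool \<Rightarrow> 'a"
  assumes group_F [simp]: "group (F \<sigma>)"
    and h_carrier [simp]: "h \<sigma> \<in> carrier (F \<sigma>)"
    and h_pow_eq: "h \<sigma> [^]\<^bsub>F \<sigma>\<^esub> (i::int) = h \<sigma> [^]\<^bsub>F \<sigma>\<^esub> (j::int) \<Longrightarrow> h \<tau> [^]\<^bsub>F \<tau>\<^esub> i = h \<tau> [^]\<^bsub>F \<tau>\<^esub> j"
begin

abbreviation pw :: "bool \<Rightarrow> int \<Rightarrow> 'a" where
  "pw \<sigma> k \<equiv> h \<sigma> [^]\<^bsub>F \<sigma>\<^esub> k"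

abbreviation edge :: "bool \<Rightarrow> 'a set" where
  "edge \<sigma> \<equiv> powers (F \<sigma>) (h \<sigma>)"

definition reduced :: "(bool \<times> 'a) list \<Rightarrow> bool" where
  "reduced L \<longleftrightarrow> (\<forall>s\<in>set L. snd s \<in> carrier (F (fst s)) - edge (fst s)) \<and> alternating L"

lemma monoid_F [simp]: "monoid (F \<sigma>)"
  using group_F group.is_monoid by blast

lemma F_closed [simp]:
  "x \<in> carrier (F \<sigma>) \<Longrightarrow> y \<in> carrier (F \<sigma>) \<Longrightarrow> x \<otimes>\<^bsub>F \<sigma>\<^esub> y \<in> carrier (F \<sigma>)"
  "\<one>\<^bsub>F \<sigma>\<^esub> \<in> carrier (F \<sigma>)"
  "x \<in> carrier (F \<sigma>) \<Longrightarrow> inv\<^bsub>F \<sigma>\<^esub> x \<in> carrier (F \<sigma>)"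
  by (simp_all add: monoid.m_closed group.inv_closed)

lemma pw_carrier [simp]: "pw \<sigma> k \<in> carrier (F \<sigma>)"
  by (simp add: group.int_pow_closed)

lemma pw_add: "pw \<sigma> (i + j) = pw \<sigma> i \<otimes>\<^bsub>F \<sigma>\<^esub> pw \<sigma> j"
  by (simp add: group.int_pow_mult)

lemma pw_uminus: "pw \<sigma> (- i) = inv\<^bsub>F \<sigma>\<^esub> pw \<sigma> i"
  by (simp add: group.int_pow_neg)

lemma pw_edge [simp]: "pw \<sigma> k \<in> edge \<sigma>"
  by (simp add: powers_def)

lemma edgeE: assumes "x \<in> edge \<sigma>" obtains k where "x = pw \<sigma> k"
  using assms by (auto simp: powers_def)

lemma pw_cancel [simp]:
  assumes "x \<in> carrier (F \<sigma>)"
  shows "pw \<sigma> (- k) \<otimes>\<^bsub>F \<sigma>\<^esub> (pw \<sigma> k \<otimes>\<^bsub>F \<sigma>\<^esub> x) = x"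
    "x \<otimes>\<^bsub>F \<sigma>\<^esub> pw \<sigma> k \<otimes>\<^bsub>F \<sigma>\<^esub> pw \<sigma> (- k) = x"
    "pw \<sigma> k \<otimes>\<^bsub>F \<sigma>\<^esub> (pw \<sigma> (- k) \<otimes>\<^bsub>F \<sigma>\<^esub> x) = x"
  using assms
  by (simp_all add: pw_uminus group.inv_solve_left monoid.m_assoc group.r_inv
      monoid.m_assoc[symmetric] group.l_inv)

lemma edge_mult [simp]:
  assumes "x \<in> carrier (F \<sigma>)"
  shows "pw \<sigma> k \<otimes>\<^bsub>F \<sigma>\<^esub> x \<in> edge \<sigma> \<longleftrightarrow> x \<in> edge \<sigma>"
    "x \<otimes>\<^bsub>F \<sigma>\<^esub> pw \<sigma> k \<in> edge \<sigma> \<longleftrightarrow> x \<in> edge \<sigma>"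
proof -
  have "x \<in> edge \<sigma>" if "pw \<sigma> k \<otimes>\<^bsub>F \<sigma>\<^esub> x \<in> edge \<sigma>"
    using that pw_cancel(1)[OF assms, of k] by (metis edgeE pw_add pw_edge)
  then show "pw \<sigma> k \<otimes>\<^bsub>F \<sigma>\<^esub> x \<in> edge \<sigma> \<longleftrightarrow> x \<in> edge \<sigma>"
    by (metis edgeE pw_add pw_edge)
  have "x \<in> edge \<sigma>" if "x \<otimes>\<^bsub>F \<sigma>\<^esub> pw \<sigma> k \<in> edge \<sigma>"
    using that pw_cancel(2)[OF assms, of k] by (metis edgeE pw_add pw_edge)
  then show "x \<otimes>\<^bsub>F \<sigma>\<^esub> pw \<sigma> k \<in> edge \<sigma> \<longleftrightarrow> x \<in> edge \<sigma>"
    by (metis edgeE pw_add pw_edge)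
qed

lemma edge_inv [simp]:
  assumes "x \<in> carrier (F \<sigma>)"
  shows "inv\<^bsub>F \<sigma>\<^esub> x \<in> edge \<sigma> \<longleftrightarrow> x \<in> edge \<sigma>"
  by (metis assms edgeE group.inv_inv group_F pw_edge pw_uminus)

text \<open>States must be equal as pairs whenever they denote the same normal form, so one exponent
  is fixed for each power. The choice made on side \<open>True\<close> is valid on both sides by
  \<open>h_pow_eq\<close>.\<close>

definition can :: "int \<Rightarrow> int" where
  "can k = (SOME j. pw True j = pw True k)"

lemma pw_can [simp]: "pw \<sigma> (can k) = pw \<sigma> k"
proof -
  have "pw True (can k) = pw True k"
    unfolding can_def by (rule someI[of _ k]) simp
  then show ?thesis by (rule h_pow_eq)
qed

lemma can_eq: "pw \<sigma> i = pw \<sigma> j \<Longrightarrow> can i = can j"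
  unfolding can_def using h_pow_eq[of \<sigma> i j True] by simp

text \<open>The choice is made from the right coset as a set, so it depends on the coset alone. This
  is what \<open>rep_mult\<close> rests on: shifting the exponent only re-indexes the same
  set.\<close>

definition rep :: "bool \<Rightarrow> 'a \<Rightarrow> 'a" where
  "rep \<sigma> x = (SOME y. y \<in> (\<lambda>k. pw \<sigma> k \<otimes>\<^bsub>F \<sigma>\<^esub> x) ` UNIV)"

definition expo :: "bool \<Rightarrow> 'a \<Rightarrow> 'a \<Rightarrow> int" where
  "expo \<sigma> x y = can (SOME k. x = pw \<sigma> k \<otimes>\<^bsub>F \<sigma>\<^esub> y)"

lemma rep_cases: obtains k where "rep \<sigma> x = pw \<sigma> k \<otimes>\<^bsub>F \<sigma>\<^esub> x"
proof -
  have "rep \<sigma> x \<in> (\<lambda>k. pw \<sigma> k \<otimes>\<^bsub>F \<sigma>\<^esub> x) ` UNIV"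
    unfolding rep_def by (rule someI_ex) auto
  then show ?thesis using that by blast
qed

lemma rep_carrier [simp]: "x \<in> carrier (F \<sigma>) \<Longrightarrow> rep \<sigma> x \<in> carrier (F \<sigma>)"
  by (metis F_closed(1) pw_carrier rep_cases)

lemma rep_edge [simp]: "x \<in> carrier (F \<sigma>) \<Longrightarrow> rep \<sigma> x \<in> edge \<sigma> \<longleftrightarrow> x \<in> edge \<sigma>"
  by (metis edge_mult(1) rep_cases)

lemma rep_mult [simp]:
  assumes "x \<in> carrier (F \<sigma>)"
  shows "rep \<sigma> (pw \<sigma> k \<otimes>\<^bsub>F \<sigma>\<^esub> x) = rep \<sigma> x"
proof -
  have "pw \<sigma> j \<otimes>\<^bsub>F \<sigma>\<^esub> (pw \<sigma> k \<otimes>\<^bsub>F \<sigma>\<^esub> x) = pw \<sigma> (j + k) \<otimes>\<^bsub>F \<sigma>\<^esub> x" for j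
    using assms by (simp add: pw_add monoid.m_assoc)
  moreover have "pw \<sigma> j \<otimes>\<^bsub>F \<sigma>\<^esub> x \<in> range (\<lambda>j. pw \<sigma> (j + k) \<otimes>\<^bsub>F \<sigma>\<^esub> x)" for j
    by (rule range_eqI[of _ _ "j - k"]) simp
  then have "range (\<lambda>j. pw \<sigma> (j + k) \<otimes>\<^bsub>F \<sigma>\<^esub> x) = range (\<lambda>j. pw \<sigma> j \<otimes>\<^bsub>F \<sigma>\<^esub> x)"
    by auto
  ultimately show ?thesis by (simp only: rep_def)
qed

lemma rep_rep [simp]: "x \<in> carrier (F \<sigma>) \<Longrightarrow> rep \<sigma> (rep \<sigma> x) = rep \<sigma> x"
  by (metis rep_cases rep_mult)

text \<open>The exponent picked by \<open>SOME\<close> may differ from \<open>k\<close>, but it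
  gives the same power, and \<open>can\<close> removes the difference.\<close>

lemma expo_mult:
  assumes "y \<in> carrier (F \<sigma>)"
  shows "expo \<sigma> (pw \<sigma> k \<otimes>\<^bsub>F \<sigma>\<^esub> y) y = can k"
proof -
  define j where "j = (SOME j. pw \<sigma> k \<otimes>\<^bsub>F \<sigma>\<^esub> y = pw \<sigma> j \<otimes>\<^bsub>F \<sigma>\<^esub> y)"
  have "pw \<sigma> k \<otimes>\<^bsub>F \<sigma>\<^esub> y = pw \<sigma> j \<otimes>\<^bsub>F \<sigma>\<^esub> y"
    unfolding j_def by (rule someI[of _ k]) simp
  then have "pw \<sigma> k = pw \<sigma> j"
    using assms by (simp add: group.right_cancel)
  then have "can k = can j" by (rule can_eq)
  then show ?thesis by (simp add: expo_def j_def)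
qed

lemma expo_rep:
  assumes "x \<in> carrier (F \<sigma>)"
  shows "pw \<sigma> (expo \<sigma> x (rep \<sigma> x)) \<otimes>\<^bsub>F \<sigma>\<^esub> rep \<sigma> x = x"
proof -
  obtain k where "rep \<sigma> x = pw \<sigma> k \<otimes>\<^bsub>F \<sigma>\<^esub> x" by (rule rep_cases)
  then have "x = pw \<sigma> (- k) \<otimes>\<^bsub>F \<sigma>\<^esub> rep \<sigma> x"
    using assms by simp
  then show ?thesis
    using expo_mult[of "rep \<sigma> x" \<sigma> "- k"] assms by simp
qed

type_synonym 'b state = "int \<times> (bool \<times> 'b) list"

text \<open>The state \<open>(k, [r\<^sub>1, ..., r\<^sub>n])\<close> encodes the normal form \<open>h\<^sup>k r\<^sub>1 ... r\<^sub>n\<close> in which every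
  \<open>r\<^sub>i\<close> is the chosen representative of its right coset of the subgroup generated by \<open>h\<close>.\<close>
definition states :: "'a state set" where
  "states = {(k, L). can k = k \<and> reduced L \<and> (\<forall>s\<in>set L. rep (fst s) (snd s) = snd s)}"

text \<open>The longest prefix of the normal form that lies in \<open>F \<sigma>\<close> is gathered
  into one element; it is the bare power if the first syllable is on the other side.\<close>

definition join :: "bool \<Rightarrow> 'a state \<Rightarrow> 'a \<times> (bool \<times> 'a) list" where
  "join \<sigma> \<omega> = (case snd \<omega> of
      [] \<Rightarrow> (pw \<sigma> (fst \<omega>), [])
    | s # L \<Rightarrow> if fst s = \<sigma> then (pw \<sigma> (fst \<omega>) \<otimes>\<^bsub>F \<sigma>\<^esub> snd s, L) else (pw \<sigma> (fst \<omega>), s # L))"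

definition split :: "bool \<Rightarrow> 'a \<times> (bool \<times> 'a) list \<Rightarrow> 'a state" where
  "split \<sigma> p = (if fst p \<in> edge \<sigma> then (expo \<sigma> (fst p) \<one>\<^bsub>F \<sigma>\<^esub>, snd p)
     else (expo \<sigma> (fst p) (rep \<sigma> (fst p)), (\<sigma>, rep \<sigma> (fst p)) # snd p))"

definition act :: "bool \<Rightarrow> 'a \<Rightarrow> 'a state \<Rightarrow> 'a state" where
  "act \<sigma> x \<omega> = split \<sigma> (x \<otimes>\<^bsub>F \<sigma>\<^esub> fst (join \<sigma> \<omega>), snd (join \<sigma> \<omega>))"

text \<open>\<open>split\<close> and \<open>join\<close> identify the states with these pairs, on which the factor \<open>F \<sigma>\<close>
  acts by left multiplication.\<close>
definition split_states :: "bool \<Rightarrow> ('a \<times> (bool \<times> 'a) list) set" where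
  "split_states \<sigma> = {(x, L). x \<in> carrier (F \<sigma>) \<and> reduced L \<and>
     (\<forall>s\<in>set L. rep (fst s) (snd s) = snd s) \<and> (L \<noteq> [] \<longrightarrow> fst (hd L) \<noteq> \<sigma>)}"

section \<open>The action of one factor on states\<close>

lemma reduced_Nil [simp]: "reduced []"
  by (simp add: reduced_def)

lemma reduced_Cons: "reduced (s # L) \<longleftrightarrow> snd s \<in> carrier (F (fst s)) - edge (fst s) \<and>
    reduced L \<and> (L \<noteq> [] \<longrightarrow> fst (hd L) \<noteq> fst s)"
  by (auto simp: reduced_def successively_Cons)

lemma can_expo [simp]: "can (expo \<sigma> x y) = expo \<sigma> x y"
  unfolding expo_def using can_eq[OF pw_can] .

lemma pw_expo_one: "x \<in> edge \<sigma> \<Longrightarrow> pw \<sigma> (expo \<sigma> x \<one>\<^bsub>F \<sigma>\<^esub>) = x"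
  using expo_mult[of "\<one>\<^bsub>F \<sigma>\<^esub>" \<sigma>] by (auto elim!: edgeE simp: monoid.r_one)

lemma join_in: "\<omega> \<in> states \<Longrightarrow> join \<sigma> \<omega> \<in> split_states \<sigma>"
  by (auto simp: states_def split_states_def join_def reduced_Cons split: list.splits)

lemma split_in: "p \<in> split_states \<sigma> \<Longrightarrow> split \<sigma> p \<in> states"
  by (auto simp: states_def split_states_def split_def reduced_Cons)

lemma join_split: "p \<in> split_states \<sigma> \<Longrightarrow> join \<sigma> (split \<sigma> p) = p"
  by (auto simp: split_states_def split_def join_def expo_rep pw_expo_one split: list.splits)

lemma split_join:
  assumes "\<omega> \<in> states"
  shows "split \<sigma> (join \<sigma> \<omega>) = \<omega>"
proof -
  have "expo \<sigma> (pw \<sigma> k) \<one>\<^bsub>F \<sigma>\<^esub> = can k" for k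
    using expo_mult[of "\<one>\<^bsub>F \<sigma>\<^esub>" \<sigma> k] by (simp add: monoid.r_one)
  then show ?thesis
    using assms
    by (auto simp: states_def split_def join_def reduced_Cons expo_mult split: list.splits)
qed

lemma split_states_mult:
  "p \<in> split_states \<sigma> \<Longrightarrow> x \<in> carrier (F \<sigma>) \<Longrightarrow> (x \<otimes>\<^bsub>F \<sigma>\<^esub> fst p, snd p) \<in> split_states \<sigma>"
  by (auto simp: split_states_def)

lemma act_in: "\<omega> \<in> states \<Longrightarrow> x \<in> carrier (F \<sigma>) \<Longrightarrow> act \<sigma> x \<omega> \<in> states"
  unfolding act_def by (intro split_in split_states_mult join_in)

lemma act_act:
  assumes "\<omega> \<in> states" "x \<in> carrier (F \<sigma>)" "y \<in> carrier (F \<sigma>)"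
  shows "act \<sigma> x (act \<sigma> y \<omega>) = act \<sigma> (x \<otimes>\<^bsub>F \<sigma>\<^esub> y) \<omega>"
proof -
  have "fst (join \<sigma> \<omega>) \<in> carrier (F \<sigma>)"
    using join_in[OF assms(1), of \<sigma>] by (auto simp: split_states_def)
  then show ?thesis
    using assms join_split[OF split_states_mult[OF join_in[OF assms(1)] assms(3)]]
    by (simp add: act_def monoid.m_assoc)
qed

lemma act_one: "\<omega> \<in> states \<Longrightarrow> act \<sigma> \<one>\<^bsub>F \<sigma>\<^esub> \<omega> = \<omega>"
  using join_in[of \<omega> \<sigma>] split_join[of \<omega> \<sigma>]
  by (cases "join \<sigma> \<omega>") (auto simp: act_def split_states_def monoid.l_one)

text \<open>The result does not mention \<open>\<sigma>\<close>: the two factor actions agree on the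
  amalgamated subgroup. This is what makes the amalgamating relator act trivially.\<close>

lemma act_pw:
  assumes "(j, L) \<in> states"
  shows "act \<sigma> (pw \<sigma> k) (j, L) = (can (k + j), L)"
proof -
  have *: "expo \<sigma> (pw \<sigma> k) \<one>\<^bsub>F \<sigma>\<^esub> = can k" for k
    using expo_mult[of "\<one>\<^bsub>F \<sigma>\<^esub>" \<sigma> k] by (simp add: monoid.r_one)
  show ?thesis
  proof (cases "L \<noteq> [] \<and> fst (hd L) = \<sigma>")
    case True
    then obtain x M where L: "L = (\<sigma>, x) # M" by (cases L) auto
    have x: "x \<in> carrier (F \<sigma>)" "x \<notin> edge \<sigma>" "rep \<sigma> x = x"
      using assms by (auto simp: L states_def reduced_Cons)
    have "pw \<sigma> k \<otimes>\<^bsub>F \<sigma>\<^esub> (pw \<sigma> j \<otimes>\<^bsub>F \<sigma>\<^esub> x) = pw \<sigma> (k + j) \<otimes>\<^bsub>F \<sigma>\<^esub> x"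
      using x by (simp add: pw_add monoid.m_assoc)
    then show ?thesis using x by (simp add: act_def join_def split_def L expo_mult)
  next
    case False
    then have "join \<sigma> (j, L) = (pw \<sigma> j, L)"
      by (auto simp: join_def split: list.splits)
    then show ?thesis by (simp add: act_def split_def * pw_add[symmetric])
  qed
qed

text \<open>No cancellation can occur: \<open>join\<close> finds only a power on side
  \<open>\<sigma>\<close>, and \<open>x\<close> times a power stays outside
  \<open>edge \<sigma>\<close>, so \<open>split\<close> prepends a syllable.\<close>

lemma act_shape:
  assumes "(j, M) \<in> states" "M \<noteq> [] \<longrightarrow> fst (hd M) \<noteq> \<sigma>" "x \<in> carrier (F \<sigma>) - edge \<sigma>"
  shows "map fst (snd (act \<sigma> x (j, M))) = \<sigma> # map fst M"
proof -
  have "join \<sigma> (j, M) = (pw \<sigma> j, M)"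
    using assms(2) by (auto simp: join_def split: list.splits)
  then show ?thesis using assms(3) by (simp add: act_def split_def)
qed

text \<open>Left multiplication on \<open>split_states\<close> is free. At the empty normal form
  this will show that the factors embed in the amalgam.\<close>

lemma act_inj:
  assumes "\<omega> \<in> states" "x \<in> carrier (F \<sigma>)" "y \<in> carrier (F \<sigma>)" "act \<sigma> x \<omega> = act \<sigma> y \<omega>"
  shows "x = y"
proof -
  have c: "fst (join \<sigma> \<omega>) \<in> carrier (F \<sigma>)"
    using join_in[OF assms(1), of \<sigma>] by (auto simp: split_states_def)
  have "join \<sigma> (act \<sigma> x \<omega>) = join \<sigma> (act \<sigma> y \<omega>)"
    using assms(4) by simp
  then have "x \<otimes>\<^bsub>F \<sigma>\<^esub> fst (join \<sigma> \<omega>) = y \<otimes>\<^bsub>F \<sigma>\<^esub> fst (join \<sigma> \<omega>)"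
    using assms by (simp add: act_def join_split split_states_mult join_in)
  then show ?thesis using c assms by (simp add: group.right_cancel)
qed

section \<open>The action of lists of syllables\<close>

definition acts :: "(bool \<times> 'a) list \<Rightarrow> 'a state \<Rightarrow> 'a state" where
  "acts L = foldr (\<lambda>s. act (fst s) (snd s)) L"

lemma acts_simps [simp]:
  "acts [] \<omega> = \<omega>" "acts (s # L) \<omega> = act (fst s) (snd s) (acts L \<omega>)"
  "acts (L @ M) \<omega> = acts L (acts M \<omega>)"
  by (simp_all add: acts_def)

lemma acts_in:
  "\<forall>s\<in>set L. snd s \<in> carrier (F (fst s)) \<Longrightarrow> \<omega> \<in> states \<Longrightarrow> acts L \<omega> \<in> states"
  by (induction L) (auto intro!: act_in)

text \<open>The heart of the normal form theorem. Only sides are compared, because the syllables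
  themselves change when powers are moved to the left and representatives are inserted.\<close>

lemma acts_shape:
  "reduced L \<Longrightarrow> (k, []) \<in> states \<Longrightarrow> map fst (snd (acts L (k, []))) = map fst L"
proof (induction L)
  case (Cons s L)
  obtain j M where jM: "acts L (k, []) = (j, M)" by fastforce
  have M: "map fst M = map fst L"
    using Cons jM by (simp add: reduced_Cons)
  have "M \<noteq> [] \<Longrightarrow> fst (hd M) = fst (hd L)" using M by (metis list.map_sel(1) map_is_Nil_conv)
  moreover have "(j, M) \<in> states"
    unfolding jM[symmetric] using Cons.prems by (intro acts_in) (auto simp: reduced_def)
  ultimately show ?case
    using Cons.prems act_shape[of j M "fst s" "snd s"] M by (auto simp: reduced_Cons jM)
qed simp

end

section \<open>Conjugacy in an amalgamated product\<close>

lemma (in group) conjugate_refl: "x \<in> carrier G \<Longrightarrow> conjugate G x x"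
  unfolding conjugate_def by (rule bexI[of _ \<one>]) auto

lemma (in group) conjugate_sym:
  assumes "conjugate G x y" "x \<in> carrier G"
  shows "conjugate G y x"
proof -
  obtain g where "g \<in> carrier G" "y = g \<otimes> x \<otimes> inv g"
    using assms(1) by (auto simp: conjugate_def)
  then have "x = inv g \<otimes> y \<otimes> inv (inv g)"
    using assms(2) by (simp add: m_assoc inv_solve_left)
  then show ?thesis
    unfolding conjugate_def by (rule bexI[OF _ inv_closed[OF \<open>g \<in> carrier G\<close>]])
qed

lemma (in group) conjugate_trans:
  assumes "conjugate G x y" "conjugate G y z" "x \<in> carrier G"
  shows "conjugate G x z"
proof -
  obtain g g' where "g \<in> carrier G" "y = g \<otimes> x \<otimes> inv g" "g' \<in> carrier G" "z = g' \<otimes> y \<otimes> inv g'"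
    using assms(1,2) by (auto simp: conjugate_def)
  then have "z = (g' \<otimes> g) \<otimes> x \<otimes> inv (g' \<otimes> g)"
    using assms(3) by (simp add: m_assoc inv_mult_group)
  then show ?thesis using \<open>g \<in> carrier G\<close> \<open>g' \<in> carrier G\<close> by (auto simp: conjugate_def)
qed

text \<open>Turns a conjugacy algorithm for a factor into an algorithm for its word problem.\<close>

lemma (in group) conjugate_iff_eq_one:
  assumes "x \<in> carrier G"
  shows "conjugate G x \<one> \<longleftrightarrow> x = \<one>"
proof
  assume "conjugate G x \<one>"
  then show "x = \<one>"
    using conjugate_sym assms by (force simp: conjugate_def)
qed (simp add: conjugate_refl)

lemma (in group) inv_mult_cancel [simp]:
  assumes "x \<in> carrier G" "y \<in> carrier G"
  shows "inv x \<otimes> (x \<otimes> y) = y" "x \<otimes> (inv x \<otimes> y) = y"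
  using assms by (simp_all add: m_assoc[symmetric])

text \<open>The side \<open>fst s\<close> of a syllable \<open>s\<close> selects the factor containing \<open>snd s\<close>.\<close>
definition syllable_prod ::
  "('g, 'm) monoid_scheme \<Rightarrow> (bool \<Rightarrow> 'a \<Rightarrow> 'g) \<Rightarrow> (bool \<times> 'a) list \<Rightarrow> 'g" where
  "syllable_prod G \<iota> L = foldr (\<lambda>s g. \<iota> (fst s) (snd s) \<otimes>\<^bsub>G\<^esub> g) L \<one>\<^bsub>G\<^esub>"

lemma alternating_ends:
  "alternating L \<Longrightarrow> L \<noteq> [] \<Longrightarrow> fst (hd L) = fst (last L) \<longleftrightarrow> odd (length L)"
  by (induction L rule: induct_list012) auto

context factor_groups
begin

section \<open>Reduced and cyclically reduced lists of syllables\<close>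

definition syllables :: "(bool \<times> 'a) list \<Rightarrow> bool" where
  "syllables L \<longleftrightarrow> (\<forall>s\<in>set L. snd s \<in> carrier (F (fst s)))"

lemma syllables_simps [simp]:
  "syllables []" "syllables (s # L) \<longleftrightarrow> snd s \<in> carrier (F (fst s)) \<and> syllables L"
  "syllables (L @ M) \<longleftrightarrow> syllables L \<and> syllables M"
  "syllables (rotate i L) \<longleftrightarrow> syllables L" "syllables (rev L) \<longleftrightarrow> syllables L"
  by (auto simp: syllables_def)

lemma reduced_syllables [simp]: "reduced L \<Longrightarrow> syllables L"
  by (simp add: reduced_def syllables_def)

lemma reduced_append: "reduced (L @ M) \<longleftrightarrow> reduced L \<and> reduced M \<and>
    (L \<noteq> [] \<longrightarrow> M \<noteq> [] \<longrightarrow> fst (last L) \<noteq> fst (hd M))"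
  by (auto simp: reduced_def successively_append_iff)

definition inv_syllables :: "(bool \<times> 'a) list \<Rightarrow> (bool \<times> 'a) list" where
  "inv_syllables L = rev (map (\<lambda>s. (fst s, inv\<^bsub>F (fst s)\<^esub> snd s)) L)"

lemma inv_syllables_simps [simp]:
  "inv_syllables [] = []"
  "inv_syllables (s # L) = inv_syllables L @ [(fst s, inv\<^bsub>F (fst s)\<^esub> snd s)]"
  "inv_syllables (L @ M) = inv_syllables M @ inv_syllables L"
  "length (inv_syllables L) = length L"
  "inv_syllables L = [] \<longleftrightarrow> L = []"
  by (simp_all add: inv_syllables_def)

lemma syllables_inv [simp]: "syllables L \<Longrightarrow> syllables (inv_syllables L)"
  by (induction L) auto

lemma last_inv_syllables: "L \<noteq> [] \<Longrightarrow> fst (last (inv_syllables L)) = fst (hd L)"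
  by (cases L) auto

lemma hd_inv_syllables: "L \<noteq> [] \<Longrightarrow> fst (hd (inv_syllables L)) = fst (last L)"
  by (induction L rule: rev_induct) auto

lemma reduced_inv [simp]: "reduced L \<Longrightarrow> reduced (inv_syllables L)"
  by (induction L) (auto simp: reduced_Cons reduced_append last_inv_syllables)

text \<open>The condition on the ends excludes length one, so these are the cyclically reduced lists
  of length at least two. Elements of a factor are treated apart.\<close>

definition cyclic :: "(bool \<times> 'a) list \<Rightarrow> bool" where
  "cyclic L \<longleftrightarrow> reduced L \<and> L \<noteq> [] \<and> fst (hd L) \<noteq> fst (last L)"

lemma cyclic_reduced [simp]: "cyclic L \<Longrightarrow> reduced L"
  by (simp add: cyclic_def)

lemma cyclic_even: "cyclic L \<Longrightarrow> even (length L)"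
  using alternating_ends[of L] by (auto simp: cyclic_def reduced_def)

lemma cyclic_rotate1:
  assumes "cyclic L"
  shows "cyclic (rotate1 L)"
proof (cases L)
  case (Cons s M)
  then have "M \<noteq> []" using assms by (auto simp: cyclic_def)
  then show ?thesis using assms Cons by (auto simp: cyclic_def reduced_Cons reduced_append)
qed (use assms in simp)

lemma cyclic_rotate [simp]: "cyclic L \<Longrightarrow> cyclic (rotate i L)"
  by (induction i) (auto simp: cyclic_rotate1)

definition factor_conj :: "bool \<Rightarrow> 'a \<Rightarrow> bool \<Rightarrow> 'a \<Rightarrow> bool" where
  "factor_conj \<sigma> x \<tau> y \<longleftrightarrow> (\<sigma> = \<tau> \<and> conjugate (F \<sigma>) x y) \<or>
     (\<exists>k. conjugate (F \<sigma>) x (pw \<sigma> k) \<and> conjugate (F \<tau>) (pw \<tau> k) y)"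

text \<open>Unlike \<open>join\<close>, this works on arbitrary reduced lists, without chosen coset
  representatives or canonical exponents, so it can be imitated on words.\<close>

definition merge :: "bool \<Rightarrow> 'a \<Rightarrow> int \<times> (bool \<times> 'a) list \<Rightarrow> 'a \<times> (bool \<times> 'a) list" where
  "merge \<sigma> x p = (case snd p of [] \<Rightarrow> (x \<otimes>\<^bsub>F \<sigma>\<^esub> pw \<sigma> (fst p), [])
     | s # L \<Rightarrow> if fst s = \<sigma> then (x \<otimes>\<^bsub>F \<sigma>\<^esub> pw \<sigma> (fst p) \<otimes>\<^bsub>F \<sigma>\<^esub> snd s, L)
         else (x \<otimes>\<^bsub>F \<sigma>\<^esub> pw \<sigma> (fst p), s # L))"

text \<open>A relation and not a function, because any exponent of the resulting power is
  acceptable. The existence proof takes an arbitrary one, the algorithm takes the one returned by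
  its power search.\<close>

definition push_rel ::
  "bool \<Rightarrow> 'a \<Rightarrow> int \<times> (bool \<times> 'a) list \<Rightarrow> int \<times> (bool \<times> 'a) list \<Rightarrow> bool" where
  "push_rel \<sigma> x p q \<longleftrightarrow> (if fst (merge \<sigma> x p) \<in> edge \<sigma>
     then fst (merge \<sigma> x p) = pw \<sigma> (fst q) \<and> snd q = snd (merge \<sigma> x p)
     else q = (0, (\<sigma>, fst (merge \<sigma> x p)) # snd (merge \<sigma> x p)))"

lemma push_rel_exists: "\<exists>q. push_rel \<sigma> x p q"
proof (cases "fst (merge \<sigma> x p) \<in> edge \<sigma>")
  case True
  then obtain k where "fst (merge \<sigma> x p) = pw \<sigma> k" by (rule edgeE)
  then have "push_rel \<sigma> x p (k, snd (merge \<sigma> x p))"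
    by (simp add: push_rel_def)
  then show ?thesis ..
next
  case False
  then have "push_rel \<sigma> x p (0, (\<sigma>, fst (merge \<sigma> x p)) # snd (merge \<sigma> x p))"
    by (simp add: push_rel_def)
  then show ?thesis ..
qed

lemma merge_reduced:
  assumes "reduced (snd p)" "x \<in> carrier (F \<sigma>)"
  shows "fst (merge \<sigma> x p) \<in> carrier (F \<sigma>)" "reduced (snd (merge \<sigma> x p))"
    "snd (merge \<sigma> x p) \<noteq> [] \<Longrightarrow> fst (hd (snd (merge \<sigma> x p))) \<noteq> \<sigma>"
  using assms by (auto simp: merge_def reduced_Cons split: list.splits if_splits)

lemma push_rel_reduced:
  assumes "push_rel \<sigma> x p q" "reduced (snd p)" "x \<in> carrier (F \<sigma>)"
  shows "reduced (snd q)"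
  using assms merge_reduced[OF assms(2,3)] unfolding push_rel_def
  by (auto simp: reduced_Cons split: if_splits)

text \<open>Merging consumes the first syllable and at most one comes back. This makes cyclic
  reduction terminate.\<close>

lemma push_rel_length:
  assumes "push_rel \<sigma> x p q" "snd p \<noteq> []" "fst (hd (snd p)) = \<sigma>"
  shows "length (snd q) \<le> length (snd p)"
proof -
  have "Suc (length (snd (merge \<sigma> x p))) = length (snd p)"
    using assms(2,3) by (cases "snd p") (auto simp: merge_def)
  then show ?thesis using assms(1) by (auto simp: push_rel_def split: if_splits)
qed

end

text \<open>This collects what the conjugacy arguments need from the presentation. As
  \<open>shape\<close> is a function on group elements, any two reduced expressions of an element
  have the same sides. The trailing power in \<open>shape_prod\<close> allows comparison up to right
  multiplication by the amalgamated subgroup, and with \<open>L\<close> empty it covers that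
  subgroup itself.\<close>

locale amalgamated = factor_groups F h + group G
  for F :: "bool \<Rightarrow> 'a monoid" and h and G (structure) +
  fixes \<iota> :: "bool \<Rightarrow> 'a \<Rightarrow> 'b" and shape :: "'b \<Rightarrow> bool list"
  assumes \<iota>_hom: "\<iota> \<sigma> \<in> hom (F \<sigma>) G"
    and \<iota>_inj: "inj_on (\<iota> \<sigma>) (carrier (F \<sigma>))"
    and \<iota>_h: "\<iota> \<sigma> (h \<sigma>) = \<iota> \<tau> (h \<tau>)"
    and generated: "g \<in> carrier G \<Longrightarrow> \<exists>L. syllables L \<and> g = syllable_prod G \<iota> L"
    and shape_prod: "reduced L \<Longrightarrow>
      shape (syllable_prod G \<iota> L \<otimes> \<iota> \<sigma> (h \<sigma> [^]\<^bsub>F \<sigma>\<^esub> (k::int))) = map fst L"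
begin

section \<open>Products of syllables and normal forms\<close>

abbreviation prod_syl ("\<pi>") where "\<pi> \<equiv> syllable_prod G \<iota>"

definition z where "z = \<iota> True (h True)"

lemma \<iota>_carrier [simp]: "x \<in> carrier (F \<sigma>) \<Longrightarrow> \<iota> \<sigma> x \<in> carrier G"
  using \<iota>_hom hom_in_carrier by fastforce

lemma \<iota>_mult [simp]:
  "x \<in> carrier (F \<sigma>) \<Longrightarrow> y \<in> carrier (F \<sigma>) \<Longrightarrow> \<iota> \<sigma> (x \<otimes>\<^bsub>F \<sigma>\<^esub> y) = \<iota> \<sigma> x \<otimes> \<iota> \<sigma> y"
  using \<iota>_hom by (auto simp: hom_def)

lemma group_hom_\<iota>: "group_hom (F \<sigma>) G (\<iota> \<sigma>)"
  by (simp add: group_hom_def group_hom_axioms_def \<iota>_hom)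

lemma \<iota>_inv [simp]: "x \<in> carrier (F \<sigma>) \<Longrightarrow> \<iota> \<sigma> (inv\<^bsub>F \<sigma>\<^esub> x) = inv (\<iota> \<sigma> x)"
  using group_hom.hom_inv[OF group_hom_\<iota>] .

lemma \<iota>_one [simp]: "\<iota> \<sigma> \<one>\<^bsub>F \<sigma>\<^esub> = \<one>"
  using group_hom.hom_one[OF group_hom_\<iota>] .

lemma z_carrier [simp]: "z \<in> carrier G"
  by (simp add: z_def)

lemma \<iota>_pw [simp]: "\<iota> \<sigma> (pw \<sigma> k) = z [^] k"
  using group_hom.hom_int_pow[OF group_hom_\<iota>, of "h \<sigma>" \<sigma> k] \<iota>_h[of \<sigma> True] by (simp add: z_def)

lemma \<iota>_eq [simp]: "x \<in> carrier (F \<sigma>) \<Longrightarrow> y \<in> carrier (F \<sigma>) \<Longrightarrow> \<iota> \<sigma> x = \<iota> \<sigma> y \<longleftrightarrow> x = y"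
  using \<iota>_inj by (auto dest: inj_onD)

lemma prod_simps [simp]:
  "\<pi> [] = \<one>" "\<pi> (s # L) = \<iota> (fst s) (snd s) \<otimes> \<pi> L"
  by (simp_all add: syllable_prod_def)

lemma prod_carrier [simp]: "syllables L \<Longrightarrow> \<pi> L \<in> carrier G"
  by (induction L) auto

lemma prod_append [simp]: "syllables L \<Longrightarrow> syllables M \<Longrightarrow> \<pi> (L @ M) = \<pi> L \<otimes> \<pi> M"
  by (induction L) (auto simp: m_assoc)

lemma prod_inv [simp]: "syllables L \<Longrightarrow> \<pi> (inv_syllables L) = inv (\<pi> L)"
  by (induction L) (auto simp: inv_mult_group)

lemma shape_right: "reduced L \<Longrightarrow> shape (\<pi> L \<otimes> z [^] (k::int)) = map fst L"
  using shape_prod[of L True k] by simp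

lemma shape_reduced: "reduced L \<Longrightarrow> shape (\<pi> L) = map fst L"
  using shape_right[of L 0] by simp

lemma shape_z: "shape (z [^] (k::int)) = []"
  using shape_right[of "[]" k] by simp

lemma shape_\<iota>: "x \<in> carrier (F \<sigma>) \<Longrightarrow> shape (\<iota> \<sigma> x) = (if x \<in> edge \<sigma> then [] else [\<sigma>])"
  using shape_reduced[of "[(\<sigma>, x)]"] by (auto simp: reduced_Cons shape_z elim!: edgeE)

lemma push_rel_prod:
  assumes "push_rel \<sigma> x p q" "reduced (snd p)" "x \<in> carrier (F \<sigma>)"
  shows "\<iota> \<sigma> x \<otimes> (z [^] fst p \<otimes> \<pi> (snd p)) = z [^] fst q \<otimes> \<pi> (snd q)"
proof -
  let ?m = "merge \<sigma> x p"
  have "\<iota> \<sigma> x \<otimes> (z [^] fst p \<otimes> \<pi> (snd p)) = \<iota> \<sigma> (fst ?m) \<otimes> \<pi> (snd ?m)"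
    using assms(2,3) by (cases "snd p") (auto simp: merge_def reduced_Cons m_assoc)
  also have "\<dots> = z [^] fst q \<otimes> \<pi> (snd q)"
  proof (cases "fst ?m \<in> edge \<sigma>")
    case True
    then have "fst ?m = pw \<sigma> (fst q)" "snd q = snd ?m"
      using assms(1) by (simp_all add: push_rel_def)
    then show ?thesis by (simp only: \<iota>_pw)
  next
    case False
    then have "q = (0, (\<sigma>, fst ?m) # snd ?m)"
      using assms(1) by (simp add: push_rel_def)
    then show ?thesis using merge_reduced[OF assms(2,3)] by simp
  qed
  finally show ?thesis .
qed

lemma normal_form_left:
  assumes "g \<in> carrier G"
  obtains k :: int and L where "reduced L" "g = z [^] k \<otimes> \<pi> L"
proof -
  have "\<exists>p. reduced (snd p) \<and> \<pi> L = z [^] (fst p :: int) \<otimes> \<pi> (snd p)" if "syllables L" for L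
    using that
  proof (induction L)
    case Nil
    then show ?case by (intro exI[of _ "(0, [])"]) simp
  next
    case (Cons s L)
    then obtain p where p: "reduced (snd p)" "\<pi> L = z [^] (fst p :: int) \<otimes> \<pi> (snd p)"
      by auto
    obtain q where "push_rel (fst s) (snd s) p q" using push_rel_exists by blast
    then show ?case
      using push_rel_reduced[of "fst s" "snd s" p q] push_rel_prod[of "fst s" "snd s" p q] p Cons.prems
      by auto
  qed
  then show ?thesis using generated[OF assms] that by fastforce
qed

text \<open>Inverting a left normal form of \<open>inv g\<close> moves the power to the right end. A
  conjugator is wanted in this form, so that its power acts first on the conjugated element.\<close>

lemma normal_form_right:
  assumes "g \<in> carrier G"
  obtains k :: int and L where "reduced L" "g = \<pi> L \<otimes> z [^] k"
proof -
  have "inv g \<in> carrier G" using assms by simp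
  then obtain k :: int and L where L: "reduced L" "inv g = z [^] k \<otimes> \<pi> L"
    by (rule normal_form_left)
  have "g = inv (z [^] k \<otimes> \<pi> L)"
    unfolding L(2)[symmetric] using assms by simp
  then have "g = \<pi> (inv_syllables L) \<otimes> z [^] (- k)"
    using L(1) by (simp add: inv_mult_group int_pow_neg)
  then show ?thesis using that[OF reduced_inv[OF L(1)]] by blast
qed

text \<open>If the quotient of the heads were not a power, it could be put before \<open>L\<close>
  as a new syllable. That reduced list would denote \<open>\<pi> M\<close> up to a power, although
  it is one syllable longer than \<open>M\<close>.\<close>

lemma equal_heads:
  assumes "reduced ((\<sigma>, x) # L)" "reduced ((\<sigma>, y) # M)"
    and eq: "\<pi> ((\<sigma>, x) # L) = \<pi> ((\<sigma>, y) # M) \<otimes> z [^] (j::int)"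
  obtains k where "x = y \<otimes>\<^bsub>F \<sigma>\<^esub> pw \<sigma> k"
proof -
  have c [simp]: "x \<in> carrier (F \<sigma>)" "y \<in> carrier (F \<sigma>)" "syllables L" "syllables M"
    "reduced L" "reduced M"
    using assms by (auto simp: reduced_Cons)
  have len: "map fst L = map fst M"
    using shape_reduced[OF assms(1)] shape_right[OF assms(2), of j] eq by simp
  let ?u = "inv\<^bsub>F \<sigma>\<^esub> y \<otimes>\<^bsub>F \<sigma>\<^esub> x"
  have "\<iota> \<sigma> ?u \<otimes> \<pi> L = inv (\<iota> \<sigma> y) \<otimes> \<pi> ((\<sigma>, x) # L)"
    by (simp add: m_assoc)
  also have "\<dots> = \<pi> M \<otimes> z [^] j"
    unfolding eq by (simp add: m_assoc)
  finally have *: "\<iota> \<sigma> ?u \<otimes> \<pi> L = \<pi> M \<otimes> z [^] j" .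
  have "?u \<in> edge \<sigma>"
  proof (rule ccontr)
    assume "?u \<notin> edge \<sigma>"
    then have "reduced ((\<sigma>, ?u) # L)"
      using assms(1) by (simp add: reduced_Cons)
    from shape_reduced[OF this] have "\<sigma> # map fst L = map fst M"
      using shape_right[of M j] * by simp
    then show False using len by simp
  qed
  then obtain k where "?u = pw \<sigma> k" by (rule edgeE)
  then have "x = y \<otimes>\<^bsub>F \<sigma>\<^esub> pw \<sigma> k"
    by (metis c(1,2) group.inv_mult_cancel(2) group_F)
  then show ?thesis by (rule that)
qed

section \<open>Conjugates of cyclically reduced elements\<close>

definition orbit :: "(bool \<times> 'a) list \<Rightarrow> 'b set" where
  "orbit L = {z [^] k \<otimes> \<pi> (rotate i L) \<otimes> inv (z [^] k) | (k::int) i. True}"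

lemma orbit_intro: "z [^] (k::int) \<otimes> \<pi> (rotate i L) \<otimes> inv (z [^] k) \<in> orbit L"
  by (auto simp: orbit_def)

text \<open>The conjugator is used up from its innermost syllable outwards. Each syllable either
  cancels against one end of the current rotation, which rotates it further, or it stays. In the
  latter case the sides of the conjugate form a list of odd length, so all that has to be remembered
  about the target is that its shape has even length.\<close>

lemma conj_orbit:
  assumes "reduced K" "cyclic L" "u \<in> orbit L" "even (length (shape (\<pi> K \<otimes> u \<otimes> inv (\<pi> K))))"
  shows "\<pi> K \<otimes> u \<otimes> inv (\<pi> K) \<in> orbit L"
  using assms
proof (induction K arbitrary: u rule: rev_induct)
  case Nil
  then have "u \<in> carrier G"
    by (auto simp: orbit_def)
  then show ?case using Nil.prems(3) by simp
next
  case (snoc s K)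
  obtain \<sigma> x where s: "s = (\<sigma>, x)" by fastforce
  have K [simp]: "reduced K" and x [simp]: "x \<in> carrier (F \<sigma>)" "x \<notin> edge \<sigma>"
    and last: "K \<noteq> [] \<Longrightarrow> fst (last K) \<noteq> \<sigma>"
    using snoc.prems(1) by (auto simp: reduced_append reduced_Cons s)
  obtain j :: int and i where u: "u = z [^] j \<otimes> \<pi> (rotate i L) \<otimes> inv (z [^] j)"
    using snoc.prems(3) by (auto simp: orbit_def)
  define N where "N = rotate i L"
  have N: "cyclic N" using snoc.prems(2) by (simp add: N_def)
  then have N_ne: "N \<noteq> []" and N_red [simp]: "reduced N" by (auto simp: cyclic_def)
  \<comment> \<open>The innermost syllable takes up the power that stands in front of the current
    rotation.\<close>
  define y where "y = x \<otimes>\<^bsub>F \<sigma>\<^esub> pw \<sigma> j"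
  have y [simp]: "y \<in> carrier (F \<sigma>)" "y \<notin> edge \<sigma>" by (simp_all add: y_def)
  define w where "w = \<iota> \<sigma> y \<otimes> \<pi> N \<otimes> inv (\<iota> \<sigma> y)"
  have v: "\<pi> (K @ [s]) \<otimes> u \<otimes> inv (\<pi> (K @ [s])) = \<pi> K \<otimes> w \<otimes> inv (\<pi> K)"
    by (simp add: u s w_def y_def N_def[symmetric] m_assoc inv_mult_group)
  \<comment> \<open>If \<open>w\<close> is an odd list that remains reduced between \<open>K\<close>
    and its inverse, the whole conjugate has odd length, against the parity assumption.\<close>
  have odd: False if M: "reduced (K @ M @ inv_syllables K)" "w = \<pi> M" "odd (length M)" "syllables M" for M
  proof -
    have "\<pi> K \<otimes> w \<otimes> inv (\<pi> K) = \<pi> (K @ M @ inv_syllables K)"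
      using M by (simp add: m_assoc)
    then have "shape (\<pi> K \<otimes> w \<otimes> inv (\<pi> K)) = map fst (K @ M @ inv_syllables K)"
      using shape_reduced[OF M(1)] by simp
    then show False using snoc.prems(4) M(3) unfolding v by simp
  qed
  have "w \<in> orbit L"
  proof (cases "fst (hd N) = \<sigma>")
    case True
    then obtain g M where NM: "N = (\<sigma>, g) # M" using N_ne by (cases N) auto
    then have M_ne: "M \<noteq> []" using N by (auto simp: cyclic_def)
    have M: "M \<noteq> []" "reduced M" "fst (last M) \<noteq> \<sigma>" "fst (hd M) \<noteq> \<sigma>"
      and g [simp]: "g \<in> carrier (F \<sigma>)"
      using N M_ne by (auto simp: NM cyclic_def reduced_Cons)
    have w: "w = \<iota> \<sigma> (y \<otimes>\<^bsub>F \<sigma>\<^esub> g) \<otimes> \<pi> M \<otimes> inv (\<iota> \<sigma> y)"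
      using M by (simp add: w_def NM m_assoc)
    show ?thesis
    proof (cases "y \<otimes>\<^bsub>F \<sigma>\<^esub> g \<in> edge \<sigma>")
      case True
      then obtain k where k: "y \<otimes>\<^bsub>F \<sigma>\<^esub> g = pw \<sigma> k" by (rule edgeE)
      then have "\<iota> \<sigma> (y \<otimes>\<^bsub>F \<sigma>\<^esub> g) = z [^] k" by (simp only: \<iota>_pw)
      \<comment> \<open>As the product of \<open>y\<close> and \<open>g\<close> is a power, the
        inverse of \<open>y\<close> is \<open>g\<close> times the inverse power: the head of
        \<open>N\<close> reappears at its end, a rotation by one place.\<close>
      moreover have "inv (\<iota> \<sigma> y) = \<iota> \<sigma> g \<otimes> inv (\<iota> \<sigma> (y \<otimes>\<^bsub>F \<sigma>\<^esub> g))"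
        by (simp add: inv_mult_group)
      ultimately have "inv (\<iota> \<sigma> y) = \<iota> \<sigma> g \<otimes> inv (z [^] k)" by (simp only:)
      then have "w = z [^] k \<otimes> \<pi> (rotate (Suc i) L) \<otimes> inv (z [^] k)"
        using M unfolding rotate_Suc N_def[symmetric] by (simp add: w k NM m_assoc)
      then show ?thesis by (simp only: orbit_intro)
    next
      case False
      have "reduced (K @ ((\<sigma>, y \<otimes>\<^bsub>F \<sigma>\<^esub> g) # M @ [(\<sigma>, inv\<^bsub>F \<sigma>\<^esub> y)]) @ inv_syllables K)"
        using M False last by (auto simp: reduced_append reduced_Cons hd_inv_syllables)
      moreover have "w = \<pi> ((\<sigma>, y \<otimes>\<^bsub>F \<sigma>\<^esub> g) # M @ [(\<sigma>, inv\<^bsub>F \<sigma>\<^esub> y)])"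
        using M by (simp add: w m_assoc)
      moreover have "odd (length ((\<sigma>, y \<otimes>\<^bsub>F \<sigma>\<^esub> g) # M @ [(\<sigma>, inv\<^bsub>F \<sigma>\<^esub> y)]))" "syllables ((\<sigma>, y \<otimes>\<^bsub>F \<sigma>\<^esub> g) # M @ [(\<sigma>, inv\<^bsub>F \<sigma>\<^esub> y)])"
        using cyclic_even[OF N] M by (auto simp: NM)
      ultimately have False by (rule odd)
      then show ?thesis ..
    qed
  next
    case False
    then have "fst (last N) = \<sigma>" using N by (auto simp: cyclic_def)
    then obtain g M where NM: "N = M @ [(\<sigma>, g)]" using N_ne by (cases N rule: rev_cases) auto
    then have M_ne: "M \<noteq> []" using N by (auto simp: cyclic_def)
    have M: "M \<noteq> []" "reduced M" "fst (last M) \<noteq> \<sigma>" "fst (hd M) \<noteq> \<sigma>"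
      and g [simp]: "g \<in> carrier (F \<sigma>)"
      using N M_ne by (auto simp: NM cyclic_def reduced_Cons reduced_append)
    let ?t = "g \<otimes>\<^bsub>F \<sigma>\<^esub> inv\<^bsub>F \<sigma>\<^esub> y"
    have w: "w = \<iota> \<sigma> y \<otimes> \<pi> M \<otimes> \<iota> \<sigma> ?t"
      using M by (simp add: w_def NM m_assoc)
    show ?thesis
    proof (cases "?t \<in> edge \<sigma>")
      case True
      then obtain k where k: "?t = pw \<sigma> k" by (rule edgeE)
      then have "\<iota> \<sigma> ?t = z [^] k" by (simp only: \<iota>_pw)
      moreover have "\<iota> \<sigma> y = inv (\<iota> \<sigma> ?t) \<otimes> \<iota> \<sigma> g"
        by (simp add: inv_mult_group m_assoc)
      ultimately have "\<iota> \<sigma> y = inv (z [^] k) \<otimes> \<iota> \<sigma> g" by (simp only:)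
      \<comment> \<open>Here the last syllable of \<open>N\<close> moves to its front, which is a
        rotation by \<open>length M\<close> places.\<close>
      moreover have "\<pi> (rotate (length M + i) L) = \<iota> \<sigma> g \<otimes> \<pi> M"
        unfolding rotate_rotate[symmetric] N_def[symmetric] NM rotate_append using M by simp
      ultimately have "w = z [^] (- k) \<otimes> \<pi> (rotate (length M + i) L) \<otimes> inv (z [^] (- k))"
        using M by (simp add: w k m_assoc int_pow_neg)
      then show ?thesis by (simp only: orbit_intro)
    next
      case False
      have "reduced (K @ ((\<sigma>, y) # M @ [(\<sigma>, ?t)]) @ inv_syllables K)"
        using M False last by (auto simp: reduced_append reduced_Cons hd_inv_syllables)
      moreover have "w = \<pi> ((\<sigma>, y) # M @ [(\<sigma>, ?t)])"
        using M by (simp add: w m_assoc)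
      moreover have "odd (length ((\<sigma>, y) # M @ [(\<sigma>, ?t)]))" "syllables ((\<sigma>, y) # M @ [(\<sigma>, ?t)])"
        using cyclic_even[OF N] M by (auto simp: NM)
      ultimately have False by (rule odd)
      then show ?thesis ..
    qed
  qed
  from snoc.IH[OF K snoc.prems(2) this] snoc.prems(4) show ?case
    unfolding v by (simp only:)
qed

lemma conjugate_rotate:
  assumes "syllables L"
  shows "conjugate G (\<pi> L) (\<pi> (rotate i L))"
proof (induction i)
  case 0
  then show ?case using assms by (simp add: conjugate_refl)
next
  case (Suc i)
  have "conjugate G (\<pi> (rotate i L)) (\<pi> (rotate1 (rotate i L)))"
  proof (cases "rotate i L")
    case Nil
    then show ?thesis by (simp add: conjugate_refl)
  next
    case (Cons s M)
    then have c: "syllables M" "snd s \<in> carrier (F (fst s))"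
      using assms syllables_simps(4)[of i L] by auto
    then have "\<pi> (rotate1 (s # M)) = inv (\<iota> (fst s) (snd s)) \<otimes> \<pi> (s # M) \<otimes> inv (inv (\<iota> (fst s) (snd s)))"
      by (simp add: m_assoc)
    then show ?thesis unfolding Cons conjugate_def using c
      by (intro bexI[of _ "inv (\<iota> (fst s) (snd s))"]) auto
  qed
  then show ?case using Suc conjugate_trans assms by (metis prod_carrier rotate_Suc)
qed

theorem conjugate_cyclic:
  assumes L: "cyclic L" and M: "cyclic M"
  shows "conjugate G (\<pi> L) (\<pi> M) \<longleftrightarrow>
    (\<exists>(k::int) i. \<pi> M = z [^] k \<otimes> \<pi> (rotate i L) \<otimes> inv (z [^] k))"
proof
  assume "conjugate G (\<pi> L) (\<pi> M)"
  then obtain g where g: "g \<in> carrier G" "\<pi> M = g \<otimes> \<pi> L \<otimes> inv g"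
    by (auto simp: conjugate_def)
  obtain k :: int and K where K: "reduced K" "g = \<pi> K \<otimes> z [^] k"
    using normal_form_right[OF g(1)] .
  define u where "u = z [^] k \<otimes> \<pi> L \<otimes> inv (z [^] k)"
  have eq: "\<pi> M = \<pi> K \<otimes> u \<otimes> inv (\<pi> K)"
    using g(2) K L by (simp add: u_def m_assoc inv_mult_group)
  have "u \<in> orbit L" unfolding u_def using orbit_intro[of k 0 L] by simp
  moreover have "even (length (shape (\<pi> M)))"
    using shape_reduced M cyclic_even by simp
  ultimately have "\<pi> M \<in> orbit L"
    using conj_orbit[OF K(1) L, of u] eq by simp
  then show "\<exists>(k::int) i. \<pi> M = z [^] k \<otimes> \<pi> (rotate i L) \<otimes> inv (z [^] k)"
    by (auto simp: orbit_def)
next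
  assume "\<exists>(k::int) i. \<pi> M = z [^] k \<otimes> \<pi> (rotate i L) \<otimes> inv (z [^] k)"
  then obtain k :: int and i where "\<pi> M = z [^] k \<otimes> \<pi> (rotate i L) \<otimes> inv (z [^] k)" by blast
  then have *: "conjugate G (\<pi> (rotate i L)) (\<pi> M)"
    unfolding conjugate_def by (intro bexI[of _ "z [^] k"]) auto
  show "conjugate G (\<pi> L) (\<pi> M)"
    by (rule conjugate_trans[OF conjugate_rotate *]) (use L in simp_all)
qed

end

section \<open>Conjugates of elements of the factors\<close>

locale nsc_amalgamated = amalgamated +
  assumes nsc: "non_self_conjugate (F \<sigma>) (h \<sigma>)"
begin

lemma pw_conjugate: "conjugate (F \<sigma>) (pw \<sigma> i) (pw \<sigma> j) \<longleftrightarrow> pw \<sigma> i = pw \<sigma> j"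
  using nsc[of \<sigma>] unfolding non_self_conjugate_def
  by (metis group.conjugate_refl group_F pw_carrier pw_edge)

lemma factor_conj_trans:
  assumes "factor_conj \<sigma> x \<rho> y" "factor_conj \<rho> y \<tau> w"
    and "x \<in> carrier (F \<sigma>)" "y \<in> carrier (F \<rho>)"
  shows "factor_conj \<sigma> x \<tau> w"
proof -
  note tr = group.conjugate_trans[OF group_F]
  consider "\<sigma> = \<rho>" "conjugate (F \<sigma>) x y" | k where "conjugate (F \<sigma>) x (pw \<sigma> k)" "conjugate (F \<rho>) (pw \<rho> k) y"
    using assms(1) by (auto simp: factor_conj_def)
  then show ?thesis
  proof cases
    case 1
    then show ?thesis using assms(2-4) tr unfolding factor_conj_def by meson
  next
    case 2
    consider "\<rho> = \<tau>" "conjugate (F \<rho>) y w" | j where "conjugate (F \<rho>) y (pw \<rho> j)" "conjugate (F \<tau>) (pw \<tau> j) w"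
      using assms(2) by (auto simp: factor_conj_def)
    then show ?thesis
    proof cases
      case 1
      then show ?thesis using 2 tr[OF 2(2), of w] unfolding factor_conj_def by auto
    next
      case (2 j)
      \<comment> \<open>The two chains meet at \<open>y\<close>, so both powers are conjugate in
        \<open>F \<rho>\<close> and hence equal there; \<open>h_pow_eq\<close> then carries the
        equality to \<open>F \<tau>\<close>.\<close>
      then have "pw \<rho> k = pw \<rho> j"
        using \<open>conjugate (F \<rho>) (pw \<rho> k) y\<close> tr pw_conjugate by (metis pw_carrier)
      then have "pw \<tau> k = pw \<tau> j" by (rule h_pow_eq)
      then show ?thesis
        using 2 \<open>conjugate (F \<sigma>) x (pw \<sigma> k)\<close> unfolding factor_conj_def by auto
    qed
  qed
qed

lemma factor_conj_pw: "factor_conj \<sigma> (pw \<sigma> k) \<tau> (pw \<tau> k)"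
  unfolding factor_conj_def using group.conjugate_refl[OF group_F] pw_carrier by blast

lemma factor_conj_same:
  assumes "x \<in> carrier (F \<sigma>)"
  shows "factor_conj \<sigma> x \<sigma> y \<longleftrightarrow> conjugate (F \<sigma>) x y"
  unfolding factor_conj_def using group.conjugate_trans[OF group_F] assms by blast

text \<open>The innermost syllable of the conjugator is absorbed if it lies on the side of
  \<open>x\<close>, or if \<open>x\<close> is a power and can be read on the other side. Otherwise
  nothing cancels and an odd length of at least three results. Such a length excludes elements of a
  factor as well as cyclically reduced elements, so one disjunction serves both theorems
  below.\<close>

lemma conj_factor:
  assumes "reduced K" "x \<in> carrier (F \<sigma>)" and v: "v = \<pi> K \<otimes> \<iota> \<sigma> x \<otimes> inv (\<pi> K)"
  shows "(\<exists>\<tau> y. y \<in> carrier (F \<tau>) \<and> v = \<iota> \<tau> y \<and> factor_conj \<sigma> x \<tau> y) \<or>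
    (odd (length (shape v)) \<and> 3 \<le> length (shape v))"
  using assms
proof (induction K arbitrary: \<sigma> x rule: rev_induct)
  case Nil
  then show ?case
    by (intro disjI1 exI[of _ \<sigma>] exI[of _ x])
      (auto simp: factor_conj_same group.conjugate_refl)
next
  case (snoc s K)
  obtain \<rho> g where s: "s = (\<rho>, g)" by fastforce
  have K [simp]: "reduced K" and g [simp]: "g \<in> carrier (F \<rho>)" "g \<notin> edge \<rho>"
    and last: "K \<noteq> [] \<Longrightarrow> fst (last K) \<noteq> \<rho>"
    using snoc.prems(1) by (auto simp: reduced_append reduced_Cons s)
  \<comment> \<open>Once \<open>x\<close> is rewritten as \<open>y\<close> on the side of the
    innermost syllable, conjugation by that syllable stays within \<open>F \<rho>\<close> and the
    induction hypothesis applies.\<close>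
  have move: ?case if y: "y \<in> carrier (F \<rho>)" "\<iota> \<rho> y = \<iota> \<sigma> x" "factor_conj \<sigma> x \<rho> y" for y
  proof -
    let ?y = "g \<otimes>\<^bsub>F \<rho>\<^esub> y \<otimes>\<^bsub>F \<rho>\<^esub> inv\<^bsub>F \<rho>\<^esub> g"
    have v': "v = \<pi> K \<otimes> \<iota> \<rho> ?y \<otimes> inv (\<pi> K)"
      using snoc.prems(2,3) y(1) y(2)[symmetric] by (simp add: s m_assoc inv_mult_group)
    have "factor_conj \<rho> y \<rho> ?y"
      using y(1) by (auto simp: factor_conj_same conjugate_def)
    then have "factor_conj \<sigma> x \<rho> ?y"
      using factor_conj_trans y snoc.prems(2) by blast
    moreover have "?y \<in> carrier (F \<rho>)" using y(1) by simp
    ultimately show ?thesis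
      using snoc.IH[of ?y \<rho>] v' snoc.prems(2) factor_conj_trans[of \<sigma> x \<rho> ?y] K by blast
  qed
  consider "\<rho> = \<sigma>" | k where "x = pw \<sigma> k" | "\<rho> \<noteq> \<sigma>" "x \<notin> edge \<sigma>"
    by (meson edgeE)
  then show ?case
  proof cases
    case 1
    then show ?thesis
      using move[of x] snoc.prems(2) by (auto simp: factor_conj_same group.conjugate_refl)
  next
    case 2
    then show ?thesis
      using move[of "pw \<rho> k"] factor_conj_pw by simp
  next
    case 3
    let ?M = "K @ [(\<rho>, g), (\<sigma>, x), (\<rho>, inv\<^bsub>F \<rho>\<^esub> g)] @ inv_syllables K"
    have "v = \<pi> ?M"
      using snoc.prems(2,3) by (simp add: s m_assoc inv_mult_group)
    moreover have "reduced ?M"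
      using 3 last snoc.prems(2) g by (auto simp: reduced_append reduced_Cons hd_inv_syllables)
    ultimately have "shape v = map fst ?M" by (simp only: shape_reduced)
    then show ?thesis by simp
  qed
qed

lemma conjugate_factor_cases:
  assumes "conjugate G (\<iota> \<sigma> x) v" "x \<in> carrier (F \<sigma>)"
  shows "(\<exists>\<tau> y. y \<in> carrier (F \<tau>) \<and> v = \<iota> \<tau> y \<and> factor_conj \<sigma> x \<tau> y) \<or>
    (odd (length (shape v)) \<and> 3 \<le> length (shape v))"
proof -
  obtain g where g: "g \<in> carrier G" "v = g \<otimes> \<iota> \<sigma> x \<otimes> inv g"
    using assms(1) by (auto simp: conjugate_def)
  obtain k :: int and K where K: "reduced K" "g = \<pi> K \<otimes> z [^] k"
    using normal_form_right[OF g(1)] .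
  let ?x = "pw \<sigma> k \<otimes>\<^bsub>F \<sigma>\<^esub> x \<otimes>\<^bsub>F \<sigma>\<^esub> inv\<^bsub>F \<sigma>\<^esub> (pw \<sigma> k)"
  have "v = \<pi> K \<otimes> \<iota> \<sigma> ?x \<otimes> inv (\<pi> K)"
    using g(2) K assms(2) by (simp add: m_assoc inv_mult_group)
  moreover have "factor_conj \<sigma> x \<sigma> ?x"
    using assms(2) pw_carrier unfolding factor_conj_same[OF assms(2)] conjugate_def by blast
  moreover have "?x \<in> carrier (F \<sigma>)" using assms(2) by simp
  ultimately show ?thesis
    using conj_factor[OF K(1), of ?x \<sigma> v] factor_conj_trans[of \<sigma> x \<sigma> ?x] assms(2) by blast
qed

theorem conjugate_factor:
  assumes x: "x \<in> carrier (F \<sigma>)" and y: "y \<in> carrier (F \<tau>)"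
  shows "conjugate G (\<iota> \<sigma> x) (\<iota> \<tau> y) \<longleftrightarrow> factor_conj \<sigma> x \<tau> y"
proof
  assume "conjugate G (\<iota> \<sigma> x) (\<iota> \<tau> y)"
  from conjugate_factor_cases[OF this x] obtain \<rho> w
    where w: "w \<in> carrier (F \<rho>)" "\<iota> \<tau> y = \<iota> \<rho> w" "factor_conj \<sigma> x \<rho> w"
    using shape_\<iota>[OF y] by (auto split: if_splits)
  show "factor_conj \<sigma> x \<tau> y"
  proof (cases "\<rho> = \<tau>")
    case True
    then show ?thesis using w y by auto
  next
    case False
    \<comment> \<open>If \<open>w\<close> lay outside the edge, its shape \<open>[\<rho>]\<close>
      would be the shape of an element of \<open>F \<tau>\<close>, which is \<open>[]\<close> or
      \<open>[\<tau>]\<close>.\<close>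
    then have "w \<in> edge \<rho>"
      using shape_\<iota>[OF y] shape_\<iota>[OF w(1)] w(2) by (auto split: if_splits)
    then obtain k where k: "w = pw \<rho> k" by (rule edgeE)
    then have "\<iota> \<tau> y = \<iota> \<tau> (pw \<tau> k)" using w(2) by simp
    then have "y = pw \<tau> k" using y by (simp only: \<iota>_eq pw_carrier)
    then show ?thesis using factor_conj_trans[OF w(3) _ x w(1)] factor_conj_pw k by simp
  qed
next
  have hom: "conjugate G (\<iota> \<rho> u) (\<iota> \<rho> w)" if uw: "conjugate (F \<rho>) u w" "u \<in> carrier (F \<rho>)" for \<rho> u w
  proof -
    obtain g where "g \<in> carrier (F \<rho>)" "w = g \<otimes>\<^bsub>F \<rho>\<^esub> u \<otimes>\<^bsub>F \<rho>\<^esub> inv\<^bsub>F \<rho>\<^esub> g"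
      using uw(1) by (auto simp: conjugate_def)
    then show ?thesis
      unfolding conjugate_def using uw(2) by (intro bexI[of _ "\<iota> \<rho> g"]) auto
  qed
  assume "factor_conj \<sigma> x \<tau> y"
  then show "conjugate G (\<iota> \<sigma> x) (\<iota> \<tau> y)"
    unfolding factor_conj_def
  proof (elim disjE conjE exE)
    fix k assume "conjugate (F \<sigma>) x (pw \<sigma> k)" "conjugate (F \<tau>) (pw \<tau> k) y"
    then have "conjugate G (\<iota> \<sigma> x) (z [^] k)" "conjugate G (z [^] k) (\<iota> \<tau> y)"
      using hom[of \<sigma> x "pw \<sigma> k"] hom[of \<tau> "pw \<tau> k" y] x by simp_all
    then show ?thesis using conjugate_trans x by (meson \<iota>_carrier)
  qed (use hom x in auto)
qed

theorem not_conjugate_factor_cyclic: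
  assumes "x \<in> carrier (F \<sigma>)" "cyclic M"
  shows "\<not> conjugate G (\<iota> \<sigma> x) (\<pi> M)"
proof
  assume "conjugate G (\<iota> \<sigma> x) (\<pi> M)"
  moreover have "shape (\<pi> M) = map fst M" "even (length M)" "M \<noteq> []"
    using assms(2) shape_reduced cyclic_even by (auto simp: cyclic_def)
  ultimately obtain \<tau> y where "y \<in> carrier (F \<tau>)" "\<pi> M = \<iota> \<tau> y"
    using conjugate_factor_cases[OF _ assms(1)] by fastforce
  then have "length M \<le> 1"
    using shape_\<iota>[of y \<tau>] \<open>shape (\<pi> M) = map fst M\<close> by (metis One_nat_def le_SucI length_Cons
        length_map list.size(3) order_refl)
  then show False
    using \<open>even (length M)\<close> \<open>M \<noteq> []\<close> by (cases M) auto
qed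

end

section \<open>Amalgams of presentations\<close>

definition side_word :: "bool \<Rightarrow> word \<Rightarrow> word" where
  "side_word \<sigma> w = map (\<lambda>(x, e). (sum_encode (if \<sigma> then Inl x else Inr x), e)) w"

lemma side_word_simps [simp]:
  "side_word \<sigma> [] = []"
  "side_word \<sigma> ((x, e) # w) = (sum_encode (if \<sigma> then Inl x else Inr x), e) # side_word \<sigma> w"
  "side_word \<sigma> (u @ v) = side_word \<sigma> u @ side_word \<sigma> v"
  "inv_word (side_word \<sigma> w) = side_word \<sigma> (inv_word w)"
  by (auto simp: side_word_def inv_word_def rev_map split_def)

lemma left_right_side_word: "left_word = side_word True" "right_word = side_word False"
  by (auto simp: fun_eq_iff side_word_def left_word_def right_word_def)

lemma elt_carrier [simp]: "w \<in> words Q \<Longrightarrow> elt Q w \<in> carrier (presented_group Q)"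
  by (simp add: presented_group_def)

lemma presented_carrierE:
  assumes "x \<in> carrier (presented_group Q)"
  obtains w where "w \<in> words Q" "x = elt Q w"
  using assms by (auto simp: presented_group_def)

lemma one_presented: "\<one>\<^bsub>presented_group Q\<^esub> = elt Q []"
  by (simp add: presented_group_def)

lemma elt_append:
  "u \<in> words Q \<Longrightarrow> v \<in> words Q \<Longrightarrow> elt Q (u @ v) = elt Q u \<otimes>\<^bsub>presented_group Q\<^esub> elt Q v"
  by (simp add: elt_mult)

lemma elt_inv_word:
  assumes "w \<in> words Q"
  shows "elt Q (inv_word w) = inv\<^bsub>presented_group Q\<^esub> elt Q w"
proof -
  have "elt Q (inv_word w) \<otimes>\<^bsub>presented_group Q\<^esub> elt Q w = \<one>\<^bsub>presented_group Q\<^esub>"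
    using assms inv_word_left[OF assms] by (simp add: elt_mult one_presented elt_eq_iff)
  from group.inv_equality[OF group_presented_group this] show ?thesis
    using assms by simp
qed

lemma elt_rep:
  assumes "w \<in> words Q"
  shows "word_eq Q w (SOME v. v \<in> elt Q w)"
proof -
  have "(SOME v. v \<in> elt Q w) \<in> elt Q w"
    by (rule someI[of _ w]) (simp add: elt_def assms word_eq.refl)
  then show ?thesis by (simp add: elt_def)
qed

text \<open>Index \<open>True\<close> stands for the left and \<open>False\<close> for the right factor.\<close>
locale amalgam_presentation =
  fixes P :: "bool \<Rightarrow> presentation" and c :: "bool \<Rightarrow> word"
  assumes wf: "wf_presentation (P \<sigma>)"
    and c_words [simp]: "c \<sigma> \<in> words (P \<sigma>)"
    and c_pow_eq: "elt (P \<sigma>) (c \<sigma>) [^]\<^bsub>presented_group (P \<sigma>)\<^esub> (i::int) =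
        elt (P \<sigma>) (c \<sigma>) [^]\<^bsub>presented_group (P \<sigma>)\<^esub> (j::int) \<Longrightarrow>
      elt (P \<tau>) (c \<tau>) [^]\<^bsub>presented_group (P \<tau>)\<^esub> i = elt (P \<tau>) (c \<tau>) [^]\<^bsub>presented_group (P \<tau>)\<^esub> j"
    and c_nsc: "non_self_conjugate (presented_group (P \<sigma>)) (elt (P \<sigma>) (c \<sigma>))"
begin

sublocale factor_groups "\<lambda>\<sigma>. presented_group (P \<sigma>)" "\<lambda>\<sigma>. elt (P \<sigma>) (c \<sigma>)"
proof (rule factor_groups.intro)
  show "group (presented_group (P \<sigma>))" for \<sigma>
    by (rule group_presented_group)
qed (simp, rule c_pow_eq)

abbreviation F where "F \<equiv> \<lambda>\<sigma>. presented_group (P \<sigma>)"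

definition am where "am = amalgam (P True) (c True) (P False) (c False)"

abbreviation GG where "GG \<equiv> presented_group am"

interpretation GG: group GG
  by (rule group_presented_group)

text \<open>\<open>sum_encode\<close> numbers left generators by even and right generators by odd
  numbers, so the parity of a generator is its side.\<close>

lemma gens_am: "n \<in> gens am \<longleftrightarrow> n div 2 \<in> gens (P (even n))"
  by (cases "even n") (auto simp: am_def amalgam_def sum_encode_def image_iff double_not_eq_Suc_double
      Suc_double_not_eq_double elim!: evenE oddE)

lemma sum_encode_gens [simp]:
  "sum_encode (if \<sigma> then Inl x else Inr x) \<in> gens am \<longleftrightarrow> x \<in> gens (P \<sigma>)"
  by (simp add: gens_am sum_encode_def)

lemma side_word_words [simp]: "side_word \<sigma> w \<in> words am \<longleftrightarrow> w \<in> words (P \<sigma>)"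
  by (induction w) auto

lemma rels_am: "r \<in> rels am \<longleftrightarrow> (\<exists>\<sigma>. r \<in> side_word \<sigma> ` rels (P \<sigma>)) \<or>
    r = side_word True (c True) @ side_word False (inv_word (c False))"
  by (auto simp: am_def amalgam_def left_right_side_word ex_bool_eq)

lemma word_eq_side:
  assumes "word_eq (P \<sigma>) u v"
  shows "word_eq am (side_word \<sigma> u) (side_word \<sigma> v)"
  using assms
proof (induction rule: word_eq.induct)
  case (sym u v)
  then show ?case by (blast intro: word_eq.sym)
next
  case (trans u v w)
  then show ?case by (blast intro: word_eq.trans)
next
  case (cancel u v x e)
  then show ?case
    using word_eq.cancel[of "side_word \<sigma> u" am "side_word \<sigma> v" "sum_encode (if \<sigma> then Inl x else Inr x)" e]
    by simp
next
  case (relator u v r)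
  then have "side_word \<sigma> r \<in> rels am" by (auto simp: rels_am)
  then show ?case
    using relator word_eq.relator[of "side_word \<sigma> u" am "side_word \<sigma> v" "side_word \<sigma> r"] by simp
qed (simp add: word_eq.refl)

section \<open>The factors inside the amalgam\<close>

definition \<iota> :: "bool \<Rightarrow> word set \<Rightarrow> word set" where
  "\<iota> \<sigma> U = elt am (side_word \<sigma> (SOME w. w \<in> U))"

lemma \<iota>_elt [simp]: "w \<in> words (P \<sigma>) \<Longrightarrow> \<iota> \<sigma> (elt (P \<sigma>) w) = elt am (side_word \<sigma> w)"
  unfolding \<iota>_def using elt_rep word_eq_side word_eq.sym word_eq_in_words
  by (metis elt_eq_iff)

lemma relator_trivial: "r \<in> rels (P \<sigma>) \<Longrightarrow> elt (P \<sigma>) r = \<one>\<^bsub>F \<sigma>\<^esub>"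
  using word_eq.relator[of "[]" "P \<sigma>" "[]" r] wf[of \<sigma>]
  by (simp add: one_presented elt_eq_iff wf_presentation_def subset_iff)

lemma c_identified: "elt am (side_word True (c True)) = elt am (side_word False (c False))"
proof -
  have "side_word True (c True) @ side_word False (inv_word (c False)) \<in> rels am"
    by (simp add: rels_am)
  from word_eq.relator[OF _ _ this, of "[]" "[]"]
  have "elt am (side_word True (c True) @ inv_word (side_word False (c False))) = \<one>\<^bsub>GG\<^esub>"
    by (simp add: one_presented elt_eq_iff)
  then have "elt am (side_word True (c True)) \<otimes>\<^bsub>GG\<^esub> inv\<^bsub>GG\<^esub> elt am (side_word False (c False)) = \<one>\<^bsub>GG\<^esub>"
    by (simp only: elt_append elt_inv_word side_word_words c_words inv_word_in_words)
  then show ?thesis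
    by (metis GG.inv_equality GG.inv_inv GG.inv_closed c_words elt_carrier side_word_words)
qed

text \<open>This undoes \<open>sum_encode\<close>. Every letter becomes a syllable of its own;
  grouping adjacent letters of one side is left to the reduction.\<close>

definition letter_syllable :: "letter \<Rightarrow> bool \<times> word" where
  "letter_syllable l = (even (fst l), [(fst l div 2, snd l)])"

definition word_syllables :: "(bool \<times> word) list \<Rightarrow> bool" where
  "word_syllables L \<longleftrightarrow> (\<forall>s\<in>set L. snd s \<in> words (P (fst s)))"

definition flat :: "(bool \<times> word) list \<Rightarrow> word" where
  "flat L = concat (map (\<lambda>s. side_word (fst s) (snd s)) L)"

definition elts :: "(bool \<times> word) list \<Rightarrow> (bool \<times> word set) list" where
  "elts L = map (\<lambda>s. (fst s, elt (P (fst s)) (snd s))) L"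

lemma word_syllables_simps [simp]:
  "word_syllables []"
  "word_syllables (s # L) \<longleftrightarrow> snd s \<in> words (P (fst s)) \<and> word_syllables L"
  "word_syllables (L @ M) \<longleftrightarrow> word_syllables L \<and> word_syllables M"
  "word_syllables (rotate i L) \<longleftrightarrow> word_syllables L"
  by (auto simp: word_syllables_def)

lemma flat_simps [simp]:
  "flat [] = []" "flat (s # L) = side_word (fst s) (snd s) @ flat L"
  "flat (L @ M) = flat L @ flat M"
  by (auto simp: flat_def)

lemma elts_simps [simp]:
  "elts [] = []" "elts (s # L) = (fst s, elt (P (fst s)) (snd s)) # elts L"
  "elts (L @ M) = elts L @ elts M" "elts (rotate i L) = rotate i (elts L)"
  "length (elts L) = length L" "elts L = [] \<longleftrightarrow> L = []" "map fst (elts L) = map fst L"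
  by (auto simp: elts_def rotate_map)

lemma flat_words [simp]: "word_syllables L \<Longrightarrow> flat L \<in> words am"
  by (induction L) auto

lemma elts_syllables [simp]: "word_syllables L \<Longrightarrow> syllables (elts L)"
  by (induction L) auto

lemma elts_surj: "syllables M \<Longrightarrow> \<exists>L. word_syllables L \<and> elts L = M"
proof (induction M)
  case (Cons s M)
  then obtain L w where "word_syllables L" "elts L = M" "w \<in> words (P (fst s))" "snd s = elt (P (fst s)) w"
    by (auto elim!: presented_carrierE)
  then show ?case by (cases s) (auto intro!: exI[of _ "(fst s, w) # L"])
qed (auto intro!: exI[of _ "[]"])

lemma elt_flat: "word_syllables L \<Longrightarrow> elt am (flat L) = syllable_prod GG \<iota> (elts L)"
  by (induction L) (auto simp: syllable_prod_def one_presented elt_append)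

lemma flat_letters: "flat (map letter_syllable w) = w"
  by (induction w) (auto simp: letter_syllable_def sum_encode_def)

lemma letters_word_syllables: "w \<in> words am \<Longrightarrow> word_syllables (map letter_syllable w)"
  by (induction w) (auto simp: letter_syllable_def gens_am)

section \<open>The amalgam acts on normal forms\<close>

definition word_act :: "word \<Rightarrow> word set state \<Rightarrow> word set state" where
  "word_act w = acts (elts (map letter_syllable w))"

lemma word_act_append: "word_act (u @ v) \<omega> = word_act u (word_act v \<omega>)"
  by (simp add: word_act_def)

lemma word_act_in: "w \<in> words am \<Longrightarrow> \<omega> \<in> states \<Longrightarrow> word_act w \<omega> \<in> states"
  unfolding word_act_def
  by (rule acts_in) (use elts_syllables[OF letters_word_syllables] in \<open>auto simp: syllables_def\<close>)

lemma word_act_side: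
  assumes "w \<in> words (P \<sigma>)" "\<omega> \<in> states"
  shows "word_act (side_word \<sigma> w) \<omega> = act \<sigma> (elt (P \<sigma>) w) \<omega>"
  using assms
proof (induction w)
  case Nil
  then show ?case by (simp add: word_act_def act_one one_presented[symmetric])
next
  case (Cons l w)
  obtain x e where l: "l = (x, e)" by fastforce
  have "word_act (side_word \<sigma> (l # w)) \<omega> = act \<sigma> (elt (P \<sigma>) [l]) (word_act (side_word \<sigma> w) \<omega>)"
    by (simp add: word_act_def letter_syllable_def sum_encode_def l)
  also have "\<dots> = act \<sigma> (elt (P \<sigma>) [l] \<otimes>\<^bsub>F \<sigma>\<^esub> elt (P \<sigma>) w) \<omega>"
    using Cons l by (simp add: act_act)
  also have "elt (P \<sigma>) [l] \<otimes>\<^bsub>F \<sigma>\<^esub> elt (P \<sigma>) w = elt (P \<sigma>) (l # w)"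
    using Cons.prems l elt_append[of "[l]" "P \<sigma>" w] by simp
  finally show ?case .
qed

text \<open>A relator of a factor is trivial in that factor. For the amalgamating relator,
  \<open>act_pw\<close> lets the inverse power act through the left factor instead of the right one,
  where it cancels.\<close>

lemma word_act_relator:
  assumes "r \<in> rels am" "\<omega> \<in> states"
  shows "word_act r \<omega> = \<omega>"
  using assms(1) unfolding rels_am
proof (elim disjE exE imageE)
  fix \<sigma> s assume s: "r = side_word \<sigma> s" "s \<in> rels (P \<sigma>)"
  then have "s \<in> words (P \<sigma>)" using wf[of \<sigma>] by (auto simp: wf_presentation_def)
  then show ?thesis using assms(2) s by (simp add: word_act_side relator_trivial act_one)
next
  assume r: "r = side_word True (c True) @ side_word False (inv_word (c False))"
  obtain j L where \<omega>: "\<omega> = (j, L)" by fastforce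
  have p: "pw True 1 = elt (P True) (c True)"
    by (simp add: group.int_pow_1)
  have m: "pw False (- 1) = elt (P False) (inv_word (c False))"
    by (simp only: pw_uminus) (simp add: group.int_pow_1 elt_inv_word)
  have "word_act r \<omega> = act True (pw True 1) (act False (pw False (- 1)) \<omega>)"
    unfolding p m r using assms(2) by (simp add: word_act_append word_act_side act_in)
  also have "act False (pw False (- 1)) \<omega> = act True (pw True (- 1)) \<omega>"
    using assms(2) by (simp only: \<omega> act_pw)
  also have "act True (pw True 1) (act True (pw True (- 1)) \<omega>) = act True (pw True (1 + - 1)) \<omega>"
    using assms(2) by (simp only: act_act pw_carrier pw_add)
  also have "\<dots> = \<omega>" using assms(2) by (simp add: act_one)
  finally show ?thesis .
qed

text \<open>The action of words thus descends to the presented group, so anything read off from it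
  is an invariant of group elements.\<close>

lemma word_act_cong:
  assumes "word_eq am u v" "\<omega> \<in> states"
  shows "word_act u \<omega> = word_act v \<omega>"
  using assms
proof (induction rule: word_eq.induct)
  case (cancel u v x e)
  let ?\<sigma> = "even x" and ?y = "x div 2"
  have y: "?y \<in> gens (P ?\<sigma>)" using cancel by (simp add: gens_am)
  then have "elt (P ?\<sigma>) [(?y, e), (?y, \<not> e)] = elt (P ?\<sigma>) []"
    using word_eq.cancel[of "[]" "P ?\<sigma>" "[]" ?y e] by (simp add: elt_eq_iff)
  moreover have "[(x, e), (x, \<not> e)] = side_word ?\<sigma> [(?y, e), (?y, \<not> e)]"
    by (simp add: sum_encode_def)
  ultimately have "word_act [(x, e), (x, \<not> e)] (word_act v \<omega>) = word_act v \<omega>"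
    using cancel y
    by (simp only: word_act_side word_act_in words_simps simp_thms one_presented[symmetric] act_one)
  then show ?case by (simp only: word_act_append)
next
  case (relator u v r)
  then show ?case by (simp add: word_act_append word_act_relator word_act_in)
qed auto

lemma word_act_flat:
  assumes "word_syllables L" "\<omega> \<in> states"
  shows "word_act (flat L) \<omega> = acts (elts L) \<omega>"
  using assms
proof (induction L)
  case (Cons s L)
  then show ?case by (simp add: word_act_append word_act_side acts_in flip: Cons.IH)
      (simp add: word_act_side word_act_in)
qed (simp add: word_act_def)

text \<open>The empty normal form. Its exponent must be canonical, and \<open>can 0\<close> need not
  be \<open>0\<close>.\<close>

definition base :: "word set state" where "base = (can 0, [])"

lemma base_in [simp]: "base \<in> states"
  using can_eq[OF pw_can, of 0] by (simp add: base_def states_def)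

definition shape :: "word set \<Rightarrow> bool list" where
  "shape U = map fst (snd (word_act (SOME w. w \<in> U) base))"

lemma shape_elt: "w \<in> words am \<Longrightarrow> shape (elt am w) = map fst (snd (word_act w base))"
  unfolding shape_def using elt_rep word_act_cong[OF _ base_in] by metis

sublocale nsc_amalgamated F "\<lambda>\<sigma>. elt (P \<sigma>) (c \<sigma>)" GG \<iota> shape
proof unfold_locales
  fix \<sigma> \<tau>
  show "\<iota> \<sigma> \<in> hom (F \<sigma>) GG"
  proof (rule homI)
    fix x y assume "x \<in> carrier (F \<sigma>)" "y \<in> carrier (F \<sigma>)"
    then obtain u v where "u \<in> words (P \<sigma>)" "v \<in> words (P \<sigma>)" "x = elt (P \<sigma>) u" "y = elt (P \<sigma>) v"
      by (metis presented_carrierE)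
    then show "\<iota> \<sigma> (x \<otimes>\<^bsub>F \<sigma>\<^esub> y) = \<iota> \<sigma> x \<otimes>\<^bsub>GG\<^esub> \<iota> \<sigma> y"
      by (simp add: elt_mult)
  qed (auto elim!: presented_carrierE)
  show "inj_on (\<iota> \<sigma>) (carrier (F \<sigma>))"
  proof (rule inj_onI)
    fix x y assume xy: "x \<in> carrier (F \<sigma>)" "y \<in> carrier (F \<sigma>)" "\<iota> \<sigma> x = \<iota> \<sigma> y"
    then obtain u v where uv: "u \<in> words (P \<sigma>)" "v \<in> words (P \<sigma>)" "x = elt (P \<sigma>) u" "y = elt (P \<sigma>) v"
      by (metis presented_carrierE)
    then have "word_eq am (side_word \<sigma> u) (side_word \<sigma> v)"
      using xy(3) by (simp add: elt_eq_iff)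
    \<comment> \<open>Words that are equal in the amalgam act alike on \<open>base\<close>, while
      each factor acts freely.\<close>
    from word_act_cong[OF this base_in] have "act \<sigma> x base = act \<sigma> y base"
      using uv by (simp add: word_act_side)
    then show "x = y" using act_inj[OF base_in xy(1,2)] by blast
  qed
  show "\<iota> \<sigma> (elt (P \<sigma>) (c \<sigma>)) = \<iota> \<tau> (elt (P \<tau>) (c \<tau>))"
    using c_identified by (cases \<sigma>; cases \<tau>) simp_all
  show "non_self_conjugate (F \<sigma>) (elt (P \<sigma>) (c \<sigma>))" by (rule c_nsc)
next
  fix g assume "g \<in> carrier GG"
  then obtain w where w: "w \<in> words am" "g = elt am w" by (rule presented_carrierE)
  then show "\<exists>L. syllables L \<and> g = syllable_prod GG \<iota> L"
    using elt_flat[OF letters_word_syllables[OF w(1)]] elts_syllables[OF letters_word_syllables[OF w(1)]]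
    by (auto simp: flat_letters)
next
  fix L \<sigma> and k :: int assume L: "reduced L"
  obtain M where M: "word_syllables M" "elts M = L"
    using elts_surj[OF reduced_syllables[OF L]] by blast
  obtain u where u: "u \<in> words (P \<sigma>)" "pw \<sigma> k = elt (P \<sigma>) u"
    using pw_carrier by (rule presented_carrierE)
  have "syllable_prod GG \<iota> L \<otimes>\<^bsub>GG\<^esub> \<iota> \<sigma> (pw \<sigma> k) = elt am (flat M @ side_word \<sigma> u)"
    using M u by (simp add: elt_append elt_flat)
  then have "shape (syllable_prod GG \<iota> L \<otimes>\<^bsub>GG\<^esub> \<iota> \<sigma> (pw \<sigma> k)) =
      map fst (snd (word_act (flat M @ side_word \<sigma> u) base))"
    using M u by (simp add: shape_elt)
  also have "word_act (flat M @ side_word \<sigma> u) base = acts L (act \<sigma> (pw \<sigma> k) base)"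
    using M u by (simp add: word_act_append word_act_side word_act_flat act_in)
  \<comment> \<open>The trailing power acts first and changes only the exponent of the empty normal
    form, so \<open>acts_shape\<close> still applies.\<close>
  also have "act \<sigma> (pw \<sigma> k) base = (can (k + can 0), [])"
    unfolding base_def by (rule act_pw) (simp flip: base_def)
  also have "map fst (snd (acts L (can (k + can 0), []))) = map fst L"
    using L act_in[OF base_in pw_carrier, of \<sigma> k]
    by (intro acts_shape) (simp_all add: \<open>act \<sigma> (pw \<sigma> k) base = _\<close>)
  finally show "shape (syllable_prod GG \<iota> L \<otimes>\<^bsub>GG\<^esub> \<iota> \<sigma> (pw \<sigma> k)) = map fst L" .
qed

end

section \<open>The conjugacy algorithm\<close>

text \<open>The code of \<open>k \<ge> 0\<close> is \<open>2 * k\<close>, and that of \<open>- m - 1\<close> is \<open>2 * m + 1\<close>.\<close>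
definition word_pow :: "word \<Rightarrow> int \<Rightarrow> word" where
  "word_pow w k = (let m = rec_nat [] (\<lambda>_ r. w @ r) (encode k div 2)
     in if even (encode k) then m else inv_word (w @ m))"

lemma computable_word_pow [computable_intros]:
  assumes "computable w" "computable k"
  shows "computable (\<lambda>x. word_pow (w x) (k x))"
  unfolding word_pow_def Let_def
  by (intro computable_intros assms computable_compose[OF assms(1)])

lemma word_pow:
  assumes "w \<in> words Q"
  shows "word_pow w k \<in> words Q" "elt Q (word_pow w k) = elt Q w [^]\<^bsub>presented_group Q\<^esub> k"
proof -
  interpret group "presented_group Q" by (rule group_presented_group)
  define m where "m = rec_nat [] (\<lambda>_ r. w @ r)"
  have m: "m n \<in> words Q \<and> elt Q (m n) = elt Q w [^]\<^bsub>presented_group Q\<^esub> int n" for n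
  proof (induction n)
    case (Suc n)
    then show ?case
      using assms int_pow_mult[of "elt Q w" 1 "int n"]
      by (simp add: m_def elt_append int_pow_1)
  qed (simp add: m_def one_presented)
  have k: "k = (if even (encode k) then int (encode k div 2) else - int (Suc (encode k div 2)))"
    using int_encode_inverse[of k] by (auto simp: int_decode_def sum_decode_def encode_int_def)
  show "word_pow w k \<in> words Q"
    using m assms by (auto simp: word_pow_def m_def[symmetric] Let_def)
  show "elt Q (word_pow w k) = elt Q w [^]\<^bsub>presented_group Q\<^esub> k"
  proof (cases "even (encode k)")
    case True
    then have "elt Q w [^]\<^bsub>presented_group Q\<^esub> k = elt Q w [^]\<^bsub>presented_group Q\<^esub> int (encode k div 2)"
      using k by simp
    then show ?thesis using True m by (simp add: word_pow_def m_def[symmetric])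
  next
    case False
    then have "elt Q w [^]\<^bsub>presented_group Q\<^esub> k =
        elt Q w [^]\<^bsub>presented_group Q\<^esub> (- int (Suc (encode k div 2)))"
      using k by simp
    also have "\<dots> = elt Q (inv_word (m (Suc (encode k div 2))))"
      using m[of "Suc (encode k div 2)"] assms
      by (simp only: elt_inv_word int_pow_neg elt_carrier)
    also have "m (Suc (encode k div 2)) = w @ m (encode k div 2)"
      by (simp add: m_def)
    finally show ?thesis using False by (simp add: word_pow_def m_def[symmetric])
  qed
qed

text \<open>The oracles are total functions, specified on words of the presentations only.
  \<open>conj_powers\<close> and \<open>coset_search\<close> exist for the left factor alone, which
  is why later tests start from a left syllable. \<open>coset_search\<close> is assumed exact for
  \<open>u\<close> outside \<open>edge True\<close>.\<close>

locale amalgam_oracles = amalgam_presentation +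
  fixes conj_test :: "bool \<Rightarrow> word \<Rightarrow> word \<Rightarrow> bool"
    and power_search :: "bool \<Rightarrow> word \<Rightarrow> int option"
    and conj_powers :: "word \<Rightarrow> int list"
    and coset_search :: "word \<Rightarrow> word \<Rightarrow> (int \<times> int) list"
  assumes conj_test: "u \<in> words (P \<sigma>) \<Longrightarrow> v \<in> words (P \<sigma>) \<Longrightarrow>
        conj_test \<sigma> u v \<longleftrightarrow> conjugate (presented_group (P \<sigma>)) (elt (P \<sigma>) u) (elt (P \<sigma>) v)"
    and power_search_None: "w \<in> words (P \<sigma>) \<Longrightarrow> power_search \<sigma> w = None \<Longrightarrow> elt (P \<sigma>) w \<notin> edge \<sigma>"
    and power_search_Some: "w \<in> words (P \<sigma>) \<Longrightarrow> power_search \<sigma> w = Some k \<Longrightarrow> elt (P \<sigma>) w = pw \<sigma> k"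
    and conj_powers: "w \<in> words (P True) \<Longrightarrow> (\<lambda>k. pw True k) ` set (conj_powers w) =
        {x \<in> edge True. conjugate (presented_group (P True)) (elt (P True) w) x}"
    and coset_search: "u \<in> words (P True) \<Longrightarrow> v \<in> words (P True) \<Longrightarrow> elt (P True) u \<notin> edge True \<Longrightarrow>
        set (coset_search u v) = {(r, s). pw True r \<otimes>\<^bsub>presented_group (P True)\<^esub> elt (P True) u
          \<otimes>\<^bsub>presented_group (P True)\<^esub> pw True s = elt (P True) v}"
    and computable_conj_test_side: "computable (\<lambda>p. conj_test \<sigma> (fst p) (snd p))"
    and computable_power_search_side: "computable (power_search \<sigma>)"
    and computable_conj_powers_pre: "computable conj_powers"
    and computable_coset_search_pre: "computable (\<lambda>p. coset_search (fst p) (snd p))"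
begin

text \<open>Oracles are known to be computable for each fixed side. As there are two sides, a side
  computed from the input can be handled by branching.\<close>

lemma computable_side:
  fixes s :: "'x::coded \<Rightarrow> bool" and f :: "bool \<Rightarrow> 'x \<Rightarrow> 'y::coded"
  assumes "computable s" "\<And>\<sigma>. computable (f \<sigma>)"
  shows "computable (\<lambda>x. f (s x) x)"
proof -
  have "f (s x) x = (if s x then f True x else f False x)" for x
    by simp
  then show ?thesis
    by (simp only:) (intro computable_intros assms)
qed

lemma computable_c: "computable s \<Longrightarrow> computable (\<lambda>x. c (s x))"
  using computable_side[of s "\<lambda>\<sigma> x. c \<sigma>"] computable_const by blast

lemma computable_conj_test:
  "computable s \<Longrightarrow> computable u \<Longrightarrow> computable v \<Longrightarrow> computable (\<lambda>x. conj_test (s x) (u x) (v x))"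
  using computable_side[of s "\<lambda>\<sigma> x. conj_test \<sigma> (u x) (v x)"]
    computable_compose[OF computable_conj_test_side computable_Pair, of u v] by simp

lemma computable_power_search:
  "computable s \<Longrightarrow> computable u \<Longrightarrow> computable (\<lambda>x. power_search (s x) (u x))"
  using computable_side[of s "\<lambda>\<sigma> x. power_search \<sigma> (u x)"]
    computable_compose[OF computable_power_search_side, of u] by simp

lemma computable_coset_search:
  "computable u \<Longrightarrow> computable v \<Longrightarrow> computable (\<lambda>x. coset_search (u x) (v x))"
  using computable_compose[OF computable_coset_search_pre computable_Pair, of u v] by simp

lemmas oracle_intros = computable_intros computable_c computable_conj_test computable_power_search
  computable_coset_search computable_compose[OF computable_conj_powers_pre]

abbreviation c_pow where "c_pow \<sigma> k \<equiv> word_pow (c \<sigma>) k"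

lemma c_pow [simp]: "c_pow \<sigma> k \<in> words (P \<sigma>)" "elt (P \<sigma>) (c_pow \<sigma> k) = pw \<sigma> k"
  by (simp_all add: word_pow)

text \<open>Realises \<open>push_rel\<close> on words: the power search decides whether the merged
  element lies in the amalgamated subgroup and supplies the exponent.\<close>

definition push :: "bool \<Rightarrow> word \<Rightarrow> int \<times> (bool \<times> word) list \<Rightarrow> int \<times> (bool \<times> word) list" where
  "push \<sigma> w p = (let q = (case snd p of [] \<Rightarrow> (w @ c_pow \<sigma> (fst p), [])
       | s # L \<Rightarrow> if fst s = \<sigma> then (w @ c_pow \<sigma> (fst p) @ snd s, L) else (w @ c_pow \<sigma> (fst p), s # L))
     in case power_search \<sigma> (fst q) of None \<Rightarrow> (0, (\<sigma>, fst q) # snd q) | Some j \<Rightarrow> (j, snd q))"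

lemma computable_push:
  assumes "computable s" "computable w" "computable p"
  shows "computable (\<lambda>x. push (s x) (w x) (p x))"
  unfolding push_def Let_def
  by (intro oracle_intros computable_compose[OF assms(1)] computable_compose[OF assms(2)]
      computable_compose[OF assms(3)] assms)

definition normal :: "(bool \<times> word) list \<Rightarrow> int \<times> (bool \<times> word) list" where
  "normal L = foldr (\<lambda>s. push (fst s) (snd s)) L (0, [])"

text \<open>A nonzero exponent may still denote the identity, so the remaining power is compared
  with the empty word. Conjugacy suffices for this, since only the identity is conjugate to the
  identity.\<close>

definition trivial_test :: "(bool \<times> word) list \<Rightarrow> bool" where
  "trivial_test L = (snd (normal L) = [] \<and> conj_test True (c_pow True (fst (normal L))) [])"

text \<open>If both ends lie on the same side, the last syllable is moved to the front and merged
  there. This conjugates the element by that syllable.\<close>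

definition cyclic_step :: "int \<times> (bool \<times> word) list \<Rightarrow> int \<times> (bool \<times> word) list" where
  "cyclic_step p = (case snd p of [] \<Rightarrow> p | t # L \<Rightarrow>
     (case rev (snd p) of [] \<Rightarrow> p | s # R \<Rightarrow>
        if fst t = fst s then push (fst s) (snd s) (fst p, rev R) else p))"

text \<open>The result is never empty: a bare power is presented as a single left syllable, so it
  counts as an element of a factor.\<close>

definition absorb :: "int \<times> (bool \<times> word) list \<Rightarrow> (bool \<times> word) list" where
  "absorb p = (case snd p of [] \<Rightarrow> [(True, c_pow True (fst p))]
     | s # L \<Rightarrow> (fst s, c_pow (fst s) (fst p) @ snd s) # L)"

text \<open>Every unfinished step shortens the list, so its length is a sufficient number of
  iterations.\<close>

definition cyclic_form :: "(bool \<times> word) list \<Rightarrow> (bool \<times> word) list" where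
  "cyclic_form L = (let p = normal L in absorb ((cyclic_step ^^ length (snd p)) p))"

definition inv_word_syllables :: "(bool \<times> word) list \<Rightarrow> (bool \<times> word) list" where
  "inv_word_syllables L = rev (map (\<lambda>s. (fst s, inv_word (snd s))) L)"

text \<open>Sides alternate, so at most one rotation brings a left syllable to the front, where the
  double coset search is available.\<close>

definition orient :: "(bool \<times> word) list \<Rightarrow> (bool \<times> word) list" where
  "orient M = (case M of [] \<Rightarrow> [] | s # L \<Rightarrow> if fst s then s # L else L @ [s])"

text \<open>A power of the amalgamated element conjugating \<open>N\<close> into \<open>M\<close> occurs in one of the finitely
  many solutions of the double coset equation between the first syllables.\<close>
definition edge_conj_test :: "(bool \<times> word) list \<Rightarrow> (bool \<times> word) list \<Rightarrow> bool" where
  "edge_conj_test N M = (case N of [] \<Rightarrow> False | n # N' \<Rightarrow> (case M of [] \<Rightarrow> False | m # M' \<Rightarrow>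
     fst n \<and> list_ex (\<lambda>p. trivial_test ((True, c_pow True (fst p)) # N @
         [(True, inv_word (c_pow True (fst p)))] @ inv_word_syllables M))
       (coset_search (snd n) (snd m))))"

text \<open>In the mixed case the powers conjugate to the left syllable are listed, and their
  exponents are then read in the right factor.\<close>

definition factor_test :: "bool \<times> word \<Rightarrow> bool \<times> word \<Rightarrow> bool" where
  "factor_test m n = (if fst m = fst n then conj_test (fst m) (snd m) (snd n)
     else if fst m then list_ex (\<lambda>k. conj_test False (c_pow False k) (snd n)) (conj_powers (snd m))
     else list_ex (\<lambda>k. conj_test False (c_pow False k) (snd m)) (conj_powers (snd n)))"

text \<open>The empty cases are mere defaults, as \<open>absorb\<close> returns nonempty lists. A
  single syllable is never conjugate to a cyclically reduced list, hence the answer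
  \<open>False\<close>.\<close>

definition decide_conj :: "(bool \<times> word) list \<Rightarrow> (bool \<times> word) list \<Rightarrow> bool" where
  "decide_conj M N = (case M of [] \<Rightarrow> False | m # M' \<Rightarrow> (case N of [] \<Rightarrow> False | n # N' \<Rightarrow>
     if M' = [] \<and> N' = [] then factor_test m n
     else if M' = [] \<or> N' = [] then False
     else list_ex (\<lambda>i. edge_conj_test (rotate i N) (orient M)) [0..<length N]))"

definition conj_alg :: "word \<Rightarrow> word \<Rightarrow> bool" where
  "conj_alg u v = decide_conj (cyclic_form (map letter_syllable u)) (cyclic_form (map letter_syllable v))"

section \<open>Computability of the algorithm\<close>

lemma computable_normal: "computable f \<Longrightarrow> computable (\<lambda>x. normal (f x))"
  unfolding normal_def by (intro oracle_intros computable_push)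

lemma computable_trivial_test: "computable f \<Longrightarrow> computable (\<lambda>x. trivial_test (f x))"
  unfolding trivial_test_def by (intro oracle_intros computable_normal)

lemma computable_cyclic_step:
  assumes "computable f"
  shows "computable (\<lambda>x. cyclic_step (f x))"
  unfolding cyclic_step_def by (intro oracle_intros computable_push computable_compose[OF assms])

lemma computable_absorb:
  assumes "computable f"
  shows "computable (\<lambda>x. absorb (f x))"
  unfolding absorb_def by (intro oracle_intros computable_compose[OF assms])

lemma computable_cyclic_form: "computable f \<Longrightarrow> computable (\<lambda>x. cyclic_form (f x))"
  unfolding cyclic_form_def Let_def
  by (intro oracle_intros computable_absorb computable_cyclic_step computable_normal)

lemma computable_edge_conj_test:
  assumes "computable f" "computable g"
  shows "computable (\<lambda>x. edge_conj_test (f x) (g x))"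
  unfolding edge_conj_test_def inv_word_syllables_def
  by (intro oracle_intros computable_trivial_test computable_compose[OF assms(1)]
      computable_compose[OF assms(2)] assms)

lemma computable_factor_test:
  assumes "computable f" "computable g"
  shows "computable (\<lambda>x. factor_test (f x) (g x))"
  unfolding factor_test_def
  by (intro oracle_intros computable_compose[OF assms(1)] computable_compose[OF assms(2)] assms)

lemma computable_decide_conj:
  assumes "computable f" "computable g"
  shows "computable (\<lambda>x. decide_conj (f x) (g x))"
  unfolding decide_conj_def orient_def
  by (intro oracle_intros computable_factor_test computable_edge_conj_test
      computable_compose[OF assms(1)] computable_compose[OF assms(2)] assms)

lemma computable_conj_alg: "computable (\<lambda>p. conj_alg (fst p) (snd p))"
  unfolding conj_alg_def letter_syllable_def
  by (intro computable_decide_conj computable_cyclic_form oracle_intros)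

subsection \<open>Correctness\<close>

notation prod_syl ("\<pi>")

section \<open>Values of states and the word problem\<close>

definition state_val :: "int \<times> (bool \<times> word) list \<Rightarrow> word set" where
  "state_val p = z [^]\<^bsub>GG\<^esub> fst p \<otimes>\<^bsub>GG\<^esub> \<pi> (elts (snd p))"

definition reduced_state :: "int \<times> (bool \<times> word) list \<Rightarrow> bool" where
  "reduced_state p \<longleftrightarrow> word_syllables (snd p) \<and> reduced (elts (snd p))"

lemma val_carrier [simp]: "reduced_state p \<Longrightarrow> state_val p \<in> carrier GG"
  by (simp add: state_val_def reduced_state_def)

lemma push_correct:
  assumes w: "w \<in> words (P \<sigma>)" and p: "word_syllables (snd p)"
  shows "word_syllables (snd (push \<sigma> w p))"
    and "push_rel \<sigma> (elt (P \<sigma>) w) (fst p, elts (snd p)) (fst (push \<sigma> w p), elts (snd (push \<sigma> w p)))"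
    and "length (snd (push \<sigma> w p)) \<le> Suc (length (snd p))"
proof -
  define q where "q = (case snd p of [] \<Rightarrow> (w @ c_pow \<sigma> (fst p), [])
    | s # L \<Rightarrow> if fst s = \<sigma> then (w @ c_pow \<sigma> (fst p) @ snd s, L) else (w @ c_pow \<sigma> (fst p), s # L))"
  have push: "push \<sigma> w p = (case power_search \<sigma> (fst q) of None \<Rightarrow> (0, (\<sigma>, fst q) # snd q)
      | Some j \<Rightarrow> (j, snd q))"
    unfolding push_def q_def Let_def ..
  have q: "fst q \<in> words (P \<sigma>)" "word_syllables (snd q)" "length (snd q) \<le> length (snd p)"
    using w p by (auto simp: q_def split: list.splits)
  have merge: "merge \<sigma> (elt (P \<sigma>) w) (fst p, elts (snd p)) = (elt (P \<sigma>) (fst q), elts (snd q))"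
    using w p by (cases "snd p") (auto simp: merge_def q_def elt_append monoid.m_assoc)
  show "word_syllables (snd (push \<sigma> w p))" "length (snd (push \<sigma> w p)) \<le> Suc (length (snd p))"
    using q by (auto simp: push split: option.split)
  show "push_rel \<sigma> (elt (P \<sigma>) w) (fst p, elts (snd p)) (fst (push \<sigma> w p), elts (snd (push \<sigma> w p)))"
  proof (cases "power_search \<sigma> (fst q)")
    case None
    then show ?thesis
      using power_search_None[OF q(1)] by (simp add: push push_rel_def merge)
  next
    case (Some j)
    then show ?thesis
      using power_search_Some[OF q(1)] by (simp add: push push_rel_def merge)
  qed
qed

lemma push_good:
  assumes w: "w \<in> words (P \<sigma>)" and p: "reduced_state p"
  shows "reduced_state (push \<sigma> w p)" "state_val (push \<sigma> w p) = \<iota> \<sigma> (elt (P \<sigma>) w) \<otimes>\<^bsub>GG\<^esub> state_val p"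
proof -
  have ws: "word_syllables (snd p)" and red: "reduced (snd (fst p, elts (snd p)))"
    using p by (auto simp: reduced_state_def)
  note r = push_correct(2)[OF w ws]
  show "reduced_state (push \<sigma> w p)"
    using push_correct(1)[OF w ws] push_rel_reduced[OF r red] w by (simp add: reduced_state_def)
  show "state_val (push \<sigma> w p) = \<iota> \<sigma> (elt (P \<sigma>) w) \<otimes>\<^bsub>GG\<^esub> state_val p"
    using push_rel_prod[OF r red] w by (simp add: state_val_def)
qed

lemma normal_correct:
  assumes "word_syllables L"
  shows "reduced_state (normal L)" "state_val (normal L) = \<pi> (elts L)"
proof -
  have "reduced_state (normal L) \<and> state_val (normal L) = \<pi> (elts L)"
    using assms
  proof (induction L)
    case Nil
    then show ?case by (simp add: normal_def reduced_state_def state_val_def)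
  next
    case (Cons s L)
    then have "reduced_state (normal L)" "state_val (normal L) = \<pi> (elts L)" "snd s \<in> words (P (fst s))"
      by auto
    moreover have "normal (s # L) = push (fst s) (snd s) (normal L)"
      by (simp add: normal_def)
    ultimately show ?case by (simp add: push_good del: \<iota>_elt)
  qed
  then show "reduced_state (normal L)" "state_val (normal L) = \<pi> (elts L)" by auto
qed

lemma trivial_test:
  assumes "word_syllables L"
  shows "trivial_test L \<longleftrightarrow> \<pi> (elts L) = \<one>\<^bsub>GG\<^esub>"
proof -
  define k where "k = fst (normal L)"
  define M where "M = snd (normal L)"
  have M: "word_syllables M" "reduced (elts M)" "z [^]\<^bsub>GG\<^esub> k \<otimes>\<^bsub>GG\<^esub> \<pi> (elts M) = \<pi> (elts L)"
    using normal_correct[OF assms] by (simp_all add: reduced_state_def state_val_def k_def M_def)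
  have c: "conj_test True (c_pow True k) [] \<longleftrightarrow> pw True k = \<one>\<^bsub>F True\<^esub>"
    by (simp add: conj_test one_presented[symmetric] group.conjugate_iff_eq_one)
  have e: "pw True k = \<one>\<^bsub>F True\<^esub> \<longleftrightarrow> z [^]\<^bsub>GG\<^esub> k = \<one>\<^bsub>GG\<^esub>"
    using \<iota>_eq[of "pw True k" True "\<one>\<^bsub>F True\<^esub>"] by (simp only: \<iota>_pw \<iota>_one pw_carrier F_closed)
  \<comment> \<open>A trivial product makes \<open>\<pi> (elts M)\<close> a power, and powers have
    empty shape.\<close>
  have "M = []" if "\<pi> (elts L) = \<one>\<^bsub>GG\<^esub>"
  proof -
    have "inv\<^bsub>GG\<^esub> (z [^]\<^bsub>GG\<^esub> k) = inv\<^bsub>GG\<^esub> (z [^]\<^bsub>GG\<^esub> k) \<otimes>\<^bsub>GG\<^esub> (z [^]\<^bsub>GG\<^esub> k \<otimes>\<^bsub>GG\<^esub> \<pi> (elts M))"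
      using M(3) that by simp
    also have "\<dots> = \<pi> (elts M)"
      using M(1) by (simp only: inv_mult_cancel z_carrier int_pow_closed prod_carrier elts_syllables)
    finally have "\<pi> (elts M) = z [^]\<^bsub>GG\<^esub> (- k)" by (simp add: int_pow_neg)
    then have "map fst (elts M) = []"
      using shape_reduced[OF M(2)] shape_z[of "- k"] by simp
    then show ?thesis by simp
  qed
  moreover have "z [^]\<^bsub>GG\<^esub> k = \<pi> (elts L)" if "M = []"
    using M(3) that by simp
  ultimately show ?thesis
    unfolding trivial_test_def k_def[symmetric] M_def[symmetric] c e by auto
qed

text \<open>Length at most one counts as finished, although \<open>cyclic_step\<close> may still
  alter such a state by moving its power across the only syllable.\<close>

definition ends_differ :: "int \<times> (bool \<times> word) list \<Rightarrow> bool" where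
  "ends_differ p \<longleftrightarrow> length (snd p) \<le> 1 \<or> fst (hd (snd p)) \<noteq> fst (last (snd p))"

lemma cyclic_step_snoc:
  assumes "snd p = R @ [s]"
  shows "cyclic_step p = (if fst (hd (snd p)) = fst s then push (fst s) (snd s) (fst p, R) else p)"
  using assms by (cases R) (simp_all add: cyclic_step_def)

text \<open>Finished states stay finished and unfinished ones shrink; these two facts give the bound
  on the number of iterations.\<close>

lemma cyclic_step_correct:
  assumes p: "reduced_state p"
  shows "reduced_state (cyclic_step p)" "conjugate GG (state_val p) (state_val (cyclic_step p))"
    "ends_differ p \<Longrightarrow> ends_differ (cyclic_step p)"
    "\<not> ends_differ p \<Longrightarrow> length (snd (cyclic_step p)) < length (snd p)"
proof -
  have triv: "reduced_state (cyclic_step p) \<and> conjugate GG (state_val p) (state_val (cyclic_step p)) \<and>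
      (ends_differ p \<longrightarrow> ends_differ (cyclic_step p)) \<and>
      (\<not> ends_differ p \<longrightarrow> length (snd (cyclic_step p)) < length (snd p))"
    if "cyclic_step p = p" "ends_differ p"
    using that p by (simp add: conjugate_refl)
  have "reduced_state (cyclic_step p) \<and> conjugate GG (state_val p) (state_val (cyclic_step p)) \<and>
      (ends_differ p \<longrightarrow> ends_differ (cyclic_step p)) \<and>
      (\<not> ends_differ p \<longrightarrow> length (snd (cyclic_step p)) < length (snd p))"
  proof (cases "snd p = [] \<or> fst (hd (snd p)) \<noteq> fst (last (snd p))")
    case True
    then have "cyclic_step p = p"
    proof
      assume "fst (hd (snd p)) \<noteq> fst (last (snd p))"
      then show ?thesis
        by (cases "snd p" rule: rev_cases) (simp_all add: cyclic_step_snoc, simp add: cyclic_step_def)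
    qed (simp add: cyclic_step_def)
    moreover have "ends_differ p" using True by (auto simp: ends_differ_def)
    ultimately show ?thesis by (rule triv)
  next
    case False
    then obtain R s where R: "snd p = R @ [s]" by (cases "snd p" rule: rev_cases) auto
    have hd: "fst (hd (R @ [s])) = fst s" using False by (simp add: R)
    have step: "cyclic_step p = push (fst s) (snd s) (fst p, R)"
      using hd by (simp add: cyclic_step_snoc[OF R] R)
    have s: "snd s \<in> words (P (fst s))" and g: "reduced_state (fst p, R)" and ws: "word_syllables R"
      using p by (auto simp: reduced_state_def R reduced_append)
    have "state_val (cyclic_step p) = \<iota> (fst s) (elt (P (fst s)) (snd s)) \<otimes>\<^bsub>GG\<^esub> state_val (fst p, R)"
      unfolding step by (rule push_good(2)[OF s g])
    also have "\<dots> = \<iota> (fst s) (elt (P (fst s)) (snd s)) \<otimes>\<^bsub>GG\<^esub> state_val p \<otimes>\<^bsub>GG\<^esub>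
        inv\<^bsub>GG\<^esub> \<iota> (fst s) (elt (P (fst s)) (snd s))"
      using s ws by (simp add: state_val_def R m_assoc del: \<iota>_elt)
    finally have "conjugate GG (state_val p) (state_val (cyclic_step p))"
      unfolding conjugate_def using s by (intro bexI[of _ "\<iota> (fst s) (elt (P (fst s)) (snd s))"]) auto
    moreover have "reduced_state (cyclic_step p)" unfolding step by (rule push_good(1)[OF s g])
    moreover have "ends_differ (cyclic_step p)" if "R = []"
      using push_correct(3)[OF s, of "(fst p, R)"] that ws by (simp add: ends_differ_def step)
    moreover have "length (snd (cyclic_step p)) < length (snd p)" if "R \<noteq> []"
    proof -
      have "fst (hd R) = fst s" using hd that by simp
      then have "fst (hd (elts R)) = fst s" using that by (cases R) auto
      then show ?thesis
        using push_rel_length[OF push_correct(2)[OF s, of "(fst p, R)"]] ws that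
        by (simp add: step R)
    qed
    moreover have "\<not> ends_differ p" if "R \<noteq> []"
      using hd that by (cases R) (auto simp: ends_differ_def R)
    moreover have "ends_differ p" if "R = []"
      using that by (simp add: ends_differ_def R)
    ultimately show ?thesis by blast
  qed
  then show "reduced_state (cyclic_step p)" "conjugate GG (state_val p) (state_val (cyclic_step p))"
    "ends_differ p \<Longrightarrow> ends_differ (cyclic_step p)"
    "\<not> ends_differ p \<Longrightarrow> length (snd (cyclic_step p)) < length (snd p)" by auto
qed

lemma cyclic_steps_correct:
  assumes "reduced_state p"
  shows "reduced_state ((cyclic_step ^^ n) p)" "conjugate GG (state_val p) (state_val ((cyclic_step ^^ n) p))"
proof -
  have "reduced_state ((cyclic_step ^^ n) p) \<and> conjugate GG (state_val p) (state_val ((cyclic_step ^^ n) p))"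
  proof (induction n)
    case 0
    then show ?case using assms by (simp add: conjugate_refl)
  next
    case (Suc n)
    then have g: "reduced_state ((cyclic_step ^^ n) p)"
      and c: "conjugate GG (state_val p) (state_val ((cyclic_step ^^ n) p))" by auto
    from conjugate_trans[OF c cyclic_step_correct(2)[OF g]] cyclic_step_correct(1)[OF g] assms
    show ?case by simp
  qed
  then show "reduced_state ((cyclic_step ^^ n) p)" "conjugate GG (state_val p) (state_val ((cyclic_step ^^ n) p))"
    by auto
qed

lemma ends_differ_iterate: "reduced_state p \<Longrightarrow> ends_differ p \<Longrightarrow> ends_differ ((cyclic_step ^^ n) p)"
  by (induction n) (auto intro: cyclic_step_correct(3) cyclic_steps_correct(1))

lemma ends_differ_cyclic_steps:
  "reduced_state p \<Longrightarrow> length (snd p) \<le> n \<Longrightarrow> ends_differ ((cyclic_step ^^ n) p)"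
proof (induction n arbitrary: p)
  case 0
  then show ?case by (simp add: ends_differ_def)
next
  case (Suc n)
  show ?case
  proof (cases "ends_differ p")
    case True
    then show ?thesis using ends_differ_iterate Suc.prems(1) by blast
  next
    case False
    then have "length (snd (cyclic_step p)) \<le> n"
      using cyclic_step_correct(4)[OF Suc.prems(1)] Suc.prems(2) by simp
    then show ?thesis
      using Suc.IH[OF cyclic_step_correct(1)[OF Suc.prems(1)]]
      by (simp add: funpow_Suc_right del: funpow.simps)
  qed
qed

definition conj_ready :: "(bool \<times> word) list \<Rightarrow> bool" where
  "conj_ready M \<longleftrightarrow> word_syllables M \<and> (length M = 1 \<or> cyclic (elts M))"

lemma absorb_correct:
  assumes "reduced_state p" "ends_differ p"
  shows "conj_ready (absorb p)" "\<pi> (elts (absorb p)) = state_val p"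
proof -
  have "conj_ready (absorb p) \<and> \<pi> (elts (absorb p)) = state_val p"
  proof (cases "snd p")
    case Nil
    then show ?thesis
      using \<iota>_pw[of True "fst p"] by (simp add: absorb_def conj_ready_def state_val_def del: \<iota>_elt)
  next
    case (Cons s L)
    have s: "snd s \<in> words (P (fst s))" "elt (P (fst s)) (snd s) \<notin> edge (fst s)"
      and L: "word_syllables L" "reduced (elts L)" "elts L \<noteq> [] \<Longrightarrow> fst (hd (elts L)) \<noteq> fst s"
      using assms(1) by (auto simp: reduced_state_def Cons reduced_Cons)
    have "cyclic (elts (absorb p))" if "L \<noteq> []"
    proof -
      have "fst (last (elts L)) = fst (last L)"
        using that by (induction L rule: rev_induct) auto
      then show ?thesis
        using that s L assms(2)
        by (auto simp: absorb_def Cons cyclic_def reduced_Cons elt_append ends_differ_def)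
    qed
    then have "conj_ready (absorb p)"
      using s L by (cases "L = []") (simp_all add: conj_ready_def absorb_def Cons)
    moreover have "\<pi> (elts (absorb p)) = state_val p"
      using s L by (simp add: absorb_def Cons state_val_def elt_append m_assoc del: \<iota>_elt)
    ultimately show ?thesis ..
  qed
  then show "conj_ready (absorb p)" "\<pi> (elts (absorb p)) = state_val p" by auto
qed

lemma cyclic_form_correct:
  assumes "word_syllables L"
  shows "conj_ready (cyclic_form L)" "conjugate GG (\<pi> (elts L)) (\<pi> (elts (cyclic_form L)))"
proof -
  define p where "p = normal L"
  define q where "q = (cyclic_step ^^ length (snd p)) p"
  have p: "reduced_state p" "state_val p = \<pi> (elts L)"
    unfolding p_def using normal_correct[OF assms] by auto
  have q: "reduced_state q" "conjugate GG (state_val p) (state_val q)" "ends_differ q"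
    unfolding q_def using cyclic_steps_correct[OF p(1)] ends_differ_cyclic_steps[OF p(1)] by auto
  have "cyclic_form L = absorb q"
    by (simp add: cyclic_form_def Let_def p_def q_def)
  then show "conj_ready (cyclic_form L)" "conjugate GG (\<pi> (elts L)) (\<pi> (elts (cyclic_form L)))"
    using absorb_correct[OF q(1,3)] q(2) p(2) by simp_all
qed

section \<open>Correctness of the conjugacy tests\<close>

lemma inv_word_syllables:
  assumes "word_syllables L"
  shows "word_syllables (inv_word_syllables L)"
    and "elts (inv_word_syllables L) = inv_syllables (elts L)"
  using assms by (induction L) (auto simp: inv_word_syllables_def elt_inv_word)

text \<open>Soundness is immediate, since each candidate exponent is verified by the word problem.
  For completeness, the conjugating power is moved into the first syllable of \<open>N\<close>, and
  \<open>equal_heads\<close> turns the comparison of heads into a solution of the double coset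
  equation. The list of solutions is exact here because a head of a reduced list is not a
  power.\<close>

lemma edge_conj_test:
  assumes N: "word_syllables N" "cyclic (elts N)"
    and M: "word_syllables M" "cyclic (elts M)" "fst (hd M)"
  shows "edge_conj_test N M \<longleftrightarrow>
    (\<exists>k::int. \<pi> (elts M) = z [^]\<^bsub>GG\<^esub> k \<otimes>\<^bsub>GG\<^esub> \<pi> (elts N) \<otimes>\<^bsub>GG\<^esub> inv\<^bsub>GG\<^esub> (z [^]\<^bsub>GG\<^esub> k))"
proof -
  have triv: "trivial_test ((True, c_pow True k) # N @ [(True, inv_word (c_pow True k))] @ inv_word_syllables M)
      \<longleftrightarrow> \<pi> (elts M) = z [^]\<^bsub>GG\<^esub> k \<otimes>\<^bsub>GG\<^esub> \<pi> (elts N) \<otimes>\<^bsub>GG\<^esub> inv\<^bsub>GG\<^esub> (z [^]\<^bsub>GG\<^esub> k)" for k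
  proof -
    let ?L = "(True, c_pow True k) # N @ [(True, inv_word (c_pow True k))] @ inv_word_syllables M"
    let ?g = "z [^]\<^bsub>GG\<^esub> k \<otimes>\<^bsub>GG\<^esub> \<pi> (elts N) \<otimes>\<^bsub>GG\<^esub> inv\<^bsub>GG\<^esub> (z [^]\<^bsub>GG\<^esub> k)"
    have "word_syllables ?L" using N M inv_word_syllables(1) by simp
    from trivial_test[OF this] have "trivial_test ?L \<longleftrightarrow> \<pi> (elts ?L) = \<one>\<^bsub>GG\<^esub>" .
    also have "\<pi> (elts ?L) = ?g \<otimes>\<^bsub>GG\<^esub> inv\<^bsub>GG\<^esub> \<pi> (elts M)"
      using N M by (simp add: inv_word_syllables elt_inv_word m_assoc del: \<iota>_elt)
    also have "\<dots> = \<one>\<^bsub>GG\<^esub> \<longleftrightarrow> ?g = \<pi> (elts M)"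
    proof
      assume "?g \<otimes>\<^bsub>GG\<^esub> inv\<^bsub>GG\<^esub> \<pi> (elts M) = \<one>\<^bsub>GG\<^esub>"
      from inv_equality[OF this] show "?g = \<pi> (elts M)"
        using N M by simp
    next
      assume "?g = \<pi> (elts M)"
      then show "?g \<otimes>\<^bsub>GG\<^esub> inv\<^bsub>GG\<^esub> \<pi> (elts M) = \<one>\<^bsub>GG\<^esub>"
        using M by simp
    qed
    finally show ?thesis by auto
  qed
  obtain n N' where n: "N = n # N'" using N by (cases N) (auto simp: cyclic_def)
  obtain m M' where m: "M = m # M'" using M by (cases M) (auto simp: cyclic_def)
  have m1: "fst m" using M m by simp
  have "edge_conj_test N M" if k: "\<pi> (elts M) = z [^]\<^bsub>GG\<^esub> k \<otimes>\<^bsub>GG\<^esub> \<pi> (elts N) \<otimes>\<^bsub>GG\<^esub> inv\<^bsub>GG\<^esub> (z [^]\<^bsub>GG\<^esub> k)" for k :: int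
  proof -
    let ?n = "elt (P (fst n)) (snd n)" and ?m = "elt (P (fst m)) (snd m)"
    let ?N = "(fst n, pw (fst n) k \<otimes>\<^bsub>F (fst n)\<^esub> ?n) # elts N'"
    have wn: "snd n \<in> words (P (fst n))" "word_syllables N'" and wm: "snd m \<in> words (P (fst m))"
      using N M by (simp_all add: n m)
    have red: "reduced ?N" "reduced (elts M)"
      using N(2) M(2) wn unfolding cyclic_def by (auto simp: n reduced_Cons)
    \<comment> \<open>The left power joins the first syllable and the inverse power stays on the
      right, which is the form required by \<open>shape_right\<close> and
      \<open>equal_heads\<close>.\<close>
    have eq: "\<pi> (elts M) = \<pi> ?N \<otimes>\<^bsub>GG\<^esub> z [^]\<^bsub>GG\<^esub> (- k)"
      unfolding k using wn by (simp add: n m_assoc int_pow_neg del: \<iota>_elt)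
    then have "map fst (elts M) = map fst ?N"
      using shape_reduced[OF red(2)] shape_right[OF red(1), of "- k"] by simp
    then have n1: "fst n" using m1 by (simp add: m)
    obtain s where s: "?m = pw True k \<otimes>\<^bsub>F True\<^esub> ?n \<otimes>\<^bsub>F True\<^esub> pw True s"
      using equal_heads[of True ?m "elts M'" "pw True k \<otimes>\<^bsub>F True\<^esub> ?n" "elts N'" "- k"]
        red eq m1 n1 by (auto simp: m)
    have "?n \<notin> edge True" using N(2) n1 by (auto simp: cyclic_def n reduced_Cons)
    then have "(k, s) \<in> set (coset_search (snd n) (snd m))"
      using coset_search[of "snd n" "snd m"] wn wm n1 m1 s by simp
    then show ?thesis
      using n1 triv[of k] k by (auto simp: edge_conj_test_def n m list_ex_iff intro!: bexI[of _ "(k, s)"])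
  qed
  moreover have "\<exists>k::int. \<pi> (elts M) = z [^]\<^bsub>GG\<^esub> k \<otimes>\<^bsub>GG\<^esub> \<pi> (elts N) \<otimes>\<^bsub>GG\<^esub> inv\<^bsub>GG\<^esub> (z [^]\<^bsub>GG\<^esub> k)"
    if test: "edge_conj_test N M"
  proof -
    obtain p where "trivial_test ((True, c_pow True (fst p)) # N @
        [(True, inv_word (c_pow True (fst p)))] @ inv_word_syllables M)"
      using test by (auto simp: edge_conj_test_def list_ex_iff split: list.splits)
    then show ?thesis using triv by blast
  qed
  ultimately show ?thesis by blast
qed

lemma orient_correct:
  assumes "word_syllables M" "cyclic (elts M)"
  shows "word_syllables (orient M)" "cyclic (elts (orient M))" "fst (hd (orient M))"
    "conjugate GG (\<pi> (elts M)) (\<pi> (elts (orient M)))"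
proof -
  obtain s L where M: "M = s # L" using assms by (cases M) (auto simp: cyclic_def)
  have "word_syllables (orient M) \<and> cyclic (elts (orient M)) \<and> fst (hd (orient M)) \<and>
    conjugate GG (\<pi> (elts M)) (\<pi> (elts (orient M)))"
  proof (cases "fst s")
    case True
    then have "orient M = M" by (simp add: orient_def M)
    then show ?thesis using assms True conjugate_refl by (simp add: M)
  next
    case False
    then have o: "orient M = rotate 1 M" by (simp add: orient_def M)
    obtain t L' where L: "L = t # L'" using assms by (cases L) (auto simp: cyclic_def M)
    have "fst t" using assms False by (auto simp: cyclic_def M L reduced_Cons)
    then have "fst (hd (rotate 1 M))" by (simp add: M L)
    then show ?thesis
      unfolding o using assms conjugate_rotate[of "elts M" 1]
      by (simp only: word_syllables_simps elts_simps cyclic_rotate elts_syllables simp_thms)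
  qed
  then show "word_syllables (orient M)" "cyclic (elts (orient M))" "fst (hd (orient M))"
    "conjugate GG (\<pi> (elts M)) (\<pi> (elts (orient M)))" by auto
qed

text \<open>The list contains every conjugate power, but possibly under an exponent other than
  \<open>k\<close>. By \<open>h_pow_eq\<close> both exponents give the same power in the right
  factor.\<close>

lemma conj_powers_test:
  assumes u: "u \<in> words (P True)" and v: "v \<in> words (P False)"
  shows "list_ex (\<lambda>k. conj_test False (c_pow False k) v) (conj_powers u) \<longleftrightarrow>
    (\<exists>k. conjugate (F True) (elt (P True) u) (pw True k) \<and> conjugate (F False) (pw False k) (elt (P False) v))"
proof -
  have test: "conj_test False (c_pow False k) v \<longleftrightarrow> conjugate (F False) (pw False k) (elt (P False) v)" for k
    using v by (simp add: conj_test)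
  have "\<exists>j\<in>set (conj_powers u). conjugate (F False) (pw False j) (elt (P False) v)"
    if "conjugate (F True) (elt (P True) u) (pw True k)" "conjugate (F False) (pw False k) (elt (P False) v)" for k
  proof -
    have "pw True k \<in> (\<lambda>k. pw True k) ` set (conj_powers u)"
      unfolding conj_powers[OF u] using that(1) by simp
    then obtain j where j: "j \<in> set (conj_powers u)" "pw True k = pw True j" by auto
    then have "pw False k = pw False j" using h_pow_eq by blast
    then show ?thesis using j(1) that(2) by auto
  qed
  moreover have "conjugate (F True) (elt (P True) u) (pw True k)" if "k \<in> set (conj_powers u)" for k
    using imageI[OF that, of "\<lambda>k. pw True k"] unfolding conj_powers[OF u] by simp
  ultimately show ?thesis
    unfolding list_ex_iff test by blast
qed

lemma factor_test:
  assumes m: "snd m \<in> words (P (fst m))" and n: "snd n \<in> words (P (fst n))"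
  shows "factor_test m n \<longleftrightarrow>
    factor_conj (fst m) (elt (P (fst m)) (snd m)) (fst n) (elt (P (fst n)) (snd n))"
proof -
  consider "fst m = fst n" | "fst m" "\<not> fst n" | "\<not> fst m" "fst n" by auto
  then show ?thesis
  proof cases
    case 1
    then show ?thesis using m n by (simp add: factor_test_def factor_conj_same conj_test)
  next
    case 2
    then show ?thesis
      using m n conj_powers_test[of "snd m" "snd n"] by (simp add: factor_test_def factor_conj_def)
  next
    case 3
    have sym: "conjugate (F \<sigma>) x y \<longleftrightarrow> conjugate (F \<sigma>) y x" if "x \<in> carrier (F \<sigma>)" "y \<in> carrier (F \<sigma>)" for \<sigma> x y
      using group.conjugate_sym[OF group_F] that by blast
    have "factor_test m n \<longleftrightarrow> (\<exists>k. conjugate (F True) (elt (P True) (snd n)) (pw True k) \<and>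
        conjugate (F False) (pw False k) (elt (P False) (snd m)))"
      using 3 m n conj_powers_test[of "snd n" "snd m"] by (simp add: factor_test_def)
    also have "\<dots> \<longleftrightarrow> (\<exists>k. conjugate (F False) (elt (P False) (snd m)) (pw False k) \<and>
        conjugate (F True) (pw True k) (elt (P True) (snd n)))"
      using 3 m n sym[of "elt (P True) (snd n)" True] sym[of "elt (P False) (snd m)" False] by auto
    finally show ?thesis using 3 by (simp add: factor_conj_def)
  qed
qed

lemma decide_conj:
  assumes M: "conj_ready M" and N: "conj_ready N"
  shows "decide_conj M N \<longleftrightarrow> conjugate GG (\<pi> (elts M)) (\<pi> (elts N))"
proof -
  have ws [simp]: "word_syllables M" "word_syllables N" using M N by (auto simp: conj_ready_def)
  have ne: "M \<noteq> []" "N \<noteq> []" using M N by (auto simp: conj_ready_def cyclic_def)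
  then obtain m M' n N' where mn: "M = m # M'" "N = n # N'" by (metis neq_Nil_conv)
  have sym: "conjugate GG (\<pi> (elts M)) (\<pi> (elts N)) \<longleftrightarrow> conjugate GG (\<pi> (elts N)) (\<pi> (elts M))"
    using conjugate_sym[of "\<pi> (elts M)" "\<pi> (elts N)"] conjugate_sym[of "\<pi> (elts N)" "\<pi> (elts M)"]
    by auto
  have cyc: "L \<noteq> []" if "cyclic (elts (s # L))" for s L
    using that by (auto simp: cyclic_def)
  consider "M' = []" "N' = []" | "M' = []" "cyclic (elts N)" | "cyclic (elts M)" "N' = []"
    | "cyclic (elts M)" "cyclic (elts N)"
    using M N by (auto simp: conj_ready_def mn)
  then show ?thesis
  proof cases
    case 1
    then have "\<pi> (elts M) = \<iota> (fst m) (elt (P (fst m)) (snd m))"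
      "\<pi> (elts N) = \<iota> (fst n) (elt (P (fst n)) (snd n))"
      using ws by (simp_all add: mn del: \<iota>_elt)
    moreover have "decide_conj M N = factor_test m n" using 1 by (simp add: decide_conj_def mn)
    ultimately show ?thesis
      using ws factor_test[of m n] conjugate_factor[of "elt (P (fst m)) (snd m)" "fst m" "elt (P (fst n)) (snd n)" "fst n"]
      by (simp add: mn del: \<iota>_elt)
  next
    case 2
    then have "\<not> decide_conj M N" using cyc[of n N'] by (simp add: decide_conj_def mn)
    moreover have "\<pi> (elts M) = \<iota> (fst m) (elt (P (fst m)) (snd m))"
      using 2 ws by (simp add: mn del: \<iota>_elt)
    ultimately show ?thesis
      using ws not_conjugate_factor_cyclic[OF _ 2(2), of "elt (P (fst m)) (snd m)" "fst m"]
      by (simp add: mn del: \<iota>_elt)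
  next
    case 3
    then have "\<not> decide_conj M N" using cyc[of m M'] by (simp add: decide_conj_def mn)
    moreover have "\<pi> (elts N) = \<iota> (fst n) (elt (P (fst n)) (snd n))"
      using 3 ws by (simp add: mn del: \<iota>_elt)
    ultimately show ?thesis
      unfolding sym using ws not_conjugate_factor_cyclic[OF _ 3(1), of "elt (P (fst n)) (snd n)" "fst n"]
      by (simp add: mn del: \<iota>_elt)
  next
    case 4
    note o = orient_correct[OF ws(1) 4(1)]
    let ?O = "orient M"
    have "M' \<noteq> []" "N' \<noteq> []" using 4 cyc mn by blast+
    then have "decide_conj M N \<longleftrightarrow> list_ex (\<lambda>i. edge_conj_test (rotate i N) ?O) [0..<length N]"
      by (simp add: decide_conj_def mn del: upt_Suc)
    also have "\<dots> \<longleftrightarrow> (\<exists>i<length N. edge_conj_test (rotate i N) ?O)"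
      by (auto simp: list_ex_iff)
    \<comment> \<open>Rotation has period \<open>length N\<close>, so the finitely many tested
      rotations are all of them.\<close>
    also have "\<dots> \<longleftrightarrow> (\<exists>i. edge_conj_test (rotate i N) ?O)"
      using ne(2) by (metis length_greater_0_conv mod_less_divisor rotate_conv_mod)
    also have "\<dots> \<longleftrightarrow> (\<exists>i (k::int). \<pi> (elts ?O) =
        z [^]\<^bsub>GG\<^esub> k \<otimes>\<^bsub>GG\<^esub> \<pi> (rotate i (elts N)) \<otimes>\<^bsub>GG\<^esub> inv\<^bsub>GG\<^esub> (z [^]\<^bsub>GG\<^esub> k))"
      using edge_conj_test[OF _ _ o(1-3)] 4 by simp
    also have "\<dots> \<longleftrightarrow> conjugate GG (\<pi> (elts N)) (\<pi> (elts ?O))"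
      using conjugate_cyclic[OF 4(2) o(2)] by blast
    also have "\<dots> \<longleftrightarrow> conjugate GG (\<pi> (elts N)) (\<pi> (elts M))"
    proof
      assume "conjugate GG (\<pi> (elts N)) (\<pi> (elts ?O))"
      from conjugate_trans[OF this conjugate_sym[OF o(4)]]
      show "conjugate GG (\<pi> (elts N)) (\<pi> (elts M))" by simp
    next
      assume "conjugate GG (\<pi> (elts N)) (\<pi> (elts M))"
      from conjugate_trans[OF this o(4)]
      show "conjugate GG (\<pi> (elts N)) (\<pi> (elts ?O))" by simp
    qed
    finally show ?thesis unfolding sym .
  qed
qed

theorem conj_alg:
  assumes u: "u \<in> words am" and v: "v \<in> words am"
  shows "conj_alg u v \<longleftrightarrow> conjugate GG (elt am u) (elt am v)"
proof -
  note lu = letters_word_syllables[OF u] and lv = letters_word_syllables[OF v]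
  note cu = cyclic_form_correct[OF lu] and cv = cyclic_form_correct[OF lv]
  have eu: "elt am u = \<pi> (elts (map letter_syllable u))" "elt am v = \<pi> (elts (map letter_syllable v))"
    using elt_flat[OF lu] elt_flat[OF lv] by (simp_all only: flat_letters)
  have c: "\<pi> (elts (map letter_syllable u)) \<in> carrier GG" "\<pi> (elts (map letter_syllable v)) \<in> carrier GG"
    "\<pi> (elts (cyclic_form (map letter_syllable u))) \<in> carrier GG"
    "\<pi> (elts (cyclic_form (map letter_syllable v))) \<in> carrier GG"
    using lu lv cu(1) cv(1) by (auto simp: conj_ready_def)
  show ?thesis
    unfolding conj_alg_def decide_conj[OF cu(1) cv(1)] eu
  proof
    assume "conjugate GG (\<pi> (elts (cyclic_form (map letter_syllable u))))
      (\<pi> (elts (cyclic_form (map letter_syllable v))))"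
    from conjugate_trans[OF conjugate_trans[OF cu(2) this] conjugate_sym[OF cv(2)]] c
    show "conjugate GG (\<pi> (elts (map letter_syllable u))) (\<pi> (elts (map letter_syllable v)))"
      by simp
  next
    assume "conjugate GG (\<pi> (elts (map letter_syllable u))) (\<pi> (elts (map letter_syllable v)))"
    from conjugate_trans[OF conjugate_trans[OF conjugate_sym[OF cu(2)] this] cv(2)] c
    show "conjugate GG (\<pi> (elts (cyclic_form (map letter_syllable u))))
      (\<pi> (elts (cyclic_form (map letter_syllable v))))"
      by simp
  qed
qed

theorem solvable_conjugacy_amalgam: "solvable_conjugacy_problem am"
proof -
  obtain f where f: "recursive_fun f" "\<And>p. f (encode p) = encode (conj_alg (fst p) (snd p))"
    using computable_conj_alg unfolding computable_def by blast
  have "f (prod_encode (word_code u, word_code v)) = (if conjugate GG (elt am u) (elt am v) then 1 else 0)"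
    if "u \<in> words am" "v \<in> words am" for u v
    using f(2)[of "(u, v)"] conj_alg[OF that] by (simp add: word_code_eq_encode)
  then show ?thesis unfolding solvable_conjugacy_problem_def using f(1) by blast
qed

end

section \<open>Algorithms in the factors\<close>

text \<open>The isomorphism sends each power of \<open>x\<close> to the same power of
  \<open>y\<close>, so its injectivity makes equations between exponents agree on both sides. In
  this form it is passed to the amalgam locale.\<close>

lemma iso_pow_eq:
  assumes "group G" "group H" "x \<in> carrier G" "y \<in> carrier H"
    and \<phi>: "\<phi> \<in> iso (subgroup_generated G {x}) (subgroup_generated H {y})" "\<phi> x = y"
  shows "x [^]\<^bsub>G\<^esub> (i::int) = x [^]\<^bsub>G\<^esub> (j::int) \<longleftrightarrow> y [^]\<^bsub>H\<^esub> i = y [^]\<^bsub>H\<^esub> j"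
proof -
  interpret G: group G by fact
  interpret H: group H by fact
  let ?G = "subgroup_generated G {x}" and ?H = "subgroup_generated H {y}"
  have x: "x \<in> carrier ?G" and y: "y \<in> carrier ?H"
    using assms(3,4) by (auto simp: carrier_subgroup_generated intro: generate.incl)
  have hom: "\<phi> \<in> hom ?G ?H" and inj: "inj_on \<phi> (carrier ?G)"
    using \<phi>(1) by (auto simp: iso_def bij_betw_def)
  have "\<phi> (x [^]\<^bsub>G\<^esub> k) = y [^]\<^bsub>H\<^esub> k" for k :: int
    using hom_int_pow[OF hom x, of k] x y \<phi>(2) by (simp add: G.int_pow_subgroup_generated H.int_pow_subgroup_generated)
  moreover have "x [^]\<^bsub>G\<^esub> k \<in> carrier ?G" for k :: int
    using group.int_pow_closed[OF G.group_subgroup_generated x, of k] x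
    by (simp add: G.int_pow_subgroup_generated)
  ultimately show ?thesis using inj by (metis inj_onD)
qed

text \<open>The given function may take any value on lists that are not words of \<open>P\<close>.
  Reading nonzero as true yields a total Boolean test, and a case distinction brings its code back
  to zero or one.\<close>

lemma conj_oracle:
  assumes "solvable_conjugacy_problem P"
  obtains t where "computable (\<lambda>p. t (fst p) (snd p))"
    "\<And>u v. u \<in> words P \<Longrightarrow> v \<in> words P \<Longrightarrow>
      t u v \<longleftrightarrow> conjugate (presented_group P) (elt P u) (elt P v)"
proof -
  obtain f where f: "recursive_fun f" "\<And>u v. u \<in> words P \<Longrightarrow> v \<in> words P \<Longrightarrow>
      f (prod_encode (word_code u, word_code v)) =
        (if conjugate (presented_group P) (elt P u) (elt P v) then 1 else 0)"
    using assms unfolding solvable_conjugacy_problem_def by blast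
  define t where "t u v \<longleftrightarrow> f (encode (u, v)) \<noteq> 0" for u v :: word
  have "computable (\<lambda>p. t (fst p) (snd p))"
  proof (rule computableI[OF recursive_fun_case_nat[OF recursive_fun_const recursive_fun_const f(1)]])
    show "(case f (encode p) of 0 \<Rightarrow> 0 | Suc k \<Rightarrow> 1) = encode (t (fst p) (snd p))" for p
      by (auto simp: t_def split: nat.split)
  qed
  moreover have "t u v \<longleftrightarrow> conjugate (presented_group P) (elt P u) (elt P v)"
    if "u \<in> words P" "v \<in> words P" for u v
    using f(2)[OF that] by (simp add: t_def word_code_eq_encode)
  ultimately show ?thesis by (rule that)
qed

text \<open>The output convention is the encoding of \<open>int option\<close>, and every number
  encodes such a value, so the given function computes the search as it stands. In the same way
  every number encodes a list in the next two lemmas.\<close>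

lemma power_oracle:
  assumes "power_search_solvable P h"
  obtains s :: "word \<Rightarrow> int option" where "computable s"
    "\<And>w. w \<in> words P \<Longrightarrow> s w = None \<Longrightarrow> elt P w \<notin> powers (presented_group P) h"
    "\<And>w k. w \<in> words P \<Longrightarrow> s w = Some k \<Longrightarrow> elt P w = h [^]\<^bsub>presented_group P\<^esub> k"
proof -
  obtain f where f: "recursive_fun f" "\<And>w. w \<in> words P \<Longrightarrow>
      if elt P w \<in> powers (presented_group P) h
      then \<exists>k::int. f (word_code w) = Suc (int_encode k) \<and> elt P w = h [^]\<^bsub>presented_group P\<^esub> k
      else f (word_code w) = 0"
    using assms unfolding power_search_solvable_def by blast
  define s where "s w = (case f (encode w) of 0 \<Rightarrow> None | Suc k \<Rightarrow> Some (int_decode k))" for w :: word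
  have "computable s"
    by (rule computableI[OF f(1)]) (simp add: s_def encode_int_def split: nat.split)
  moreover have "s w = None \<and> elt P w \<notin> powers (presented_group P) h \<or>
      (\<exists>k. s w = Some k \<and> elt P w = h [^]\<^bsub>presented_group P\<^esub> k)" if w: "w \<in> words P" for w
  proof (cases "elt P w \<in> powers (presented_group P) h")
    case True
    then obtain k :: int where k: "f (word_code w) = Suc (int_encode k)" "elt P w = h [^]\<^bsub>presented_group P\<^esub> k"
      using f(2)[OF w] by (simp only: if_True) blast
    have "s w = Some k" by (simp add: s_def word_code_eq_encode[symmetric] k(1))
    then show ?thesis using k(2) by blast
  next
    case False
    then have "f (word_code w) = 0" using f(2)[OF w] by (simp only: if_False)
    then show ?thesis using False by (simp add: s_def word_code_eq_encode)
  qed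
  ultimately show ?thesis using that by (metis option.distinct(1) option.inject)
qed

lemma conj_powers_oracle:
  assumes "conjugate_power_search_solvable P h"
  obtains t :: "word \<Rightarrow> int list" where "computable t"
    "\<And>w. w \<in> words P \<Longrightarrow> (\<lambda>k. h [^]\<^bsub>presented_group P\<^esub> k) ` set (t w) =
      {x \<in> powers (presented_group P) h. conjugate (presented_group P) (elt P w) x}"
proof -
  obtain f where f: "recursive_fun f" "\<And>w. w \<in> words P \<Longrightarrow>
      \<exists>ks :: int list. f (word_code w) = list_encode (map int_encode ks) \<and>
        (\<lambda>k. h [^]\<^bsub>presented_group P\<^esub> k) ` set ks =
          {x \<in> powers (presented_group P) h. conjugate (presented_group P) (elt P w) x}"
    using assms unfolding conjugate_power_search_solvable_def Let_def by blast
  define t where "t w = map int_decode (list_decode (f (encode w)))" for w :: word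
  have "computable t"
    by (rule computableI[OF f(1)]) (simp add: t_def encode_list_def encode_int_def comp_def)
  moreover have "(\<lambda>k. h [^]\<^bsub>presented_group P\<^esub> k) ` set (t w) =
      {x \<in> powers (presented_group P) h. conjugate (presented_group P) (elt P w) x}"
    if w: "w \<in> words P" for w
  proof -
    obtain ks :: "int list" where ks: "f (word_code w) = list_encode (map int_encode ks)"
      "(\<lambda>k. h [^]\<^bsub>presented_group P\<^esub> k) ` set ks =
        {x \<in> powers (presented_group P) h. conjugate (presented_group P) (elt P w) x}"
      using f(2)[OF w] by blast
    have "t w = ks" by (simp add: t_def word_code_eq_encode[symmetric] ks(1) comp_def)
    then show ?thesis using ks(2) by simp
  qed
  ultimately show ?thesis by (rule that)
qed

lemma double_coset_oracle:
  assumes "double_coset_search_solvable P h"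
  obtains t :: "word \<Rightarrow> word \<Rightarrow> (int \<times> int) list" where "computable (\<lambda>p. t (fst p) (snd p))"
    "\<And>u v. u \<in> words P \<Longrightarrow> v \<in> words P \<Longrightarrow> elt P u \<notin> powers (presented_group P) h \<Longrightarrow>
      set (t u v) = {(r, s). h [^]\<^bsub>presented_group P\<^esub> r \<otimes>\<^bsub>presented_group P\<^esub> elt P u
        \<otimes>\<^bsub>presented_group P\<^esub> h [^]\<^bsub>presented_group P\<^esub> s = elt P v}"
proof -
  let ?S = "\<lambda>u v. {(r :: int, s :: int). h [^]\<^bsub>presented_group P\<^esub> r \<otimes>\<^bsub>presented_group P\<^esub> elt P u
        \<otimes>\<^bsub>presented_group P\<^esub> h [^]\<^bsub>presented_group P\<^esub> s = elt P v}"
  obtain f where f: "recursive_fun f" "\<And>u v. u \<in> words P \<Longrightarrow> v \<in> words P \<Longrightarrow>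
      (elt P u \<notin> powers (presented_group P) h \<longrightarrow> finite (?S u v)) \<and>
      (\<exists>L. f (prod_encode (word_code u, word_code v)) =
          list_encode (map (\<lambda>(r, s). prod_encode (int_encode r, int_encode s)) L) \<and>
        set L \<subseteq> ?S u v \<and> (?S u v \<noteq> {} \<longrightarrow> L \<noteq> []) \<and> (finite (?S u v) \<longrightarrow> set L = ?S u v))"
    using assms unfolding double_coset_search_solvable_def Let_def by blast
  define t where "t u v = map (\<lambda>m. (int_decode (fst (prod_decode m)), int_decode (snd (prod_decode m))))
      (list_decode (f (encode (u, v))))" for u v :: word
  have "computable (\<lambda>p. t (fst p) (snd p))"
    by (rule computableI[OF f(1)])
      (simp add: t_def encode_list_def encode_prod_def encode_int_def comp_def)
  moreover have "set (t u v) = ?S u v"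
    if uv: "u \<in> words P" "v \<in> words P" "elt P u \<notin> powers (presented_group P) h" for u v
  proof -
    obtain L where L: "f (prod_encode (word_code u, word_code v)) =
          list_encode (map (\<lambda>(r, s). prod_encode (int_encode r, int_encode s)) L)" "set L = ?S u v"
      using f(2)[OF uv(1,2)] uv(3) by blast
    have "t u v = L"
      using L(1) by (simp add: t_def word_code_eq_encode comp_def split_def)
    then show ?thesis using L(2) by simp
  qed
  ultimately show ?thesis by (rule that)
qed

text \<open>If \<open>w\<close> is a power, it is conjugate to itself and, by non-self-conjugacy, to
  no other power. The list is then nonempty and all its exponents denote \<open>w\<close>, so trying
  the first one suffices. The trial is a word problem, solved by testing conjugacy to the empty
  word.\<close>

lemma power_search_from_conj_powers:
  fixes ks :: "word \<Rightarrow> int list"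
  assumes g: "g \<in> words P" and nsc: "non_self_conjugate (presented_group P) (elt P g)"
    and t: "computable (\<lambda>p. t (fst p) (snd p))"
      "\<And>u v. u \<in> words P \<Longrightarrow> v \<in> words P \<Longrightarrow>
        t u v \<longleftrightarrow> conjugate (presented_group P) (elt P u) (elt P v)"
    and ks: "computable ks" "\<And>w. w \<in> words P \<Longrightarrow>
      (\<lambda>k. elt P g [^]\<^bsub>presented_group P\<^esub> k) ` set (ks w) =
        {x \<in> powers (presented_group P) (elt P g). conjugate (presented_group P) (elt P w) x}"
  obtains s :: "word \<Rightarrow> int option" where "computable s"
    "\<And>w. w \<in> words P \<Longrightarrow> s w = None \<Longrightarrow> elt P w \<notin> powers (presented_group P) (elt P g)"
    "\<And>w k. w \<in> words P \<Longrightarrow> s w = Some k \<Longrightarrow> elt P w = elt P g [^]\<^bsub>presented_group P\<^esub> k"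
proof -
  interpret group "presented_group P" by (rule group_presented_group)
  let ?G = "presented_group P"
  define s where "s w = (case ks w of [] \<Rightarrow> None
    | k # _ \<Rightarrow> if t (w @ inv_word (word_pow g k)) [] then Some k else None)" for w
  have t': "computable u \<Longrightarrow> computable (\<lambda>x. t (u x) [])" for u :: "(word \<times> int \<times> int list) \<Rightarrow> word"
    using computable_compose[OF t(1) computable_Pair[OF _ computable_const], of u "[]"] by simp
  have "computable (\<lambda>w. s w)"
    unfolding s_def by (intro computable_intros t' computable_compose[OF ks(1)])
  moreover have test: "t (w @ inv_word (word_pow g k)) [] \<longleftrightarrow> elt P w = elt P g [^]\<^bsub>?G\<^esub> k"
    if w: "w \<in> words P" for w k
  proof -
    have "t (w @ inv_word (word_pow g k)) [] \<longleftrightarrow>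
        conjugate ?G (elt P w \<otimes>\<^bsub>?G\<^esub> inv\<^bsub>?G\<^esub> (elt P g [^]\<^bsub>?G\<^esub> k)) \<one>\<^bsub>?G\<^esub>"
      using w g by (simp add: t(2) word_pow elt_append elt_inv_word one_presented)
    also have "\<dots> \<longleftrightarrow> elt P w \<otimes>\<^bsub>?G\<^esub> inv\<^bsub>?G\<^esub> (elt P g [^]\<^bsub>?G\<^esub> k) = \<one>\<^bsub>?G\<^esub>"
      using w g by (intro conjugate_iff_eq_one) simp
    also have "\<dots> \<longleftrightarrow> elt P w = elt P g [^]\<^bsub>?G\<^esub> k"
    proof
      assume "elt P w \<otimes>\<^bsub>?G\<^esub> inv\<^bsub>?G\<^esub> (elt P g [^]\<^bsub>?G\<^esub> k) = \<one>\<^bsub>?G\<^esub>"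
      from inv_equality[OF this] show "elt P w = elt P g [^]\<^bsub>?G\<^esub> k"
        using w g by simp
    qed (use g in simp)
    finally show ?thesis .
  qed
  moreover have "elt P w \<notin> powers ?G (elt P g)" if w: "w \<in> words P" and None: "s w = None" for w
  proof
    assume p: "elt P w \<in> powers ?G (elt P g)"
    then have "elt P w \<in> (\<lambda>k. elt P g [^]\<^bsub>?G\<^esub> k) ` set (ks w)"
      unfolding ks(2)[OF w] using w by (simp add: conjugate_refl)
    then obtain k l where k: "ks w = k # l" by (cases "ks w") auto
    then have "elt P g [^]\<^bsub>?G\<^esub> k \<in> (\<lambda>k. elt P g [^]\<^bsub>?G\<^esub> k) ` set (ks w)" by simp
    then have "elt P g [^]\<^bsub>?G\<^esub> k \<in> powers ?G (elt P g)" "conjugate ?G (elt P w) (elt P g [^]\<^bsub>?G\<^esub> k)"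
      unfolding ks(2)[OF w] by auto
    then have "elt P w = elt P g [^]\<^bsub>?G\<^esub> k"
      using nsc p unfolding non_self_conjugate_def by blast
    then show False using None test[OF w, of k] by (simp add: s_def k)
  qed
  moreover have "elt P w = elt P g [^]\<^bsub>?G\<^esub> k" if "w \<in> words P" "s w = Some k" for w k
    using that test by (auto simp: s_def split: list.splits if_splits)
  ultimately show ?thesis using that by blast
qed

theorem mainTheorem3:
  fixes A B :: presentation and a b :: word
  assumes "wf_presentation A" and "wf_presentation B"
    and "a \<in> words A" and "b \<in> words B"
    and "solvable_conjugacy_problem A" and "solvable_conjugacy_problem B"
    and "super_critical A (elt A a)"
    and "non_self_conjugate (presented_group B) (elt B b)"
    and "power_search_solvable B (elt B b)"
    and "\<exists>\<phi> \<in> iso (subgroup_generated (presented_group A) {elt A a})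
                   (subgroup_generated (presented_group B) {elt B b}).
           \<phi> (elt A a) = elt B b"
  shows "solvable_conjugacy_problem (amalgam A a B b)"
proof -
  have nsc: "non_self_conjugate (presented_group A) (elt A a)"
    and cps: "conjugate_power_search_solvable A (elt A a)"
    and dcs: "double_coset_search_solvable A (elt A a)"
    using assms(7) by (auto simp: super_critical_def)
  obtain tA where tA: "computable (\<lambda>p. tA (fst p) (snd p))"
    "\<And>u v. u \<in> words A \<Longrightarrow> v \<in> words A \<Longrightarrow>
      tA u v \<longleftrightarrow> conjugate (presented_group A) (elt A u) (elt A v)"
    using conj_oracle[OF assms(5)] by blast
  obtain tB where tB: "computable (\<lambda>p. tB (fst p) (snd p))"
    "\<And>u v. u \<in> words B \<Longrightarrow> v \<in> words B \<Longrightarrow>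
      tB u v \<longleftrightarrow> conjugate (presented_group B) (elt B u) (elt B v)"
    using conj_oracle[OF assms(6)] by blast
  obtain sB :: "word \<Rightarrow> int option" where sB: "computable sB"
    "\<And>w. w \<in> words B \<Longrightarrow> sB w = None \<Longrightarrow> elt B w \<notin> powers (presented_group B) (elt B b)"
    "\<And>w k. w \<in> words B \<Longrightarrow> sB w = Some k \<Longrightarrow> elt B w = elt B b [^]\<^bsub>presented_group B\<^esub> k"
    using power_oracle[OF assms(9)] by blast
  obtain ks :: "word \<Rightarrow> int list" where ks: "computable ks"
    "\<And>w. w \<in> words A \<Longrightarrow> (\<lambda>k. elt A a [^]\<^bsub>presented_group A\<^esub> k) ` set (ks w) =
      {x \<in> powers (presented_group A) (elt A a). conjugate (presented_group A) (elt A w) x}"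
    using conj_powers_oracle[OF cps] by blast
  obtain dc :: "word \<Rightarrow> word \<Rightarrow> (int \<times> int) list" where dc: "computable (\<lambda>p. dc (fst p) (snd p))"
    "\<And>u v. u \<in> words A \<Longrightarrow> v \<in> words A \<Longrightarrow> elt A u \<notin> powers (presented_group A) (elt A a) \<Longrightarrow>
      set (dc u v) = {(r, s). elt A a [^]\<^bsub>presented_group A\<^esub> r \<otimes>\<^bsub>presented_group A\<^esub> elt A u
        \<otimes>\<^bsub>presented_group A\<^esub> elt A a [^]\<^bsub>presented_group A\<^esub> s = elt A v}"
    using double_coset_oracle[OF dcs] by blast
  obtain sA :: "word \<Rightarrow> int option" where sA: "computable sA"
    "\<And>w. w \<in> words A \<Longrightarrow> sA w = None \<Longrightarrow> elt A w \<notin> powers (presented_group A) (elt A a)"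
    "\<And>w k. w \<in> words A \<Longrightarrow> sA w = Some k \<Longrightarrow> elt A w = elt A a [^]\<^bsub>presented_group A\<^esub> k"
    using power_search_from_conj_powers[OF assms(3) nsc tA ks] by blast
  define P where "P \<sigma> = (if \<sigma> then A else B)" for \<sigma>
  define c where "c \<sigma> = (if \<sigma> then a else b)" for \<sigma>
  define t where "t \<sigma> = (if \<sigma> then tA else tB)" for \<sigma>
  define s where "s \<sigma> = (if \<sigma> then sA else sB)" for \<sigma>
  have P [simp]: "P True = A" "P False = B" "c True = a" "c False = b"
    "t True = tA" "t False = tB" "s True = sA" "s False = sB"
    by (simp_all add: P_def c_def t_def s_def)
  obtain \<phi> where "\<phi> \<in> iso (subgroup_generated (presented_group A) {elt A a})
      (subgroup_generated (presented_group B) {elt B b})" "\<phi> (elt A a) = elt B b"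
    using assms(10) by blast
  note pow = iso_pow_eq[OF group_presented_group group_presented_group elt_carrier[OF assms(3)]
      elt_carrier[OF assms(4)] this]
  interpret amalgam_oracles P c t s ks dc
  proof unfold_locales
    fix \<sigma> \<tau> u v w and i j :: int
    show "wf_presentation (P \<sigma>)" "c \<sigma> \<in> words (P \<sigma>)"
      "non_self_conjugate (presented_group (P \<sigma>)) (elt (P \<sigma>) (c \<sigma>))"
      using assms nsc by (cases \<sigma>; simp)+
    show "elt (P \<tau>) (c \<tau>) [^]\<^bsub>presented_group (P \<tau>)\<^esub> i = elt (P \<tau>) (c \<tau>) [^]\<^bsub>presented_group (P \<tau>)\<^esub> j"
      if "elt (P \<sigma>) (c \<sigma>) [^]\<^bsub>presented_group (P \<sigma>)\<^esub> i = elt (P \<sigma>) (c \<sigma>) [^]\<^bsub>presented_group (P \<sigma>)\<^esub> j"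
      using that pow[of i j] by (cases \<sigma>; cases \<tau>) simp_all
    show "t \<sigma> u v \<longleftrightarrow> conjugate (presented_group (P \<sigma>)) (elt (P \<sigma>) u) (elt (P \<sigma>) v)"
      if "u \<in> words (P \<sigma>)" "v \<in> words (P \<sigma>)"
      using that tA(2) tB(2) by (cases \<sigma>) simp_all
    show "elt (P \<sigma>) w \<notin> powers (presented_group (P \<sigma>)) (elt (P \<sigma>) (c \<sigma>))"
      if "w \<in> words (P \<sigma>)" "s \<sigma> w = None"
      using that sA(2) sB(2) by (cases \<sigma>) simp_all
    show "elt (P \<sigma>) w = elt (P \<sigma>) (c \<sigma>) [^]\<^bsub>presented_group (P \<sigma>)\<^esub> i"
      if "w \<in> words (P \<sigma>)" "s \<sigma> w = Some i"
      using that sA(3) sB(3) by (cases \<sigma>) simp_all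
    show "computable (\<lambda>p. t \<sigma> (fst p) (snd p))" "computable (s \<sigma>)"
      using tA(1) tB(1) sA(1) sB(1) by (cases \<sigma>; simp)+
  qed (use ks dc in simp_all)
  have "am = amalgam A a B b" by (simp add: am_def)
  then show ?thesis using solvable_conjugacy_amalgam by simp
qed

end
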